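(* Let $\mathfrak{r}_\ast\in\mathfrak{R}$ satisfy $|\mathfrak{r}_\ast|=P-1$, let $i(\mathfrak{r}_\ast)$ denote the index of the unique coordinate of $\mathfrak{r}_\ast$ that equals zero, and let $c$ be the constant corresponding to $\mathfrak{r}_\ast$ in the assumption (S) on the model selection procedure $\hat{\mathfrak{r}}$ (see context). Suppose that $AQ^{-1}e_{i(\mathfrak{r}_\ast)}\neq0$, where $e_{i(\mathfrak{r}_\ast)}$ is the $i(\mathfrak{r}_\ast)$-th standard basis vector in $\mathbb{R}^P$ (i.e., $A\tilde\theta(\mathfrak{r}_{full})$ and $\tilde\theta_{i(\mathfrak{r}_\ast)}(\mathfrak{r}_{full})$ are asymptotically correlated). Then for every $\theta\in M_{\mathfrak{r}_\ast}$ which has exactly $P-1$ non-zero coordinates, every $\sigma$ with $0<\sigma<\infty$, and every $t\in\mathbb{R}^k$ the following holds: There exist $\delta_0>0$ and $\rho_0$, $0<\rho_0<\infty$, such that any estimator $\hat K_n(t)$ of $K_{n,\theta,\sigma}(t)$ satisfying $$P_{n,\theta,\sigma}\left(\left|\hat K_n(t)-K_{n,\theta,\sigma}(t)\right|>\delta\right)\xrightarrow{n\to\infty}0\quad\text{for each }\delta>0$$ (in particular, every estimator that is consistent) also satisfies $$\sup_{\vartheta\in\mathbb{R}^P,\ \|\vartheta-\theta\|<\rho_0/\sqrt n}P_{n,\vartheta,\sigma}\left(\left|\hat K_n(t)-K_{n,\vartheta,\sigma}(t)\right|>\delta_0\right)\xrightarrow{n\to\infty}1 .$$ The constants $\delta_0$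 and $\rho_0$ may be chosen in such a way that they depend only on $t,Q,A,\sigma$, and $c$. Moreover, $$\liminf_{n\to\infty}\ \inf_{\hat K_n(t)}\ \sup_{\vartheta\in\mathbb{R}^P,\ \|\vartheta-\theta\|<\rho_0/\sqrt n}P_{n,\vartheta,\sigma}\left(\left|\hat K_n(t)-K_{n,\vartheta,\sigma}(t)\right|>\delta_0\right)>0$$ and $$\sup_{\delta>0}\ \liminf_{n\to\infty}\ \inf_{\hat K_n(t)}\ \sup_{\vartheta\in\mathbb{R}^P,\ \|\vartheta-\theta\|<\rho_0/\sqrt n}P_{n,\vartheta,\sigma}\left(\left|\hat K_n(t)-K_{n,\vartheta,\sigma}(t)\right|>\delta\right)\ge\frac12$$ hold, where the infima extend over all estimators $\hat K_n(t)$ of $K_{n,\theta,\sigma}(t)$.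
   Context: Model. Fix $P\ge1$. For each sample size $n>P$ one observes $Y=X\theta+u$, where $X$ is a non-stochastic $n\times P$ matrix of rank $P$ (its elements may depend on $n$), $\theta\in\mathbb{R}^P$, and $u\sim N(0,\sigma^2I_n)$ with $0<\sigma<\infty$. $P_{n,\theta,\sigma}$ is the distribution of the sample $Y$ of size $n$. It is assumed that $Q=\lim_{n\to\infty}X'X/n$ exists and is non-singular. $\|\cdot\|$ is the Euclidean norm. Candidate models. For $\mathfrak{r}\in\{0,1\}^P$ let $M_{\mathfrak{r}}=\{\theta\in\mathbb{R}^P:\theta_i(1-\mathfrak{r}_i)=0\text{ for }1\le i\le P\}$, let $|\mathfrak{r}|$ be the number of non-zero coordinates of $\mathfrak{r}$, and let $\tilde\theta(\mathfrak{r})\in\mathbb{R}^P$ be the restricted least-squares estimator of $\theta$ based on the model $M_{\mathfrak{r}}$ (with $\tilde\theta(\mathfrak{r})=0$ if $\mathfrak{r}=(0,\dots,0)$). Let $\mathfrak{r}_{full}=(1,\dots,1)$. $\mathfrak{R}\subseteq\{0,1\}^P$ is a given set that contains $\mathfrak{r}_{full}$ and at least one element $\mathfrak{r}_\ast$ with $|\mathfrak{r}_\ast|=P-1$. Model selection procedure. $\hat{\mathfrak{r}}=\hat{\mathfrak{r}}(Y,X)$ is a (measurable) random variable with values in $\mathfrak{R}$, for each $n$, satisfying the following assumption. (S): For every $\mathfrak{r}_\ast\in\mathfrak{R}$ with $|\mathfrak{r}_\ast|=P-1$ there exists a positive finite constant $c$ (possibly depending on $\mathfrak{r}_\ast$)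 such that for every $\theta\in M_{\mathfrak{r}_\ast}$ which has exactly $P-1$ non-zero coordinates and every $0<\sigma<\infty$, $$\lim_{n\to\infty}P_{n,\theta,\sigma}\left(\{\hat{\mathfrak{r}}=\mathfrak{r}_{full}\}\,\triangle\,\{|T_{\mathfrak{r}_\ast}|\ge c\}\right)=\lim_{n\to\infty}P_{n,\theta,\sigma}\left(\{\hat{\mathfrak{r}}=\mathfrak{r}_\ast\}\,\triangle\,\{|T_{\mathfrak{r}_\ast}|<c\}\right)=0,$$ where $\triangle$ is the symmetric difference and $T_{\mathfrak{r}_\ast}$ is the usual $t$-statistic for testing $\theta_{i}=0$, $i=i(\mathfrak{r}_\ast)$ being the index of the unique zero coordinate of $\mathfrak{r}_\ast$, in the full model; that is, $T_{\mathfrak{r}_\ast}=\sqrt n\,\tilde\theta_i(\mathfrak{r}_{full})\big/\left(\hat\sigma\,([(X'X/n)^{-1}]_{i,i})^{1/2}\right)$ with $\hat\sigma^2=(n-P)^{-1}\|Y-X\tilde\theta(\mathfrak{r}_{full})\|^2$. Target. The post-model-selection estimator is $\bar\theta=\sum_{\mathfrak{r}\in\mathfrak{R}}\tilde\theta(\mathfrak{r})\mathbf{1}(\hat{\mathfrak{r}}=\mathfrak{r})$. $A$ is a non-stochastic $k\times P$ matrix of rank $k$, $1\le k\le P$, and $K_{n,\theta,\sigma}(t)=P_{n,\theta,\sigma}\left(\sqrt nA(\bar\theta-\theta)\le t\right)$, $t\in\mathbb{R}^k$ (componentwise inequality). Estimators. For fixed $t$, an estimator $\hat K_n(t)$ of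 $K_{n,\theta,\sigma}(t)$ is any real-valued (measurable) function of $(Y,X)$, for each $n$; it is not required to be the value at $t$ of an estimated cdf nor to lie in $[0,1]$. *)

theory Defs
  imports "HOL-Probability.Probability"
begin

(* Encodings.  The coordinates of R^P are indexed by the finite type 'p, P = CARD('p).
   X n i (for i < n) is the i-th row of the n x P design matrix of sample size n; rows i >= n
   are never used.  A sample of size n is a function y :: nat => real, restricted to {..<n}.
   An element r of {0,1}^P is given by its support, a subset of 'p: |r| is card r and
   r_full is UNIV. *)

definition sample_space :: "nat \<Rightarrow> (nat \<Rightarrow> real) measure" where
  "sample_space n = Pi\<^sub>M {..<n} (\<lambda>_. borel)"

(* N(X theta, sigma^2 I_n): independent coordinates; normal_density takes the
   standard deviation as its second argument. *)
definition sample_law ::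
    "(nat \<Rightarrow> nat \<Rightarrow> real^'p) \<Rightarrow> nat \<Rightarrow> real^'p \<Rightarrow> real \<Rightarrow> (nat \<Rightarrow> real) measure" where
  "sample_law X n \<theta> \<sigma> = Pi\<^sub>M {..<n} (\<lambda>i. density lborel (normal_density (X n i \<bullet> \<theta>) \<sigma>))"

(* X'X / n *)
definition scaled_gram :: "(nat \<Rightarrow> nat \<Rightarrow> real^'p) \<Rightarrow> nat \<Rightarrow> real^'p^'p" where
  "scaled_gram X n = (\<chi> a b. (\<Sum>i<n. X n i $ a * X n i $ b) / real n)"

definition design :: "(nat \<Rightarrow> nat \<Rightarrow> real^'p) \<Rightarrow> real^'p^'p \<Rightarrow> bool" where
  "design X Q \<longleftrightarrow>
     (\<forall>n>CARD('p). dim (X n ` {..<n}) = CARD('p)) \<and>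
     (\<lambda>n. scaled_gram X n) \<longlonglongrightarrow> Q \<and> invertible Q"

definition model :: "'p set \<Rightarrow> (real^'p) set" where
  "model r = {\<theta>. \<forall>i. i \<notin> r \<longrightarrow> \<theta> $ i = 0}"

definition rss :: "(nat \<Rightarrow> nat \<Rightarrow> real^'p) \<Rightarrow> nat \<Rightarrow> (nat \<Rightarrow> real) \<Rightarrow> real^'p \<Rightarrow> real" where
  "rss X n y \<theta> = (\<Sum>i<n. (y i - X n i \<bullet> \<theta>)\<^sup>2)"

(* The minimizer is unique whenever the design matrix has rank P, in particular for n > P. *)
definition restricted_lse ::
    "(nat \<Rightarrow> nat \<Rightarrow> real^'p) \<Rightarrow> nat \<Rightarrow> 'p set \<Rightarrow> (nat \<Rightarrow> real) \<Rightarrow> real^'p" where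
  "restricted_lse X n r y = arg_min_on (rss X n y) (model r)"

definition sigma_hat ::
    "(nat \<Rightarrow> nat \<Rightarrow> real^'p) \<Rightarrow> nat \<Rightarrow> (nat \<Rightarrow> real) \<Rightarrow> real" where
  "sigma_hat X n y =
     sqrt (rss X n y (restricted_lse X n UNIV y) / (real n - real CARD('p)))"

(* Only meaningful if exactly one coordinate is outside r, i.e. |r| = P - 1. *)
definition zero_index :: "'p set \<Rightarrow> 'p" where
  "zero_index r = (THE i. i \<notin> r)"

definition t_stat ::
    "(nat \<Rightarrow> nat \<Rightarrow> real^'p) \<Rightarrow> nat \<Rightarrow> 'p set \<Rightarrow> (nat \<Rightarrow> real) \<Rightarrow> real" where
  "t_stat X n r y =
     (let i = zero_index r in
        sqrt (real n) * restricted_lse X n UNIV y $ i /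
        (sigma_hat X n y * sqrt (matrix_inv (scaled_gram X n) $ i $ i)))"

definition candidate_models :: "'p::finite set set \<Rightarrow> bool" where
  "candidate_models R \<longleftrightarrow> UNIV \<in> R \<and> (\<exists>r\<in>R. card r = CARD('p) - 1)"

definition selection_procedure ::
    "'p::finite set set \<Rightarrow> (nat \<Rightarrow> (nat \<Rightarrow> real) \<Rightarrow> 'p set) \<Rightarrow> bool" where
  "selection_procedure R rhat \<longleftrightarrow>
     (\<forall>n>CARD('p). rhat n \<in> sample_space n \<rightarrow>\<^sub>M count_space UNIV \<and>
                   (\<forall>y\<in>space (sample_space n). rhat n y \<in> R))"

definition one_zero_point :: "'p set \<Rightarrow> real^'p \<Rightarrow> bool" where
  "one_zero_point r \<theta> \<longleftrightarrow> \<theta> \<in> model r \<and> card {i. \<theta> $ i \<noteq> 0} = CARD('p) - 1"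

(* The property that assumption (S) requires of the constant c belonging to r. *)
definition S_constant ::
    "(nat \<Rightarrow> nat \<Rightarrow> real^'p) \<Rightarrow> (nat \<Rightarrow> (nat \<Rightarrow> real) \<Rightarrow> 'p set) \<Rightarrow> 'p set \<Rightarrow> real \<Rightarrow> bool" where
  "S_constant X rhat r c \<longleftrightarrow> c > 0 \<and>
     (\<forall>\<theta> \<sigma>. one_zero_point r \<theta> \<and> 0 < \<sigma> \<longrightarrow>
        (\<lambda>n. measure (sample_law X n \<theta> \<sigma>)
               (sym_diff {y \<in> space (sample_space n). rhat n y = UNIV}
                         {y \<in> space (sample_space n). \<bar>t_stat X n r y\<bar> \<ge> c})) \<longlonglongrightarrow> 0 \<and>
        (\<lambda>n. measure (sample_law X n \<theta> \<sigma>)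
               (sym_diff {y \<in> space (sample_space n). rhat n y = r}
                         {y \<in> space (sample_space n). \<bar>t_stat X n r y\<bar> < c})) \<longlonglongrightarrow> 0)"

definition assumption_S ::
    "(nat \<Rightarrow> nat \<Rightarrow> real^'p) \<Rightarrow> 'p set set \<Rightarrow> (nat \<Rightarrow> (nat \<Rightarrow> real) \<Rightarrow> 'p set) \<Rightarrow> bool" where
  "assumption_S X R rhat \<longleftrightarrow>
     (\<forall>r\<in>R. card r = CARD('p) - 1 \<longrightarrow> (\<exists>c. S_constant X rhat r c))"

definition post_selection_estimator ::
    "(nat \<Rightarrow> nat \<Rightarrow> real^'p) \<Rightarrow> 'p set set \<Rightarrow> (nat \<Rightarrow> (nat \<Rightarrow> real) \<Rightarrow> 'p set) \<Rightarrow>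
     nat \<Rightarrow> (nat \<Rightarrow> real) \<Rightarrow> real^'p" where
  "post_selection_estimator X R rhat n y =
     (\<Sum>r\<in>R. if rhat n y = r then restricted_lse X n r y else 0)"

(* K_{n,theta,sigma}(t); the order on real^'k is componentwise. *)
definition pms_cdf ::
    "(nat \<Rightarrow> nat \<Rightarrow> real^'p) \<Rightarrow> 'p set set \<Rightarrow> (nat \<Rightarrow> (nat \<Rightarrow> real) \<Rightarrow> 'p set) \<Rightarrow>
     real^'p^'k \<Rightarrow> nat \<Rightarrow> real^'p \<Rightarrow> real \<Rightarrow> real^'k \<Rightarrow> real" where
  "pms_cdf X R rhat A n \<theta> \<sigma> t =
     measure (sample_law X n \<theta> \<sigma>)
       {y \<in> space (sample_space n).
          sqrt (real n) *\<^sub>R (A *v (post_selection_estimator X R rhat n y - \<theta>)) \<le> t}"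

(* Estimators at sample size n; the design is non-stochastic and hence suppressed
   as an argument. *)
definition estimators :: "nat \<Rightarrow> ((nat \<Rightarrow> real) \<Rightarrow> real) set" where
  "estimators n = borel_measurable (sample_space n)"

definition error_prob ::
    "(nat \<Rightarrow> nat \<Rightarrow> real^'p) \<Rightarrow> 'p set set \<Rightarrow> (nat \<Rightarrow> (nat \<Rightarrow> real) \<Rightarrow> 'p set) \<Rightarrow>
     real^'p^'k \<Rightarrow> real^'k \<Rightarrow> real \<Rightarrow> nat \<Rightarrow> ((nat \<Rightarrow> real) \<Rightarrow> real) \<Rightarrow> real \<Rightarrow> real^'p \<Rightarrow> real" where
  "error_prob X R rhat A t \<sigma> n K \<delta> \<theta> =
     measure (sample_law X n \<theta> \<sigma>)
       {y \<in> space (sample_space n). \<bar>K y - pms_cdf X R rhat A n \<theta> \<sigma> t\<bar> > \<delta>}"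

(* Supremum of the error probability over the open ball of radius rho / sqrt n around theta;
   taken in ereal, so that suprema, infima and liminf are those of a complete lattice. *)
definition local_sup_error ::
    "(nat \<Rightarrow> nat \<Rightarrow> real^'p) \<Rightarrow> 'p set set \<Rightarrow> (nat \<Rightarrow> (nat \<Rightarrow> real) \<Rightarrow> 'p set) \<Rightarrow>
     real^'p^'k \<Rightarrow> real^'k \<Rightarrow> real \<Rightarrow> real^'p \<Rightarrow> real \<Rightarrow>
     nat \<Rightarrow> ((nat \<Rightarrow> real) \<Rightarrow> real) \<Rightarrow> real \<Rightarrow> ereal" where
  "local_sup_error X R rhat A t \<sigma> \<theta> \<rho> n K \<delta> =
     (SUP \<eta>\<in>{\<eta>. norm (\<eta> - \<theta>) < \<rho> / sqrt (real n)}. ereal (error_prob X R rhat A t \<sigma> n K \<delta> \<eta>))"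

end

theory Submission
  imports Defs "HOL-Real_Asymp.Real_Asymp"
begin

text \<open>
  Let \<open>i\<close> be the coordinate that \<open>r\<close> excludes, and move the parameter from \<open>\<theta>\<close> to the local alternatives
  \<open>\<theta> + (\<nu> / sqrt n) e\<^sub>i\<close>. Two facts are in conflict. The laws of the sample at these parameters stay
  so close that no estimator can tell them apart reliably, whereas the distribution function of the
  post-model-selection estimator changes with \<open>\<nu>\<close> even in the limit.

  \<^emph>\<open>The laws are close.\<close> The samples are Gaussian with means at bounded distance, so the likelihood ratio has
  a bounded second moment, which tends to \<open>1\<close> as the alternatives approach each other
  (\<open>normal_product_shift\<close>, \<open>local_shift\<close>). If the estimand takes values more than \<open>2 \<delta>\<close> apart at two such
  parameters, no estimator is within \<open>\<delta>\<close> of both (\<open>two_point_bound\<close>). The three claims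
  follow: an estimator consistent at \<open>\<theta>\<close> keeps its value under the alternatives and fails there, no
  estimator can have small error probabilities at both points, and for two points that are
  close to each other one of these probabilities is nearly \<open>1 / 2\<close>.

  \<^emph>\<open>The limit.\<close> Assumption (S), carried over to the alternatives by contiguity, replaces the selection
  procedure by the pretest that compares the \<open>t\<close>-statistic with \<open>c\<close> (\<open>pms_cdf_pretest\<close>), and consistency of
  the variance estimate replaces \<open>sigma_hat\<close> by \<open>\<sigma>\<close> (\<open>sigma_hat_consistent\<close>, \<open>pretest_known_variance\<close>). What
  remains is a functional of the error of the full least squares estimator, which is a linear image of a
  standard Gaussian vector of dimension \<open>P\<close> (\<open>iid_normal_linear_combination\<close>, by rotation invariance). Its
  covariance matrix converges to \<open>\<sigma>\<^sup>2 Q\<^sup>-\<^sup>1\<close>, and the distribution functions converge to \<open>limit_cdf\<close>, except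
  possibly at finitely many \<open>\<nu>\<close> (\<open>pms_cdf_tendsto\<close>).

  \<^emph>\<open>The limit is not constant.\<close> Let \<open>Z\<close> be the limit of the error and \<open>b = Q\<^sup>-\<^sup>1 e\<^sub>i / (Q\<^sup>-\<^sup>1)\<^sub>i\<^sub>i\<close>. Then
  \<open>Z - Z\<^sub>i b\<close> is independent of \<open>Z\<^sub>i\<close>. With \<open>V = A (Z - Z\<^sub>i b)\<close>, \<open>d = A b\<close> and \<open>H x = P (V \<le> t + x d)\<close> the
  limit is the mean of \<open>H x\<close> over a Gaussian variable \<open>x\<close>, except that \<open>H x\<close> is replaced by \<open>H \<nu>\<close> in the window
  \<open>\<bar>x - \<nu>\<bar> < s\<close>. Were it constant in \<open>\<nu>\<close>, then \<open>H\<close> would agree with its own averages over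
  the windows. The averaging operator is reversible, so \<open>H\<close> would be constant almost everywhere
  (\<open>window_average_not_constant\<close>). But \<open>d \<noteq> 0\<close>, which is the hypothesis on \<open>A Q\<^sup>-\<^sup>1 e\<^sub>i\<close>, makes \<open>H\<close> vanish at one end
  of the line, and its mean \<open>P (A Z \<le> t)\<close> is positive because \<open>A\<close> has full rank
  (\<open>limit_cdf_not_constant\<close>).
\<close>

section \<open>Gaussian measures\<close>

lemma PiM_density:
  fixes M :: "'i \<Rightarrow> 'a measure"
  assumes I: "finite I" and sf: "\<And>i. sigma_finite_measure (M i)"
    and f[measurable]: "\<And>i. f i \<in> borel_measurable (M i)"
    and sfd: "\<And>i. sigma_finite_measure (density (M i) (f i))"
  shows "PiM I (\<lambda>i. density (M i) (f i)) = density (PiM I M) (\<lambda>x. \<Prod>i\<in>I. f i (x i))"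
proof -
  interpret M: product_sigma_finite M by (simp add: product_sigma_finite_def sf)
  interpret D: product_sigma_finite "\<lambda>i. density (M i) (f i)"
    by (simp add: product_sigma_finite_def sfd)
  have f'[measurable]: "(\<lambda>x. \<Prod>i\<in>I. f i (x i)) \<in> borel_measurable (PiM I M)"
    by (intro borel_measurable_prod_ennreal) simp
  show ?thesis
  proof (rule D.PiM_eqI[symmetric])
    fix A assume A: "\<And>i. i \<in> I \<Longrightarrow> A i \<in> sets (density (M i) (f i))"
    then have A'[measurable]: "\<And>i. i \<in> I \<Longrightarrow> A i \<in> sets (M i)" by simp
    have [measurable]: "Pi\<^sub>E I A \<in> sets (PiM I M)" using I A' by (rule sets_PiM_I_finite)
    have "emeasure (density (PiM I M) (\<lambda>x. \<Prod>i\<in>I. f i (x i))) (Pi\<^sub>E I A)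
       = (\<integral>\<^sup>+x. (\<Prod>i\<in>I. f i (x i)) * indicator (Pi\<^sub>E I A) x \<partial>PiM I M)"
      by (simp add: emeasure_density)
    also have "\<dots> = (\<integral>\<^sup>+x. (\<Prod>i\<in>I. f i (x i) * indicator (A i) (x i)) \<partial>PiM I M)"
    proof (rule nn_integral_cong)
      fix x assume "x \<in> space (PiM I M)"
      then have x: "x \<in> extensional I" by (simp add: space_PiM PiE_def)
      have "indicator (Pi\<^sub>E I A) x = (\<Prod>i\<in>I. indicator (A i) (x i) :: ennreal)"
      proof (cases "x \<in> Pi\<^sub>E I A")
        case True
        then have "\<And>i. i \<in> I \<Longrightarrow> x i \<in> A i" by auto
        then have "(\<Prod>i\<in>I. indicator (A i) (x i) :: ennreal) = (\<Prod>i\<in>I. 1)"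
          by (intro prod.cong) auto
        then show ?thesis using True by simp
      next
        case False
        then obtain i where "i \<in> I" "x i \<notin> A i" using x by (auto simp: PiE_iff)
        then have "(\<Prod>i\<in>I. indicator (A i) (x i) :: ennreal) = 0"
          using I by (intro prod_zero bexI[of _ i]) (auto simp: indicator_def)
        then show ?thesis using False by simp
      qed
      then show "(\<Prod>i\<in>I. f i (x i)) * indicator (Pi\<^sub>E I A) x
          = (\<Prod>i\<in>I. f i (x i) * indicator (A i) (x i))"
        by (simp add: prod.distrib)
    qed
    also have "\<dots> = (\<Prod>i\<in>I. \<integral>\<^sup>+y. f i y * indicator (A i) y \<partial>M i)"
      using I by (rule M.product_nn_integral_prod) measurable
    also have "\<dots> = (\<Prod>i\<in>I. emeasure (density (M i) (f i)) (A i))"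
      by (intro prod.cong refl) (simp add: emeasure_density)
    finally show "emeasure (density (PiM I M) (\<lambda>x. \<Prod>i\<in>I. f i (x i))) (Pi\<^sub>E I A)
      = (\<Prod>i\<in>I. emeasure (density (M i) (f i)) (A i))" .
  qed (use I in \<open>simp_all cong: sets_PiM_cong\<close>)
qed

definition std_gauss :: "'a::euclidean_space measure" where
  "std_gauss = density lborel (\<lambda>x. \<Prod>b\<in>Basis. ennreal (std_normal_density (x \<bullet> b)))"

lemma sets_std_gauss[simp, measurable_cong]: "sets std_gauss = sets borel"
  and space_std_gauss[simp]: "space std_gauss = UNIV"
  by (simp_all add: std_gauss_def)

lemma nn_integral_std_normal: "(\<integral>\<^sup>+x. ennreal (std_normal_density x) \<partial>lborel) = 1"
  using prob_space.emeasure_space_1[OF prob_space_normal_density[of 1 0]]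
  by (simp add: emeasure_density)

lemma prob_space_std_gauss: "prob_space (std_gauss :: 'a::euclidean_space measure)"
proof
  have "emeasure (std_gauss :: 'a measure) UNIV
      = (\<integral>\<^sup>+x. (\<Prod>b\<in>Basis. ennreal (std_normal_density ((x :: 'a) \<bullet> b))) \<partial>lborel)"
    by (simp add: std_gauss_def emeasure_density)
  also have "\<dots> = (\<Prod>b\<in>(Basis::'a set). \<integral>\<^sup>+x. ennreal (std_normal_density x) \<partial>lborel)"
    by (rule nn_integral_lborel_prod) auto
  finally show "emeasure (std_gauss :: 'a measure) (space std_gauss) = 1"
    by (simp add: nn_integral_std_normal)
qed

definition gauss_density :: "'a::euclidean_space \<Rightarrow> real" where
  "gauss_density x = (1 / sqrt (2 * pi)) ^ DIM('a) * exp (- (norm x)\<^sup>2 / 2)"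

lemma gauss_density_eq_prod: "gauss_density x = (\<Prod>b\<in>Basis. std_normal_density (x \<bullet> b))"
proof -
  have "(\<Prod>b\<in>Basis. std_normal_density (x \<bullet> b))
      = (1 / sqrt (2 * pi)) ^ DIM('a) * exp (\<Sum>b\<in>Basis. - (x \<bullet> b)\<^sup>2 / 2)"
    by (simp only: std_normal_density_def prod.distrib exp_sum finite_Basis prod_constant)
  also have "(\<Sum>b\<in>Basis. - (x \<bullet> b)\<^sup>2 / 2) = - (norm x)\<^sup>2 / 2"
    by (simp add: norm_eq_sqrt_inner euclidean_inner[of x x] sum_nonneg power2_eq_square
        sum_negf sum_divide_distrib)
  finally show ?thesis by (simp add: gauss_density_def)
qed

lemma gauss_density_pos: "gauss_density x > 0"
  by (simp add: gauss_density_def)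

lemma borel_measurable_gauss_density[measurable]: "gauss_density \<in> borel_measurable borel"
  unfolding gauss_density_def[abs_def] by measurable

lemma std_gauss_eq_density: "std_gauss = density lborel (\<lambda>x. ennreal (gauss_density x))"
  by (simp add: std_gauss_def gauss_density_eq_prod prod_ennreal)

lemma nn_integral_gauss_density: "(\<integral>\<^sup>+x. ennreal (gauss_density (x :: 'a::euclidean_space)) \<partial>lborel) = 1"
  using prob_space.emeasure_space_1[OF prob_space_std_gauss[where 'a='a]]
  by (simp add: std_gauss_eq_density emeasure_density)

lemma nn_integral_lborel_translate:
  fixes f :: "'a::euclidean_space \<Rightarrow> ennreal"
  assumes [measurable]: "f \<in> borel_measurable borel"
  shows "(\<integral>\<^sup>+x. f (c + x) \<partial>lborel) = (\<integral>\<^sup>+x. f x \<partial>lborel)"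
proof -
  have "(\<integral>\<^sup>+x. f x \<partial>lborel) = (\<integral>\<^sup>+x. f x \<partial>distr lborel borel ((+) c))"
    by (simp add: lborel_distr_plus)
  also have "\<dots> = (\<integral>\<^sup>+x. f (c + x) \<partial>lborel)"
    by (subst nn_integral_distr) auto
  finally show ?thesis ..
qed

text \<open>Smoothing an indicator with a rotationally symmetric density of total mass one and using
  Fubini reduces invariance under isometries to invariance under translations.\<close>
lemma lborel_orthogonal_invariant:
  fixes T :: "'a::euclidean_space \<Rightarrow> 'a"
  assumes T: "orthogonal_transformation T"
  shows "distr lborel borel T = lborel"
proof (rule measure_eqI)
  have lin: "linear T" using T by (rule orthogonal_transformation_linear)
  have [measurable]: "T \<in> borel \<rightarrow>\<^sub>M borel"
    using lin by (intro borel_measurable_continuous_onI linear_continuous_on)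
      (simp add: linear_linear)
  fix A :: "'a set" assume "A \<in> sets (distr lborel borel T)"
  then have A[measurable]: "A \<in> sets borel" by simp
  define F :: "'a \<Rightarrow> ennreal" where "F = indicator A"
  have [measurable]: "F \<in> borel_measurable borel" unfolding F_def by simp
  let ?g = "\<lambda>x::'a. ennreal (gauss_density x)"
  have surj: "surj T" using T by (rule orthogonal_transformation_surj)
  have "emeasure (distr lborel borel T) A = (\<integral>\<^sup>+x. F (T x) \<partial>lborel)"
    using nn_integral_distr[of T lborel borel F] by (simp add: F_def)
  also have "\<dots> = (\<integral>\<^sup>+y. ?g y * (\<integral>\<^sup>+x. F (T x) \<partial>lborel) \<partial>lborel)"
    by (simp add: nn_integral_multc nn_integral_gauss_density)
  also have "\<dots> = (\<integral>\<^sup>+y. ?g y * (\<integral>\<^sup>+x. F (T x + y) \<partial>lborel) \<partial>lborel)"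
  proof (rule nn_integral_cong)
    fix y
    obtain z where z: "y = T z" using surj by (metis surjD)
    have "(\<integral>\<^sup>+x. F (T x + y) \<partial>lborel) = (\<integral>\<^sup>+x. F (T (z + x)) \<partial>lborel)"
      using lin by (simp add: z linear_add add.commute)
    also have "\<dots> = (\<integral>\<^sup>+x. F (T x) \<partial>lborel)"
      by (rule nn_integral_lborel_translate[of "\<lambda>x. F (T x)"]) measurable
    finally show "?g y * (\<integral>\<^sup>+x. F (T x) \<partial>lborel) = ?g y * (\<integral>\<^sup>+x. F (T x + y) \<partial>lborel)"
      by simp
  qed
  also have "\<dots> = (\<integral>\<^sup>+y. \<integral>\<^sup>+x. ?g y * F (T x + y) \<partial>lborel \<partial>lborel)"
    by (intro nn_integral_cong nn_integral_cmult[symmetric]) measurable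
  also have "\<dots> = (\<integral>\<^sup>+x. \<integral>\<^sup>+y. ?g y * F (T x + y) \<partial>lborel \<partial>lborel)"
    by (rule lborel_pair.Fubini') measurable
  also have "\<dots> = (\<integral>\<^sup>+x. \<integral>\<^sup>+y. ?g (y - T x) * F y \<partial>lborel \<partial>lborel)"
  proof (rule nn_integral_cong)
    fix x
    show "(\<integral>\<^sup>+y. ?g y * F (T x + y) \<partial>lborel) = (\<integral>\<^sup>+y. ?g (y - T x) * F y \<partial>lborel)"
      using nn_integral_lborel_translate[of "\<lambda>y. ?g (y - T x) * F y" "T x"] by simp
  qed
  also have "\<dots> = (\<integral>\<^sup>+y. \<integral>\<^sup>+x. ?g (y - T x) * F y \<partial>lborel \<partial>lborel)"
    by (rule lborel_pair.Fubini') measurable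
  also have "\<dots> = (\<integral>\<^sup>+y. F y \<partial>lborel)"
  proof (rule nn_integral_cong)
    fix y
    obtain z where z: "y = T z" using surj by (metis surjD)
    have "gauss_density (y - T x) = gauss_density (- z + x)" for x
    proof -
      have "norm (y - T x) = norm (T (z - x))" using lin by (simp add: z linear_diff)
      also have "\<dots> = norm (z - x)" using T by (simp add: orthogonal_transformation)
      finally show ?thesis by (simp add: gauss_density_def norm_minus_commute)
    qed
    then have "(\<integral>\<^sup>+x. ?g (y - T x) * F y \<partial>lborel) = (\<integral>\<^sup>+x. ?g (- z + x) * F y \<partial>lborel)" by simp
    also have "\<dots> = (\<integral>\<^sup>+x. ?g x * F y \<partial>lborel)"
      by (rule nn_integral_lborel_translate) measurable
    also have "\<dots> = F y" by (simp add: nn_integral_multc nn_integral_gauss_density)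
    finally show "(\<integral>\<^sup>+x. ?g (y - T x) * F y \<partial>lborel) = F y" .
  qed
  also have "\<dots> = emeasure lborel A" by (simp add: F_def)
  finally show "emeasure (distr lborel borel T) A = emeasure lborel A" .
qed simp

lemma std_gauss_orthogonal_invariant:
  fixes T :: "'a::euclidean_space \<Rightarrow> 'a"
  assumes T: "orthogonal_transformation T"
  shows "distr std_gauss borel T = std_gauss"
proof (rule measure_eqI)
  have lin: "linear T" using T by (rule orthogonal_transformation_linear)
  have [measurable]: "T \<in> borel \<rightarrow>\<^sub>M borel"
    using lin by (intro borel_measurable_continuous_onI linear_continuous_on)
      (simp add: linear_linear)
  fix A :: "'a set" assume "A \<in> sets (distr std_gauss borel T)"
  then have A[measurable]: "A \<in> sets borel" by simp
  have g: "gauss_density (T x) = gauss_density x" for x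
    using T by (simp add: gauss_density_def orthogonal_transformation)
  have "emeasure std_gauss A
      = (\<integral>\<^sup>+x. ennreal (gauss_density x) * indicator A x \<partial>distr lborel borel T)"
    by (simp add: std_gauss_eq_density emeasure_density lborel_orthogonal_invariant[OF T])
  also have "\<dots> = (\<integral>\<^sup>+x. ennreal (gauss_density x) * indicator (T -` A) x \<partial>lborel)"
    by (subst nn_integral_distr) (auto simp: g indicator_def intro!: nn_integral_cong)
  also have "\<dots> = emeasure (distr std_gauss borel T) A"
    using measurable_sets[of T borel borel A]
    by (simp add: emeasure_distr std_gauss_eq_density emeasure_density)
  finally show "emeasure (distr std_gauss borel T) A = emeasure std_gauss A" ..
qed simp

lemma std_gauss_pair:
  "(std_gauss :: ('a::euclidean_space \<times> 'b::euclidean_space) measure) = std_gauss \<Otimes>\<^sub>M std_gauss"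
proof -
  have g: "gauss_density (x, y) = gauss_density x * gauss_density y" for x :: 'a and y :: 'b
    by (simp add: gauss_density_def norm_Pair power_add add_divide_distrib exp_add exp_minus)
       (simp add: exp_add[symmetric] exp_minus[symmetric])
  have "std_gauss \<Otimes>\<^sub>M std_gauss = density (lborel \<Otimes>\<^sub>M lborel)
      (\<lambda>(x::'a, y::'b). ennreal (gauss_density x) * ennreal (gauss_density y))"
    unfolding std_gauss_eq_density
  proof (rule pair_measure_density)
    show "sigma_finite_measure (density lborel (\<lambda>x::'b. ennreal (gauss_density x)))"
      using prob_space_std_gauss[where 'a='b] unfolding std_gauss_eq_density[symmetric]
      by (simp add: prob_space_imp_sigma_finite)
  qed (auto simp: lborel.sigma_finite_measure_axioms)
  also have "(\<lambda>(x::'a, y::'b). ennreal (gauss_density x) * ennreal (gauss_density y))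
      = (\<lambda>z. ennreal (gauss_density z))"
    by (auto simp: g fun_eq_iff ennreal_mult gauss_density_pos less_imp_le)
  finally show ?thesis by (simp add: lborel_prod std_gauss_eq_density)
qed

lemma std_gauss_real: "(std_gauss :: real measure) = density lborel std_normal_density"
  by (simp add: std_gauss_def)

section \<open>Shifts of Gaussian product measures\<close>

lemma normal_density_sq_ratio:
  assumes "\<sigma> > 0"
  shows "(normal_density m' \<sigma> y)\<^sup>2 / normal_density m \<sigma> y
    = exp ((m' - m)\<^sup>2 / \<sigma>\<^sup>2) * normal_density (2 * m' - m) \<sigma> y"
proof -
  let ?c = "1 / sqrt (2 * pi * \<sigma>\<^sup>2)"
  have c: "?c > 0" using assms by simp
  have "(normal_density m' \<sigma> y)\<^sup>2 / normal_density m \<sigma> y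
      = ?c * (exp (2 * (- (y - m')\<^sup>2 / (2 * \<sigma>\<^sup>2))) / exp (- (y - m)\<^sup>2 / (2 * \<sigma>\<^sup>2)))"
    using c unfolding normal_density_def power_mult_distrib exp_double
    by (simp add: power2_eq_square divide_simps)
  also have "\<dots> = ?c * exp (2 * (- (y - m')\<^sup>2 / (2 * \<sigma>\<^sup>2)) - (- (y - m)\<^sup>2 / (2 * \<sigma>\<^sup>2)))"
    by (simp only: exp_diff)
  also have "2 * (- (y - m')\<^sup>2 / (2 * \<sigma>\<^sup>2)) - (- (y - m)\<^sup>2 / (2 * \<sigma>\<^sup>2))
      = (m' - m)\<^sup>2 / \<sigma>\<^sup>2 + - (y - (2 * m' - m))\<^sup>2 / (2 * \<sigma>\<^sup>2)"
    using assms by (simp add: field_simps) (simp add: power2_eq_square algebra_simps)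
  finally show ?thesis by (simp only: normal_density_def exp_add mult.left_commute)
qed

lemma normal_product_likelihood_ratio:
  fixes m m' :: "'i \<Rightarrow> real" and \<sigma> :: real
  assumes I: "finite I" and \<sigma>: "\<sigma> > 0"
  defines "P1 \<equiv> PiM I (\<lambda>i. density lborel (normal_density (m i) \<sigma>))"
    and "P2 \<equiv> PiM I (\<lambda>i. density lborel (normal_density (m' i) \<sigma>))"
  obtains L :: "('i \<Rightarrow> real) \<Rightarrow> real" where
    "L \<in> borel_measurable P1" "\<And>y. L y \<ge> 0" "P2 = density P1 (\<lambda>y. ennreal (L y))"
    "integrable P1 L" "(\<integral>y. L y \<partial>P1) = 1"
    "integrable P1 (\<lambda>y. (L y)\<^sup>2)" "(\<integral>y. (L y)\<^sup>2 \<partial>P1) = exp ((\<Sum>i\<in>I. (m' i - m i)\<^sup>2) / \<sigma>\<^sup>2)"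
proof -
  define B where "B = PiM I (\<lambda>_::'i. lborel :: real measure)"
  have ps: "prob_space (density lborel (\<lambda>x. ennreal (normal_density a \<sigma> x)))" for a
    using \<sigma> by (rule prob_space_normal_density)
  have P: "PiM I (\<lambda>i. density lborel (normal_density (a i) \<sigma>))
      = density B (\<lambda>y. \<Prod>i\<in>I. ennreal (normal_density (a i) \<sigma> (y i)))" for a :: "'i \<Rightarrow> real"
    unfolding B_def
    by (rule PiM_density[OF I])
      (auto simp: lborel.sigma_finite_measure_axioms intro: prob_space_imp_sigma_finite[OF ps])
  define f where "f a y = (\<Prod>i\<in>I. normal_density (a i) \<sigma> (y i))" for a y :: "'i \<Rightarrow> real"
  have [measurable]: "f a \<in> borel_measurable B" for a
    unfolding f_def[abs_def] B_def by measurable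
  have fpos: "f a y > 0" for a y
    unfolding f_def using \<sigma> by (intro prod_pos) (simp add: normal_density_pos)
  have P1: "P1 = density B (\<lambda>y. ennreal (f m y))" and P2: "P2 = density B (\<lambda>y. ennreal (f m' y))"
    unfolding P1_def P2_def P by (simp_all add: f_def prod_ennreal)
  define L where "L y = f m' y / f m y" for y
  have Lm: "L \<in> borel_measurable B" unfolding L_def[abs_def] by measurable
  then have Lm1[measurable]: "L \<in> borel_measurable P1" by (simp add: P1)
  have L0: "L y \<ge> 0" for y using fpos[of m y] fpos[of m' y] by (simp add: L_def)
  have d: "P2 = density P1 (\<lambda>y. ennreal (L y))"
    unfolding P1 P2 using Lm
    by (subst density_density_eq)
      (auto intro!: density_cong simp: ennreal_mult[symmetric] L_def fpos less_imp_le less_imp_neq[OF fpos, symmetric])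
  have ps2: "prob_space P2" unfolding P2_def by (intro prob_space_PiM ps)
  have "(\<integral>\<^sup>+y. ennreal (L y) \<partial>P1) = 1"
    using prob_space.emeasure_space_1[OF ps2] unfolding d by (simp add: emeasure_density)
  then have hb1: "has_bochner_integral P1 L 1"
    using L0 by (intro has_bochner_integral_nn_integral) auto
  have sq: "f m y * (L y)\<^sup>2 = (\<Prod>i\<in>I. exp ((m' i - m i)\<^sup>2 / \<sigma>\<^sup>2) * normal_density (2 * m' i - m i) \<sigma> (y i))"
    for y
  proof -
    have "f m y * (L y)\<^sup>2 = (f m' y)\<^sup>2 / f m y"
      using fpos[of m y] by (simp add: L_def power2_eq_square)
    also have "\<dots> = (\<Prod>i\<in>I. (normal_density (m' i) \<sigma> (y i))\<^sup>2 / normal_density (m i) \<sigma> (y i))"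
      by (simp add: f_def prod_power_distrib prod_dividef)
    finally show ?thesis by (simp add: normal_density_sq_ratio[OF \<sigma>])
  qed
  interpret lb: product_sigma_finite "\<lambda>_::'i. lborel :: real measure"
    by (simp add: product_sigma_finite_def lborel.sigma_finite_measure_axioms)
  have "(\<integral>\<^sup>+y. ennreal ((L y)\<^sup>2) \<partial>P1)
      = (\<integral>\<^sup>+y. (\<Prod>i\<in>I. ennreal (exp ((m' i - m i)\<^sup>2 / \<sigma>\<^sup>2) * normal_density (2 * m' i - m i) \<sigma> (y i))) \<partial>B)"
    using Lm unfolding P1
    by (subst nn_integral_density)
      (auto intro!: nn_integral_cong simp: ennreal_mult[symmetric] sq[symmetric] fpos less_imp_le prod_ennreal)
  also have "\<dots> = (\<Prod>i\<in>I. \<integral>\<^sup>+x. ennreal (exp ((m' i - m i)\<^sup>2 / \<sigma>\<^sup>2) * normal_density (2 * m' i - m i) \<sigma> x) \<partial>lborel)"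
    unfolding B_def by (rule lb.product_nn_integral_prod[OF I]) measurable
  also have "\<dots> = (\<Prod>i\<in>I. ennreal (exp ((m' i - m i)\<^sup>2 / \<sigma>\<^sup>2)))"
  proof (rule prod.cong[OF refl])
    fix i
    have "(\<integral>\<^sup>+x. ennreal (normal_density (2 * m' i - m i) \<sigma> x) \<partial>lborel) = 1"
      using prob_space.emeasure_space_1[OF ps[of "2 * m' i - m i"]] by (simp add: emeasure_density)
    then show "(\<integral>\<^sup>+x. ennreal (exp ((m' i - m i)\<^sup>2 / \<sigma>\<^sup>2) * normal_density (2 * m' i - m i) \<sigma> x) \<partial>lborel)
      = ennreal (exp ((m' i - m i)\<^sup>2 / \<sigma>\<^sup>2))"
      by (simp add: ennreal_mult nn_integral_cmult)
  qed
  also have "\<dots> = ennreal (exp ((\<Sum>i\<in>I. (m' i - m i)\<^sup>2) / \<sigma>\<^sup>2))"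
    using I by (simp add: prod_ennreal exp_sum sum_divide_distrib)
  finally have "has_bochner_integral P1 (\<lambda>y. (L y)\<^sup>2) (exp ((\<Sum>i\<in>I. (m' i - m i)\<^sup>2) / \<sigma>\<^sup>2))"
    by (intro has_bochner_integral_nn_integral) auto
  then have i2: "integrable P1 (\<lambda>y. (L y)\<^sup>2)"
    and e2: "(\<integral>y. (L y)\<^sup>2 \<partial>P1) = exp ((\<Sum>i\<in>I. (m' i - m i)\<^sup>2) / \<sigma>\<^sup>2)"
    by (simp_all only: has_bochner_integral_iff)
  from hb1 have i1: "integrable P1 L" and e1: "(\<integral>y. L y \<partial>P1) = 1"
    by (simp_all only: has_bochner_integral_iff)
  show ?thesis by (rule that[OF Lm1 L0 d i1 e1 i2 e2])
qed

text \<open>The likelihood ratio has second moment \<open>C\<close>, hence variance \<open>C - 1\<close>, whose square root bounds the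
  total variation distance. Cauchy-Schwarz for the likelihood ratio and an indicator gives the
  second bound, a quantitative form of contiguity: events of small probability under the first
  law have small probability under the second.\<close>
lemma normal_product_shift:
  fixes m m' :: "'i \<Rightarrow> real" and \<sigma> :: real
  assumes I: "finite I" and \<sigma>: "\<sigma> > 0"
  defines "P1 \<equiv> PiM I (\<lambda>i. density lborel (normal_density (m i) \<sigma>))"
    and "P2 \<equiv> PiM I (\<lambda>i. density lborel (normal_density (m' i) \<sigma>))"
    and "C \<equiv> exp ((\<Sum>i\<in>I. (m' i - m i)\<^sup>2) / \<sigma>\<^sup>2)"
  assumes B: "B \<in> sets P1"
  shows "\<bar>measure P2 B - measure P1 B\<bar> \<le> sqrt (C - 1)" (is ?tv)
    and "measure P2 B \<le> sqrt (C * measure P1 B)" (is ?cont)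
proof -
  obtain L where L[measurable]: "L \<in> borel_measurable P1" and L0: "\<And>y. L y \<ge> 0"
    and P2: "P2 = density P1 (\<lambda>y. ennreal (L y))"
    and i1: "integrable P1 L" and e1: "(\<integral>y. L y \<partial>P1) = 1"
    and i2: "integrable P1 (\<lambda>y. (L y)\<^sup>2)" and e2: "(\<integral>y. (L y)\<^sup>2 \<partial>P1) = C"
    by (rule normal_product_likelihood_ratio[OF I \<sigma>, of m m', folded P1_def P2_def C_def]) (rule that)
  note [measurable] = B
  interpret P1: prob_space P1
    unfolding P1_def by (intro prob_space_PiM prob_space_normal_density \<sigma>)
  have iB: "integrable P1 (\<lambda>y. L y * indicator B y)"
    using i1 by (rule integrable_real_mult_indicator[OF B])
  have iI: "integrable P1 (indicator B :: _ \<Rightarrow> real)"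
    using B by (simp add: integrable_indicator_iff P1.emeasure_eq_measure)
  have mP2: "measure P2 B = (\<integral>y. L y * indicator B y \<partial>P1)"
  proof -
    have "emeasure P2 B = (\<integral>\<^sup>+y. ennreal (L y * indicator B y) \<partial>P1)"
      unfolding P2 by (auto simp: emeasure_density L0 indicator_def intro!: nn_integral_cong)
    also have "\<dots> = ennreal (\<integral>y. L y * indicator B y \<partial>P1)"
      using iB L0 by (intro nn_integral_eq_integral) auto
    finally show ?thesis using L0 by (simp add: measure_def integral_nonneg_AE)
  qed
  have C1: "C \<ge> 1" unfolding C_def by (simp add: sum_nonneg)
  show ?tv
  proof -
    let ?X = "\<lambda>y. (L y - 1) * indicator B y"
    have iq: "integrable P1 (\<lambda>y. (L y - 1)\<^sup>2)"
      using i1 i2 by (simp add: power2_diff)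
    have eq: "(\<integral>y. (L y - 1)\<^sup>2 \<partial>P1) = C - 1"
      using i1 i2 e1 e2 by (simp add: power2_diff P1.prob_space)
    have iX: "integrable P1 ?X"
      using i1 by (intro integrable_real_mult_indicator[OF B]) auto
    have sX: "(?X y)\<^sup>2 = (L y - 1)\<^sup>2 * indicator B y" for y
      by (simp add: indicator_def)
    have iX2: "integrable P1 (\<lambda>y. (?X y)\<^sup>2)"
      unfolding sX using iq by (rule integrable_real_mult_indicator[OF B])
    have "measure P2 B - measure P1 B = (\<integral>y. ?X y \<partial>P1)"
      using iB iI B by (simp add: mP2 left_diff_distrib)
    moreover have "(\<integral>y. ?X y \<partial>P1)\<^sup>2 \<le> (\<integral>y. (?X y)\<^sup>2 \<partial>P1)"
      using P1.variance_positive[of ?X] P1.variance_eq[OF iX iX2] by linarith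
    moreover have "(\<integral>y. (?X y)\<^sup>2 \<partial>P1) \<le> (\<integral>y. (L y - 1)\<^sup>2 \<partial>P1)"
      using iX2 iq by (intro integral_mono) (auto simp: indicator_def)
    ultimately have "\<bar>measure P2 B - measure P1 B\<bar>\<^sup>2 \<le> C - 1" using eq by simp
    then show ?thesis by (rule real_le_rsqrt)
  qed
  show ?cont
  proof -
    let ?p = "measure P1 B"
    \<comment> \<open>Cauchy-Schwarz in the form \<open>2 a b \<le> e a\<^sup>2 + b\<^sup>2 / e\<close>, to be optimised over \<open>e\<close>.\<close>
    have bound: "measure P2 B \<le> (e * C + ?p / e) / 2" if e: "e > 0" for e
    proof -
      have *: "L y * indicator B y \<le> (e * (L y)\<^sup>2 + indicator B y / e) / 2" for y
      proof -
        have "0 \<le> (e * L y - indicator B y)\<^sup>2 / e" using e by simp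
        also have "\<dots> = e * (L y)\<^sup>2 + indicator B y / e - 2 * (L y * indicator B y)"
          using e by (simp add: power2_diff indicator_def field_simps power2_eq_square)
        finally show ?thesis by simp
      qed
      have "measure P2 B \<le> (\<integral>y. (e * (L y)\<^sup>2 + indicator B y / e) / 2 \<partial>P1)"
        unfolding mP2 using iB i2 iI * by (intro integral_mono) auto
      also have "\<dots> = (e * C + ?p / e) / 2"
        using i2 iI B e2 by simp
      finally show ?thesis .
    qed
    show ?thesis
    proof (cases "?p = 0")
      case True
      have "measure P2 B \<le> 0"
      proof (rule field_le_epsilon)
        fix e :: real assume "e > 0"
        then show "measure P2 B \<le> 0 + e" using bound[of "2 * e / C"] C1 True by simp
      qed
      then show ?thesis using C1 by (simp add: True)
    next
      case False
      then have p: "?p > 0" using measure_nonneg[of P1 B] by linarith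
      define s where "s = sqrt (C * ?p)"
      have s: "s > 0" "s * s = C * ?p" using p C1 by (simp_all add: s_def)
      have "(s / C) * C + ?p / (s / C) = 2 * s"
        using s C1 by (simp add: field_simps)
      then show ?thesis using bound[of "s / C"] s C1 unfolding s_def[symmetric] by simp
    qed
  qed
qed

section \<open>Linear images of Gaussian vectors\<close>

text \<open>The reflection in the hyperplane orthogonal to \<open>a - b\<close>.\<close>
lemma reflection_exists:
  fixes a b :: "'a::real_inner"
  assumes "norm a = norm b"
  obtains R where "linear R" "\<And>x y. R x \<bullet> R y = x \<bullet> y" "\<And>x. R (R x) = x" "R a = b"
proof (cases "a = b")
  case True
  then show ?thesis by (intro that[of id]) (auto simp: linear_iff)
next
  case False
  define v where "v = a - b"
  have vv: "v \<bullet> v \<noteq> 0" using False by (simp add: v_def)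
  define R where "R x = x - (2 * (x \<bullet> v) / (v \<bullet> v)) *\<^sub>R v" for x
  have "a \<bullet> a = b \<bullet> b" using assms by (simp add: norm_eq)
  then have av: "2 * (a \<bullet> v) = v \<bullet> v"
    by (simp add: v_def inner_diff inner_commute)
  have Rv: "R x \<bullet> v = - (x \<bullet> v)" for x using vv by (simp add: R_def inner_diff)
  show ?thesis
  proof
    show "linear R"
      by (rule linearI) (simp_all add: R_def algebra_simps inner_add_left add_divide_distrib)
    show "R x \<bullet> R y = x \<bullet> y" for x y
    proof -
      have "R x \<bullet> R y = R x \<bullet> y - 2 * (y \<bullet> v) / (v \<bullet> v) * (R x \<bullet> v)"
        by (subst (2) R_def) (simp add: inner_diff)
      then show ?thesis unfolding Rv
        by (simp add: R_def inner_diff inner_commute)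
    qed
    show "R (R x) = x" for x
      by (subst R_def, unfold Rv) (simp add: R_def)
    show "R a = b" using av vv by (simp add: R_def v_def)
  qed
qed

lemma distr_snd_pair:
  assumes "prob_space M" "prob_space N"
  shows "distr (M \<Otimes>\<^sub>M N) N snd = N"
proof (rule measure_eqI)
  interpret M: prob_space M by fact
  interpret N: prob_space N by fact
  fix A assume "A \<in> sets (distr (M \<Otimes>\<^sub>M N) N snd)"
  then have A: "A \<in> sets N" by simp
  have "snd -` A \<inter> space (M \<Otimes>\<^sub>M N) = space M \<times> A"
    using sets.sets_into_space[OF A] by (auto simp: space_pair_measure)
  then show "emeasure (distr (M \<Otimes>\<^sub>M N) N snd) A = emeasure N A"
    using A by (simp add: emeasure_distr N.emeasure_pair_measure_Times M.emeasure_space_1)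
qed simp

lemma borel_measurable_linear:
  fixes f :: "'a::euclidean_space \<Rightarrow> 'b::euclidean_space"
  assumes "linear f" shows "f \<in> borel_measurable borel"
  using assms by (intro borel_measurable_continuous_onI linear_continuous_on)
    (simp add: linear_linear)

text \<open>The isometry of the product space that exchanges the directions \<open>(e, 0)\<close> and \<open>(0, 1)\<close>
  shows that the component along \<open>e\<close> may be replaced by an independent standard normal variable.\<close>
lemma std_gauss_split:
  fixes e :: "'a::euclidean_space"
  assumes e: "norm e = 1"
  shows std_gauss_resample:
      "distr (std_gauss \<Otimes>\<^sub>M std_gauss) borel (\<lambda>(x, z). x - (x \<bullet> e) *\<^sub>R e + z *\<^sub>R e) = std_gauss"
    and std_gauss_marginal: "distr std_gauss borel (\<lambda>x. x \<bullet> e) = (std_gauss :: real measure)"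
proof -
  have ee: "e \<bullet> e = 1" using e by (simp add: norm_eq_1)
  define R :: "'a \<times> real \<Rightarrow> 'a \<times> real" where
    "R = (\<lambda>(x, z). (x - (x \<bullet> e) *\<^sub>R e + z *\<^sub>R e, x \<bullet> e))"
  have linR: "linear R"
    by (rule linearI) (auto simp: R_def algebra_simps inner_add_left)
  have "R p \<bullet> R q = p \<bullet> q" for p q
    by (cases p; cases q) (simp add: R_def inner_add inner_diff ee inner_commute algebra_simps)
  then have "orthogonal_transformation R" using linR by (simp add: orthogonal_transformation_def)
  then have inv: "distr std_gauss borel R = std_gauss" by (rule std_gauss_orthogonal_invariant)
  note [measurable] = borel_measurable_linear[OF linR]
  have b[simp]: "borel \<Otimes>\<^sub>M borel = (borel :: ('a \<times> real) measure)" by (rule borel_prod)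
  let ?P = "std_gauss \<Otimes>\<^sub>M std_gauss :: ('a \<times> real) measure"
  have P: "?P = distr ?P borel R" using inv by (simp add: std_gauss_pair)
  have sP[measurable_cong]: "sets ?P = sets borel"
    unfolding std_gauss_pair[symmetric] by (rule sets_std_gauss)
  have f: "distr ?P borel fst = (std_gauss :: 'a measure)"
    using prob_space.distr_pair_fst[OF prob_space_std_gauss[where 'a=real], of "std_gauss :: 'a measure"]
    by (subst distr_cong[OF refl _ refl]) auto
  have s: "distr ?P borel snd = (std_gauss :: real measure)"
    using distr_snd_pair[OF prob_space_std_gauss[where 'a='a] prob_space_std_gauss[where 'a=real]]
    by (subst distr_cong[OF refl _ refl]) auto
  have m1[measurable]: "(fst :: 'a \<times> real \<Rightarrow> 'a) \<in> borel \<rightarrow>\<^sub>M borel"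
    and m2[measurable]: "(snd :: 'a \<times> real \<Rightarrow> real) \<in> borel \<rightarrow>\<^sub>M borel"
    by (auto intro!: borel_measurable_continuous_onI continuous_intros)
  have mR: "R \<in> ?P \<rightarrow>\<^sub>M borel" by measurable
  have "distr ?P borel (fst \<circ> R) = std_gauss"
    using distr_distr[OF m1 mR] P f by simp
  moreover have "fst \<circ> R = (\<lambda>(x, z). x - (x \<bullet> e) *\<^sub>R e + z *\<^sub>R e)" by (auto simp: R_def)
  ultimately show "distr ?P borel (\<lambda>(x, z). x - (x \<bullet> e) *\<^sub>R e + z *\<^sub>R e) = std_gauss" by simp
  have "distr ?P borel (snd \<circ> R) = std_gauss"
    using distr_distr[OF m2 mR] P s by simp
  moreover have "snd \<circ> R = (\<lambda>x. x \<bullet> e) \<circ> fst" by (auto simp: R_def)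
  moreover have "distr ?P borel ((\<lambda>x. x \<bullet> e) \<circ> fst) = distr std_gauss borel (\<lambda>x. x \<bullet> e)"
  proof -
    have "fst \<in> ?P \<rightarrow>\<^sub>M (borel :: 'a measure)" by measurable
    from distr_distr[of "\<lambda>x. x \<bullet> e" borel borel, OF _ this] f show ?thesis by simp
  qed
  ultimately show "distr std_gauss borel (\<lambda>x. x \<bullet> e) = (std_gauss :: real measure)" by simp
qed

definition iid_normal :: "nat \<Rightarrow> (nat \<Rightarrow> real) measure" where
  "iid_normal n = PiM {..<n} (\<lambda>_. std_gauss)"

lemma sets_iid_normal[measurable_cong]: "sets (iid_normal n) = sets (PiM {..<n} (\<lambda>_. borel))"
  and space_iid_normal: "space (iid_normal n) = space (PiM {..<n} (\<lambda>_. borel :: real measure))"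
  by (auto simp: iid_normal_def space_PiM intro!: sets_PiM_cong)

lemma prob_space_iid_normal: "prob_space (iid_normal n)"
  unfolding iid_normal_def by (intro prob_space_PiM prob_space_std_gauss)

lemma iid_normal_Suc:
  "iid_normal (Suc n) = distr (std_gauss \<Otimes>\<^sub>M iid_normal n) (iid_normal (Suc n)) (\<lambda>(x, u). u(n := x))"
  using distr_pair_PiM_eq_PiM[of "{..<n}" "\<lambda>_. std_gauss :: real measure" n]
  by (simp add: iid_normal_def lessThan_Suc prob_space_std_gauss)

text \<open>Adjoining one more summand \<open>x *\<^sub>R v n\<close> gives a linear map on a space of one dimension more,
  whose kernel contains a unit vector. A reflection moves this vector to the new coordinate,
  which then drops out, while the covariance form is preserved.\<close>
lemma iid_normal_linear_combination:
  fixes v :: "nat \<Rightarrow> 'a::euclidean_space"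
  shows "\<exists>L :: 'a \<Rightarrow> 'a. linear L \<and>
    distr (iid_normal n) borel (\<lambda>u. \<Sum>i<n. u i *\<^sub>R v i) = distr std_gauss borel L \<and>
    (\<forall>x y. (\<Sum>i<n. (v i \<bullet> x) * (v i \<bullet> y)) = adjoint L x \<bullet> adjoint L y)"
proof (induction n)
  case 0
  have "adjoint (\<lambda>_::'a. 0::'a) = (\<lambda>_. 0)" by (rule adjoint_unique) simp
  moreover have "distr (iid_normal 0) borel (\<lambda>u. 0::'a) = distr std_gauss borel (\<lambda>_::'a. 0)"
    by (subst (1 2) prob_space.distr_const)
      (auto simp: prob_space_iid_normal prob_space_std_gauss)
  ultimately show ?case by (intro exI[of _ "\<lambda>_. 0"]) (auto simp: linear_iff)
next
  case (Suc n)
  then obtain L :: "'a \<Rightarrow> 'a" where L: "linear L"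
    and law: "distr (iid_normal n) borel (\<lambda>u. \<Sum>i<n. u i *\<^sub>R v i) = distr std_gauss borel L"
    and cov: "\<And>x y. (\<Sum>i<n. (v i \<bullet> x) * (v i \<bullet> y)) = adjoint L x \<bullet> adjoint L y"
    by blast
  define M :: "real \<times> 'a \<Rightarrow> 'a" where "M = (\<lambda>(x, z). x *\<^sub>R v n + L z)"
  have linM: "linear M"
    using L by (intro linearI) (auto simp: M_def algebra_simps linear_add linear_cmul)
  have "\<not> inj M"
  proof
    assume "inj M"
    then have "dim (M ` UNIV) = dim (UNIV :: (real \<times> 'a) set)"
      using linM by (intro dim_image_eq) auto
    moreover have "dim (M ` UNIV) \<le> DIM('a)" by (rule dim_subset_UNIV)
    ultimately show False by simp
  qed
  then obtain w0 where w0: "w0 \<noteq> 0" "M w0 = 0"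
    using linM by (auto simp: linear_injective_0)
  define w where "w = w0 /\<^sub>R norm w0"
  have w: "norm w = 1" "M w = 0" using w0 linM by (auto simp: w_def linear_cmul)
  then have "norm (1::real, 0::'a) = norm w" by (simp add: norm_Pair)
  then obtain R where linR: "linear R" and R: "\<And>x y. R x \<bullet> R y = x \<bullet> y" "\<And>x. R (R x) = x"
    and Rw: "R (1, 0) = w"
    using reflection_exists by metis
  have Rorth: "orthogonal_transformation R" using linR R by (simp add: orthogonal_transformation_def)
  define L' where "L' z = M (R (0, z))" for z
  have MR: "M (R (x, z)) = L' z" for x z
  proof -
    have "(x, z) = x *\<^sub>R (1, 0) + (0, z)" by simp
    then have "M (R (x, z)) = M (R (x *\<^sub>R (1, 0) + (0, z)))" by (rule arg_cong)
    also have "\<dots> = x *\<^sub>R M (R (1, 0)) + M (R (0, z))"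
      by (simp only: linear_add[OF linR] linear_add[OF linM] linear_cmul[OF linR] linear_cmul[OF linM])
    finally have "M (R (x, z)) = x *\<^sub>R M (R (1, 0)) + M (R (0, z))" .
    then show ?thesis using w Rw by (simp add: L'_def)
  qed
  have lin0: "linear (\<lambda>z::'a. (0::real, z))" by (rule linearI) auto
  have "linear (M \<circ> (R \<circ> (\<lambda>z. (0, z))))"
    by (intro linear_compose lin0 linR linM)
  then have linL': "linear L'" by (simp add: comp_def L'_def[abs_def])
  note [measurable] = borel_measurable_linear[OF linM] borel_measurable_linear[OF linL']
    borel_measurable_linear[OF L] borel_measurable_linear[OF linR]
  let ?P = "std_gauss \<Otimes>\<^sub>M std_gauss :: (real \<times> 'a) measure"
  have mL: "(\<lambda>(x, z). (x, L z)) \<in> ?P \<rightarrow>\<^sub>M borel \<Otimes>\<^sub>M borel" by measurable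
  have sP[measurable_cong]: "sets ?P = sets borel"
    unfolding std_gauss_pair[symmetric] by (rule sets_std_gauss)
  interpret iid: prob_space "iid_normal n" by (rule prob_space_iid_normal)
  interpret g: prob_space "std_gauss :: 'a measure" by (rule prob_space_std_gauss)
  interpret g1: prob_space "std_gauss :: real measure" by (rule prob_space_std_gauss)
  define S where "S u = (\<Sum>i<n. u i *\<^sub>R v i)" for u
  have S[measurable]: "S \<in> iid_normal n \<rightarrow>\<^sub>M borel"
    unfolding S_def[abs_def] by measurable
  have psS: "sigma_finite_measure (distr (iid_normal n) borel S)"
    by (intro prob_space_imp_sigma_finite iid.prob_space_distr S)
  have psL: "sigma_finite_measure (distr std_gauss borel L)"
    by (intro prob_space_imp_sigma_finite g.prob_space_distr) simp
  have plus[measurable]: "(\<lambda>(x, y). x *\<^sub>R v n + y) \<in> borel \<Otimes>\<^sub>M borel \<rightarrow>\<^sub>M borel" by measurable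
  have upd: "(\<lambda>(x, u). u(n := x)) \<in> std_gauss \<Otimes>\<^sub>M iid_normal n \<rightarrow>\<^sub>M iid_normal (Suc n)"
    unfolding iid_normal_def lessThan_Suc by measurable
  have S': "(\<lambda>u. \<Sum>i<Suc n. u i *\<^sub>R v i) \<in> iid_normal (Suc n) \<rightarrow>\<^sub>M borel" by measurable
  have "distr (iid_normal (Suc n)) borel (\<lambda>u. \<Sum>i<Suc n. u i *\<^sub>R v i)
      = distr (std_gauss \<Otimes>\<^sub>M iid_normal n) borel
          ((\<lambda>u. \<Sum>i<Suc n. u i *\<^sub>R v i) \<circ> (\<lambda>(x, u). u(n := x)))"
    by (subst iid_normal_Suc, subst distr_distr[OF S' upd]) simp
  also have "((\<lambda>u. \<Sum>i<Suc n. u i *\<^sub>R v i) \<circ> (\<lambda>(x, u). u(n := x)))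
      = (\<lambda>(x, y). x *\<^sub>R v n + y) \<circ> (\<lambda>(x, u). (x, S u))"
    by (auto simp: S_def fun_eq_iff)
  also have "distr (std_gauss \<Otimes>\<^sub>M iid_normal n) borel \<dots>
      = distr (distr (std_gauss \<Otimes>\<^sub>M iid_normal n) (borel \<Otimes>\<^sub>M borel) (\<lambda>(x, u). (x, S u))) borel
          (\<lambda>(x, y). x *\<^sub>R v n + y)"
    by (rule distr_distr[symmetric]) measurable
  also have "distr (std_gauss \<Otimes>\<^sub>M iid_normal n) (borel \<Otimes>\<^sub>M borel) (\<lambda>(x, u). (x, S u))
      = distr std_gauss borel (\<lambda>x. x) \<Otimes>\<^sub>M distr (iid_normal n) borel S"
    by (rule pair_measure_distr[OF _ S psS, symmetric]) simp
  also have "distr (iid_normal n) borel S = distr std_gauss borel L"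
    using law by (simp add: S_def[abs_def])
  also have "distr std_gauss borel (\<lambda>x::real. x) \<Otimes>\<^sub>M distr std_gauss borel L
      = distr ?P (borel \<Otimes>\<^sub>M borel) (\<lambda>(x, z). (x, L z))"
    by (rule pair_measure_distr[OF _ _ psL]) simp_all
  also have "distr \<dots> borel (\<lambda>(x, y). x *\<^sub>R v n + y) = distr ?P borel M"
    by (subst distr_distr[OF plus mL]) (auto simp: M_def comp_def split_beta')
  also have "\<dots> = distr (distr ?P borel R) borel M"
    using std_gauss_orthogonal_invariant[OF Rorth] by (simp add: std_gauss_pair)
  also have "\<dots> = distr ?P borel (L' \<circ> snd)"
    by (subst distr_distr) (auto simp: comp_def MR split_beta' intro!: distr_cong)
  also have "\<dots> = distr (distr ?P std_gauss snd) borel L'"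
    by (subst distr_distr) auto
  also have "distr ?P std_gauss snd = std_gauss"
    by (rule distr_snd_pair) (rule prob_space_std_gauss)+
  finally have law': "distr (iid_normal (Suc n)) borel (\<lambda>u. \<Sum>i<Suc n. u i *\<^sub>R v i)
      = distr std_gauss borel L'" .
  have adjM: "(v n \<bullet> x, adjoint L x) \<bullet> z = x \<bullet> M z" for x z
    using L by (cases z) (simp add: M_def inner_add adjoint_works inner_commute)
  have adjL': "adjoint L' = (\<lambda>x. snd (R (v n \<bullet> x, adjoint L x)))"
  proof (rule adjoint_unique, intro allI)
    fix x y
    have "L' x \<bullet> y = (v n \<bullet> y, adjoint L y) \<bullet> R (0, x)" by (simp only: adjM L'_def) (rule inner_commute)
    also have "\<dots> = R (v n \<bullet> y, adjoint L y) \<bullet> (0, x)" by (metis R)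
    finally show "L' x \<bullet> y = x \<bullet> snd (R (v n \<bullet> y, adjoint L y))"
      by (simp add: inner_prod_def inner_commute)
  qed
  have fst0: "fst (R (v n \<bullet> x, adjoint L x)) = 0" for x
  proof -
    have "fst (R (v n \<bullet> x, adjoint L x)) = R (v n \<bullet> x, adjoint L x) \<bullet> (1, 0)"
      by (simp add: inner_prod_def)
    also have "\<dots> = (v n \<bullet> x, adjoint L x) \<bullet> w" by (metis R Rw)
    finally show ?thesis using w by (simp add: adjM)
  qed
  have "(\<Sum>i<Suc n. (v i \<bullet> x) * (v i \<bullet> y)) = adjoint L' x \<bullet> adjoint L' y" for x y
  proof -
    have "(\<Sum>i<Suc n. (v i \<bullet> x) * (v i \<bullet> y)) = (v n \<bullet> x, adjoint L x) \<bullet> (v n \<bullet> y, adjoint L y)"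
      by (simp add: cov)
    also have "\<dots> = R (v n \<bullet> x, adjoint L x) \<bullet> R (v n \<bullet> y, adjoint L y)" by (simp add: R)
    finally show ?thesis using fst0 by (simp add: adjL' inner_prod_def)
  qed
  with linL' law' show ?case by blast
qed

lemma distr_std_normal_affine:
  assumes "\<sigma> > 0"
  shows "distr std_gauss borel (\<lambda>x. m + \<sigma> * x) = density lborel (normal_density m \<sigma>)"
proof -
  interpret prob_space "std_gauss :: real measure" by (rule prob_space_std_gauss)
  have "distr (std_gauss :: real measure) lborel (\<lambda>x. x) = std_gauss"
    by (rule distr_id2) simp
  then have "distributed std_gauss lborel (\<lambda>x. x) std_normal_density"
    unfolding distributed_def by (simp add: std_gauss_real)
  then have "distributed std_gauss lborel (\<lambda>x. m + \<sigma> * x) (normal_density (m + \<sigma> * 0) (\<bar>\<sigma>\<bar> * 1))"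
    by (rule normal_density_affine) (use assms in auto)
  then have "distr std_gauss lborel (\<lambda>x. m + \<sigma> * x) = density lborel (normal_density m \<sigma>)"
    using assms by (simp add: distributed_def)
  then show ?thesis by (subst distr_cong[OF refl _ refl, of _ lborel]) auto
qed

lemma sample_law_eq_distr:
  assumes \<sigma>: "\<sigma> > 0"
  shows "sample_law X n \<theta> \<sigma>
    = distr (iid_normal n) (sample_space n) (\<lambda>u. \<lambda>i\<in>{..<n}. X n i \<bullet> \<theta> + \<sigma> * u i)"
proof -
  let ?m = "\<lambda>i. X n i \<bullet> \<theta>"
  let ?D = "\<lambda>i. density lborel (normal_density (?m i) \<sigma>)"
  let ?f = "\<lambda>u. \<lambda>i\<in>{..<n}. ?m i + \<sigma> * u i"
  interpret D: product_sigma_finite ?D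
    by (simp add: product_sigma_finite_def prob_space_imp_sigma_finite prob_space_normal_density \<sigma>)
  interpret g: product_sigma_finite "\<lambda>_::nat. std_gauss :: real measure"
    by (simp add: product_sigma_finite_def prob_space_imp_sigma_finite prob_space_std_gauss)
  have f[measurable]: "?f \<in> iid_normal n \<rightarrow>\<^sub>M sample_space n"
    unfolding sample_space_def iid_normal_def by measurable
  have "distr (iid_normal n) (sample_space n) ?f = PiM {..<n} ?D"
  proof (rule D.PiM_eqI)
    show "sets (distr (iid_normal n) (sample_space n) ?f) = sets (PiM {..<n} ?D)"
      by (simp add: sample_space_def cong: sets_PiM_cong)
    fix A assume "\<And>i. i \<in> {..<n} \<Longrightarrow> A i \<in> sets (?D i)"
    then have A: "\<And>i. i \<in> {..<n} \<Longrightarrow> A i \<in> sets borel" by simp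
    have pre: "(\<lambda>x. ?m i + \<sigma> * x) -` A i \<in> sets borel" if "i \<in> {..<n}" for i
      using A[OF that] measurable_sets[of "\<lambda>x. ?m i + \<sigma> * x" borel borel "A i"] by simp
    have "Pi\<^sub>E {..<n} A \<in> sets (sample_space n)"
      unfolding sample_space_def by (rule sets_PiM_I_finite) (use A in auto)
    then have "emeasure (distr (iid_normal n) (sample_space n) ?f) (Pi\<^sub>E {..<n} A)
        = emeasure (iid_normal n) (?f -` Pi\<^sub>E {..<n} A \<inter> space (iid_normal n))"
      by (rule emeasure_distr[OF f])
    also have "?f -` Pi\<^sub>E {..<n} A \<inter> space (iid_normal n)
        = Pi\<^sub>E {..<n} (\<lambda>i. (\<lambda>x. ?m i + \<sigma> * x) -` A i)"
      by (auto simp: iid_normal_def space_PiM PiE_iff)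
    also have "emeasure (iid_normal n) \<dots>
        = (\<Prod>i<n. emeasure std_gauss ((\<lambda>x. ?m i + \<sigma> * x) -` A i))"
      unfolding iid_normal_def using pre by (intro g.emeasure_PiM) auto
    also have "\<dots> = (\<Prod>i<n. emeasure (?D i) (A i))"
      using A by (intro prod.cong refl)
        (simp add: distr_std_normal_affine[OF \<sigma>, symmetric] emeasure_distr)
    finally show "emeasure (distr (iid_normal n) (sample_space n) ?f) (Pi\<^sub>E {..<n} A)
      = (\<Prod>i\<in>{..<n}. emeasure (?D i) (A i))" .
  qed simp
  then show ?thesis by (simp add: sample_law_def)
qed

section \<open>Least squares\<close>

lemma matrix_inv_works:
  fixes A :: "real^'n^'n"
  assumes "invertible A"
  shows "A *v (matrix_inv A *v x) = x" "matrix_inv A *v (A *v x) = x"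
proof -
  have "A ** matrix_inv A = mat 1 \<and> matrix_inv A ** A = mat 1"
    using assms unfolding invertible_def matrix_inv_def by (rule someI_ex)
  then show "A *v (matrix_inv A *v x) = x" "matrix_inv A *v (A *v x) = x"
    by (simp_all add: matrix_vector_mul_assoc)
qed

lemma invertible_iff_kernel:
  fixes A :: "real^'n^'n"
  shows "invertible A \<longleftrightarrow> (\<forall>x. A *v x = 0 \<longrightarrow> x = 0)"
  by (simp add: invertible_left_inverse matrix_left_invertible_ker)

definition full_rank :: "(nat \<Rightarrow> nat \<Rightarrow> real^'p) \<Rightarrow> nat \<Rightarrow> bool" where
  "full_rank X n \<longleftrightarrow> n > 0 \<and> span (X n ` {..<n}) = UNIV"

lemma design_full_rank:
  fixes X :: "nat \<Rightarrow> nat \<Rightarrow> real^'p"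
  assumes "design X Q" "n > CARD('p)"
  shows "full_rank X n"
proof -
  have "dim (X n ` {..<n}) = DIM(real^'p)" using assms by (simp add: design_def)
  then have "span (X n ` {..<n}) = UNIV" by (simp only: dim_eq_full)
  then show ?thesis using assms(2) by (simp add: full_rank_def)
qed

text \<open>\<open>X'y / n\<close>; the normal equations read \<open>(X'X / n) \<theta> = X'y / n\<close>.\<close>
definition score :: "(nat \<Rightarrow> nat \<Rightarrow> real^'p) \<Rightarrow> nat \<Rightarrow> (nat \<Rightarrow> real) \<Rightarrow> real^'p" where
  "score X n y = (1 / real n) *\<^sub>R (\<Sum>i<n. y i *\<^sub>R X n i)"

lemma inner_score: "real n * (score X n y \<bullet> \<eta>) = (\<Sum>i<n. y i * (X n i \<bullet> \<eta>))"
  by (cases "n = 0") (simp_all add: score_def inner_sum_left)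

lemma scaled_gram_mult: "scaled_gram X n *v \<theta> = score X n (\<lambda>i. X n i \<bullet> \<theta>)"
unfolding vec_eq_iff
proof
  fix a
  have "(scaled_gram X n *v \<theta>) $ a = (\<Sum>b\<in>UNIV. \<Sum>i<n. X n i $ a * (X n i $ b * \<theta> $ b) / real n)"
    by (simp add: matrix_vector_mult_def scaled_gram_def sum_distrib_right sum_distrib_left
        sum_divide_distrib ac_simps)
  also have "\<dots> = (\<Sum>i<n. X n i $ a * (\<Sum>b\<in>UNIV. X n i $ b * \<theta> $ b) / real n)"
    by (subst sum.swap) (simp add: sum_distrib_left sum_divide_distrib)
  also have "\<dots> = score X n (\<lambda>i. X n i \<bullet> \<theta>) $ a"
    by (simp add: score_def inner_vec_def sum_divide_distrib ac_simps)
  finally show "(scaled_gram X n *v \<theta>) $ a = score X n (\<lambda>i. X n i \<bullet> \<theta>) $ a" .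
qed

lemma inner_scaled_gram:
  "real n * ((scaled_gram X n *v \<theta>) \<bullet> \<eta>) = (\<Sum>i<n. (X n i \<bullet> \<theta>) * (X n i \<bullet> \<eta>))"
  by (simp add: scaled_gram_mult inner_score)

lemma scaled_gram_symmetric: "(scaled_gram X n *v \<theta>) \<bullet> \<eta> = \<theta> \<bullet> (scaled_gram X n *v \<eta>)"
proof (cases "n = 0")
  case False
  have "real n * ((scaled_gram X n *v \<theta>) \<bullet> \<eta>) = real n * (\<theta> \<bullet> (scaled_gram X n *v \<eta>))"
    by (subst (2) inner_commute) (simp only: inner_scaled_gram mult.commute)
  then show ?thesis using False by simp
qed (simp add: scaled_gram_mult score_def)

text \<open>A vector orthogonal to all rows is orthogonal to their span, the whole space.\<close>
lemma full_rank_pos: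
  assumes "full_rank X n" "\<eta> \<noteq> 0"
  shows "(\<Sum>i<n. (X n i \<bullet> \<eta>)\<^sup>2) > 0"
proof (rule ccontr)
  assume "\<not> ?thesis"
  then have "(\<Sum>i<n. (X n i \<bullet> \<eta>)\<^sup>2) = 0" by (meson less_eq_real_def linorder_not_less sum_nonneg zero_le_power2)
  then have "\<forall>i<n. X n i \<bullet> \<eta> = 0" by (subst (asm) sum_nonneg_eq_0_iff) auto
  then have o: "orthogonal \<eta> x" if "x \<in> X n ` {..<n}" for x
    using that by (auto simp: orthogonal_def inner_commute)
  have "\<eta> \<in> span (X n ` {..<n})" using assms(1) by (simp add: full_rank_def)
  from orthogonal_to_span[OF this o] have "orthogonal \<eta> \<eta>" .
  then show False using assms(2) by (simp add: orthogonal_self)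
qed

lemma invertible_scaled_gram:
  assumes "full_rank X n" shows "invertible (scaled_gram X n)"
  unfolding invertible_iff_kernel
proof (intro allI impI)
  fix \<eta> assume "scaled_gram X n *v \<eta> = 0"
  then have "(\<Sum>i<n. (X n i \<bullet> \<eta>)\<^sup>2) = 0"
    using inner_scaled_gram[of n X \<eta> \<eta>] by (simp add: power2_eq_square)
  then show "\<eta> = 0" using full_rank_pos[OF assms, of \<eta>] by (metis less_irrefl)
qed

lemma rss_shift:
  "rss X n y (\<theta> + \<eta>) = rss X n y \<theta>
    - 2 * (real n * ((score X n y - scaled_gram X n *v \<theta>) \<bullet> \<eta>)) + (\<Sum>i<n. (X n i \<bullet> \<eta>)\<^sup>2)"
proof -
  have "real n * ((score X n y - scaled_gram X n *v \<theta>) \<bullet> \<eta>)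
      = (\<Sum>i<n. (y i - X n i \<bullet> \<theta>) * (X n i \<bullet> \<eta>))"
    by (simp add: inner_diff right_diff_distrib inner_score inner_scaled_gram left_diff_distrib
        sum_subtractf)
  moreover have "rss X n y (\<theta> + \<eta>) = (\<Sum>i<n. (y i - X n i \<bullet> \<theta>)\<^sup>2
      - 2 * ((y i - X n i \<bullet> \<theta>) * (X n i \<bullet> \<eta>)) + (X n i \<bullet> \<eta>)\<^sup>2)"
    unfolding rss_def by (intro sum.cong refl) (simp add: inner_add power2_eq_square algebra_simps)
  ultimately show ?thesis
    by (simp add: sum.distrib sum_subtractf sum_distrib_left rss_def)
qed

lemma model_diff: "\<theta> \<in> model r \<Longrightarrow> \<eta> \<in> model r \<Longrightarrow> \<theta> - \<eta> \<in> model r"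
  by (simp add: model_def)

text \<open>The normal equations characterise the minimiser, by strict convexity.\<close>
lemma restricted_lse_eqI:
  assumes fr: "full_rank X n" and m: "\<theta> \<in> model r"
    and normal: "\<And>\<eta>. \<eta> \<in> model r \<Longrightarrow> (score X n y - scaled_gram X n *v \<theta>) \<bullet> \<eta> = 0"
  shows "restricted_lse X n r y = \<theta>"
proof -
  have less: "rss X n y \<theta> < rss X n y \<zeta>" if "\<zeta> \<in> model r" "\<zeta> \<noteq> \<theta>" for \<zeta>
    using rss_shift[of X n y \<theta> "\<zeta> - \<theta>"] normal[of "\<zeta> - \<theta>"] that m
      full_rank_pos[OF fr, of "\<zeta> - \<theta>"] by (simp add: model_diff)
  have "\<not> rss X n y \<zeta> < rss X n y \<theta>" if "\<zeta> \<in> model r" for \<zeta>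
    using less[OF that] by (cases "\<zeta> = \<theta>") (simp_all add: not_less)
  then have "is_arg_min (rss X n y) (\<lambda>x. x \<in> model r) \<theta>"
    unfolding is_arg_min_def using m by blast
  moreover have "\<zeta> = \<theta>" if "is_arg_min (rss X n y) (\<lambda>x. x \<in> model r) \<zeta>" for \<zeta>
    using that less[of \<zeta>] m unfolding is_arg_min_def by blast
  ultimately show ?thesis
    unfolding restricted_lse_def arg_min_on_def arg_min_def by (rule some_equality)
qed

lemma gram_inv_works:
  assumes "full_rank X n"
  shows "scaled_gram X n *v (matrix_inv (scaled_gram X n) *v x) = x"
    and "matrix_inv (scaled_gram X n) *v (scaled_gram X n *v x) = x"
  using matrix_inv_works[OF invertible_scaled_gram[OF assms]] by auto

definition full_lse :: "(nat \<Rightarrow> nat \<Rightarrow> real^'p) \<Rightarrow> nat \<Rightarrow> (nat \<Rightarrow> real) \<Rightarrow> real^'p" where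
  "full_lse X n y = matrix_inv (scaled_gram X n) *v score X n y"

lemma restricted_lse_UNIV:
  assumes "full_rank X n"
  shows "restricted_lse X n UNIV y = full_lse X n y"
proof (rule restricted_lse_eqI[OF assms])
  show "full_lse X n y \<in> model UNIV" by (simp add: model_def)
qed (simp add: full_lse_def gram_inv_works[OF assms])

text \<open>\<open>G\<^sup>-\<^sup>1 e\<^sub>i / (G\<^sup>-\<^sup>1)\<^sub>i\<^sub>i\<close>: the direction in which the full estimator is projected when its
  \<open>i\<close>-th coordinate is forced to vanish.\<close>
definition drop_dir :: "real^'p^'p \<Rightarrow> 'p \<Rightarrow> real^'p" where
  "drop_dir G i = (1 / (matrix_inv G $ i $ i)) *\<^sub>R (matrix_inv G *v axis i 1)"

lemma mult_axis_diag: "((M :: real^'n^'n) *v axis i 1) $ i = M $ i $ i"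
  by (simp add: matrix_vector_mul_component inner_axis)

lemma inv_gram_diag_pos:
  assumes "full_rank X n" shows "matrix_inv (scaled_gram X n) $ i $ i > 0"
proof -
  let ?G = "scaled_gram X n" and ?h = "matrix_inv (scaled_gram X n) *v axis i 1"
  have Gh: "?G *v ?h = axis i 1" using assms by (simp add: gram_inv_works)
  then have "?h \<noteq> 0" by (auto simp: matrix_vector_mult_0_right axis_eq_0_iff)
  have "real n * ((?G *v ?h) \<bullet> ?h) > 0"
    unfolding inner_scaled_gram power2_eq_square[symmetric]
    by (rule full_rank_pos[OF assms \<open>?h \<noteq> 0\<close>])
  then have "axis i 1 \<bullet> ?h > 0" unfolding Gh by (simp add: zero_less_mult_iff)
  then show ?thesis by (simp add: inner_axis' mult_axis_diag)
qed

lemma restricted_lse_drop: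
  assumes "full_rank X n"
  shows "restricted_lse X n (UNIV - {i}) y
    = full_lse X n y - (full_lse X n y $ i) *\<^sub>R drop_dir (scaled_gram X n) i"
proof (rule restricted_lse_eqI[OF assms])
  let ?G = "scaled_gram X n"
  have pos: "matrix_inv ?G $ i $ i > 0" by (rule inv_gram_diag_pos[OF assms])
  then have d1: "drop_dir ?G i $ i = 1" by (simp add: drop_dir_def mult_axis_diag)
  then show "full_lse X n y - (full_lse X n y $ i) *\<^sub>R drop_dir ?G i \<in> model (UNIV - {i})"
    by (simp add: model_def)
  fix \<eta> :: "real^'a" assume "\<eta> \<in> model (UNIV - {i})"
  then have "\<eta> $ i = 0" by (simp add: model_def)
  moreover have "?G *v drop_dir ?G i = (1 / matrix_inv ?G $ i $ i) *\<^sub>R axis i 1"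
    using assms by (simp add: drop_dir_def matrix_vector_mult_scaleR gram_inv_works)
  moreover have "?G *v full_lse X n y = score X n y"
    using assms by (simp add: full_lse_def gram_inv_works)
  ultimately show "(score X n y - ?G *v (full_lse X n y - (full_lse X n y $ i) *\<^sub>R drop_dir ?G i)) \<bullet> \<eta> = 0"
    by (simp add: matrix_vector_mult_diff_distrib matrix_vector_mult_scaleR inner_axis')
qed

text \<open>Off the coordinates in \<open>r\<close> the Gram matrix is replaced by the identity, which makes the
  solution of the normal equations of any submodel an explicit linear function of the data.\<close>
lemma restricted_lse_linear:
  fixes X :: "nat \<Rightarrow> nat \<Rightarrow> real^'p"
  assumes fr: "full_rank X n"
  obtains B :: "real^'p^'p" where "\<And>y. restricted_lse X n r y = B *v score X n y"
proof -
  let ?G = "scaled_gram X n"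
  define N :: "real^'p^'p" where
    "N = (\<chi> a b. if a \<in> r then (if b \<in> r then ?G $ a $ b else 0) else if a = b then 1 else 0)"
  define E :: "real^'p^'p" where "E = (\<chi> a b. if a = b \<and> a \<in> r then 1 else 0)"
  have Nout: "(N *v \<theta>) $ a = \<theta> $ a" if "a \<notin> r" for a \<theta>
  proof -
    have "(N *v \<theta>) $ a = (\<Sum>b\<in>UNIV. (if a = b then 1 else 0) * \<theta> $ b)"
      using that by (simp add: matrix_vector_mult_def N_def)
    also have "\<dots> = (\<Sum>b\<in>UNIV. if a = b then \<theta> $ b else 0)" by (intro sum.cong) auto
    finally show ?thesis by simp
  qed
  have Nin: "(N *v \<theta>) $ a = (?G *v \<theta>) $ a" if "a \<in> r" "\<theta> \<in> model r" for a \<theta>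
    using that by (auto simp: matrix_vector_mult_def N_def model_def intro!: sum.cong)
  have E: "(E *v s) $ a = (if a \<in> r then s $ a else 0)" for s a
  proof -
    have "(E *v s) $ a = (\<Sum>b\<in>UNIV. if a = b then (if a \<in> r then s $ b else 0) else 0)"
      unfolding matrix_vector_mult_def E_def vec_lambda_beta by (intro sum.cong) auto
    then show ?thesis by simp
  qed
  have inv: "invertible N"
    unfolding invertible_iff_kernel
  proof (intro allI impI)
    fix \<theta> assume 0: "N *v \<theta> = 0"
    then have "\<theta> $ a = 0" if "a \<notin> r" for a using Nout[OF that, of \<theta>] by simp
    then have m: "\<theta> \<in> model r" by (simp add: model_def)
    have "(?G *v \<theta>) $ a * \<theta> $ a = 0" for a
      using Nin[OF _ m, of a] 0 m by (cases "a \<in> r") (auto simp: model_def)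
    then have "(?G *v \<theta>) \<bullet> \<theta> = 0"
      unfolding inner_vec_def inner_real_def by (intro sum.neutral ballI)
    then have "(\<Sum>i<n. (X n i \<bullet> \<theta>)\<^sup>2) = 0"
      using inner_scaled_gram[of n X \<theta> \<theta>] by (simp add: power2_eq_square)
    then show "\<theta> = 0" using full_rank_pos[OF fr, of \<theta>] by (metis less_irrefl)
  qed
  show ?thesis
  proof
    fix y
    let ?t = "(matrix_inv N ** E) *v score X n y"
    have Nt: "N *v ?t = E *v score X n y"
      using inv by (simp add: matrix_vector_mul_assoc[symmetric] matrix_inv_works)
    have m: "?t \<in> model r" unfolding model_def using Nout[of _ ?t] by (auto simp: Nt E)
    show "restricted_lse X n r y = ?t"
    proof (rule restricted_lse_eqI[OF fr m])
      fix \<eta> assume \<eta>: "\<eta> \<in> model r"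
      have "(score X n y - ?G *v ?t) $ a * \<eta> $ a = 0" for a
        using Nin[OF _ m, of a] \<eta> by (cases "a \<in> r") (auto simp: model_def Nt E)
      then show "(score X n y - ?G *v ?t) \<bullet> \<eta> = 0"
        unfolding inner_vec_def inner_real_def by (intro sum.neutral ballI)
    qed
  qed
qed

lemma borel_measurable_matrix_vector_mult[measurable (raw)]:
  fixes B :: "real^'n^'m"
  assumes "f \<in> M \<rightarrow>\<^sub>M borel"
  shows "(\<lambda>y. B *v f y) \<in> M \<rightarrow>\<^sub>M borel"
proof -
  have "(\<lambda>x. B *v x) \<in> borel \<rightarrow>\<^sub>M borel"
    by (intro borel_measurable_continuous_onI) (simp add: matrix_vector_mult_linear_continuous_on)
  from measurable_compose[OF assms this] show ?thesis .
qed

lemma borel_measurable_score[measurable]: "score X n \<in> sample_space n \<rightarrow>\<^sub>M borel"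
proof -
  have [measurable]: "(\<lambda>y. y i) \<in> sample_space n \<rightarrow>\<^sub>M borel" if "i \<in> {..<n}" for i
    unfolding sample_space_def using that by (rule measurable_component_singleton)
  show ?thesis unfolding score_def[abs_def] by measurable
qed

lemma borel_measurable_restricted_lse:
  assumes "full_rank X n"
  shows "restricted_lse X n r \<in> sample_space n \<rightarrow>\<^sub>M borel"
proof -
  obtain B where "\<And>y. restricted_lse X n r y = B *v score X n y"
    using restricted_lse_linear[OF assms] by blast
  then have "restricted_lse X n r = (\<lambda>y. B *v score X n y)" by auto
  then show ?thesis by simp
qed

lemma borel_measurable_vec_nth[measurable]: "(\<lambda>x::real^'n. x $ i) \<in> borel_measurable borel"
  by (intro borel_measurable_continuous_onI continuous_intros)

lemma borel_measurable_rss: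
  assumes "f \<in> sample_space n \<rightarrow>\<^sub>M borel"
  shows "(\<lambda>y. rss X n y (f y)) \<in> borel_measurable (sample_space n)"
proof -
  have [measurable]: "(\<lambda>y. y i) \<in> sample_space n \<rightarrow>\<^sub>M borel" if "i \<in> {..<n}" for i
    unfolding sample_space_def using that by (rule measurable_component_singleton)
  note [measurable] = assms
  show ?thesis unfolding rss_def by measurable
qed

lemma borel_measurable_sigma_hat:
  assumes "full_rank X n"
  shows "sigma_hat X n \<in> borel_measurable (sample_space n)"
  unfolding sigma_hat_def[abs_def]
  using borel_measurable_rss[OF borel_measurable_restricted_lse[OF assms]] by measurable

lemma borel_measurable_t_stat:
  assumes "full_rank X n"
  shows "t_stat X n r \<in> borel_measurable (sample_space n)"
proof -
  note [measurable] = borel_measurable_sigma_hat[OF assms] borel_measurable_restricted_lse[OF assms]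
  show ?thesis unfolding t_stat_def[abs_def] Let_def by measurable
qed

lemma borel_measurable_post_selection_estimator:
  assumes fr: "full_rank X n" and sel: "rhat n \<in> sample_space n \<rightarrow>\<^sub>M count_space UNIV"
  shows "post_selection_estimator X R rhat n \<in> sample_space n \<rightarrow>\<^sub>M borel"
proof -
  note [measurable] = sel borel_measurable_restricted_lse[OF fr]
  show ?thesis unfolding post_selection_estimator_def[abs_def] by measurable
qed

text \<open>Estimation error and residuals as functions of the standardised disturbances \<open>u\<close>; neither
  depends on the true parameter.\<close>

definition lse_coef :: "(nat \<Rightarrow> nat \<Rightarrow> real^'p) \<Rightarrow> nat \<Rightarrow> real \<Rightarrow> nat \<Rightarrow> real^'p" where
  "lse_coef X n \<sigma> i = (\<sigma> / sqrt (real n)) *\<^sub>R (matrix_inv (scaled_gram X n) *v X n i)"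

definition lse_error :: "(nat \<Rightarrow> nat \<Rightarrow> real^'p) \<Rightarrow> nat \<Rightarrow> real \<Rightarrow> (nat \<Rightarrow> real) \<Rightarrow> real^'p" where
  "lse_error X n \<sigma> u = (\<Sum>i<n. u i *\<^sub>R lse_coef X n \<sigma> i)"

definition sample :: "(nat \<Rightarrow> nat \<Rightarrow> real^'p) \<Rightarrow> nat \<Rightarrow> real^'p \<Rightarrow> real \<Rightarrow> (nat \<Rightarrow> real) \<Rightarrow> nat \<Rightarrow> real" where
  "sample X n \<theta> \<sigma> u = (\<lambda>i\<in>{..<n}. X n i \<bullet> \<theta> + \<sigma> * u i)"

lemma score_sample:
  "score X n (sample X n \<theta> \<sigma> u) = scaled_gram X n *v \<theta> + (\<sigma> / real n) *\<^sub>R (\<Sum>i<n. u i *\<^sub>R X n i)"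
  by (simp add: score_def sample_def scaled_gram_mult scaleR_add_left sum.distrib
      scaleR_add_right scaleR_sum_right)

lemma full_lse_sample:
  assumes "full_rank X n"
  shows "sqrt (real n) *\<^sub>R (full_lse X n (sample X n \<theta> \<sigma> u) - \<theta>) = lse_error X n \<sigma> u"
proof -
  let ?H = "matrix_inv (scaled_gram X n)"
  have n: "n > 0" using assms by (simp add: full_rank_def)
  have "full_lse X n (sample X n \<theta> \<sigma> u) - \<theta> = (\<sigma> / real n) *\<^sub>R (\<Sum>i<n. u i *\<^sub>R (?H *v X n i))"
    using assms by (simp add: full_lse_def score_sample matrix_vector_right_distrib
        gram_inv_works matrix_vector_mult_scaleR
        linear_sum[OF matrix_vector_mul_linear])
  then have "sqrt (real n) *\<^sub>R (full_lse X n (sample X n \<theta> \<sigma> u) - \<theta>)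
      = (sqrt (real n) * (\<sigma> / real n)) *\<^sub>R (\<Sum>i<n. u i *\<^sub>R (?H *v X n i))"
    by simp
  also have "sqrt (real n) * (\<sigma> / real n) = \<sigma> / sqrt (real n)"
    using n by (simp add: field_simps)
  finally show ?thesis
    by (simp add: lse_error_def lse_coef_def scaleR_sum_right ac_simps)
qed

lemma rss_sample:
  assumes "full_rank X n"
  shows "rss X n (sample X n \<theta> \<sigma> u) (full_lse X n (sample X n \<theta> \<sigma> u))
    = \<sigma>\<^sup>2 * (\<Sum>i<n. (u i)\<^sup>2) - (scaled_gram X n *v lse_error X n \<sigma> u) \<bullet> lse_error X n \<sigma> u"
proof -
  let ?G = "scaled_gram X n" and ?y = "sample X n \<theta> \<sigma> u"
  let ?f = "full_lse X n ?y"
  have n: "n > 0" using assms by (simp add: full_rank_def)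
  have Gf: "?G *v ?f = score X n ?y"
    using assms by (simp add: full_lse_def gram_inv_works)
  define \<eta> where "\<eta> = \<theta> - ?f"
  have "rss X n ?y (?f + \<eta>) = rss X n ?y ?f + (\<Sum>i<n. (X n i \<bullet> \<eta>)\<^sup>2)"
    by (simp add: rss_shift Gf)
  moreover have "rss X n ?y (?f + \<eta>) = \<sigma>\<^sup>2 * (\<Sum>i<n. (u i)\<^sup>2)"
    by (simp add: \<eta>_def rss_def sample_def power_mult_distrib sum_distrib_left)
  moreover have "(\<Sum>i<n. (X n i \<bullet> \<eta>)\<^sup>2) = real n * ((?G *v \<eta>) \<bullet> \<eta>)"
    by (simp add: inner_scaled_gram power2_eq_square)
  moreover have "real n * ((?G *v \<eta>) \<bullet> \<eta>)
      = (?G *v (sqrt (real n) *\<^sub>R (?f - \<theta>))) \<bullet> (sqrt (real n) *\<^sub>R (?f - \<theta>))"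
  proof -
    have "sqrt (real n) *\<^sub>R (?f - \<theta>) = (- sqrt (real n)) *\<^sub>R \<eta>"
      by (simp add: \<eta>_def algebra_simps)
    then show ?thesis by (simp add: matrix_vector_mult_scaleR del: scaleR_minus_left)
  qed
  ultimately show ?thesis by (simp add: full_lse_sample[OF assms])
qed

lemma lse_coef_covariance:
  assumes "full_rank X n"
  shows "(\<Sum>i<n. (lse_coef X n \<sigma> i \<bullet> x) * (lse_coef X n \<sigma> i \<bullet> y))
    = \<sigma>\<^sup>2 * (x \<bullet> (matrix_inv (scaled_gram X n) *v y))"
proof -
  let ?G = "scaled_gram X n" and ?H = "matrix_inv (scaled_gram X n)"
  have n: "n > 0" using assms by (simp add: full_rank_def)
  have inv: "invertible ?G" using assms by (rule invertible_scaled_gram)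
  have H: "(?H *v a) \<bullet> b = a \<bullet> (?H *v b)" for a b
    using scaled_gram_symmetric[of X n "?H *v a" "?H *v b"] by (simp add: matrix_inv_works[OF inv])
  have "(\<Sum>i<n. (lse_coef X n \<sigma> i \<bullet> x) * (lse_coef X n \<sigma> i \<bullet> y))
      = (\<sigma>\<^sup>2 / real n) * (\<Sum>i<n. (X n i \<bullet> (?H *v x)) * (X n i \<bullet> (?H *v y)))"
    using n by (simp add: lse_coef_def H sum_distrib_left power2_eq_square ac_simps)
  also have "\<dots> = \<sigma>\<^sup>2 * ((?G *v (?H *v x)) \<bullet> (?H *v y))"
    using n unfolding inner_scaled_gram[symmetric] by simp
  finally show ?thesis by (simp add: matrix_inv_works[OF inv])
qed

section \<open>Averages over a moving window\<close>

text \<open>Suppose the integral equals \<open>g\<close> for almost all \<open>\<nu>\<close>. Far out the window carries no mass, so \<open>g\<close> is the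
  mean of \<open>H\<close>, and \<open>H \<nu>\<close> is for almost all \<open>\<nu>\<close> the mean of \<open>H\<close> over the window around \<open>\<nu>\<close>. Because
  the relation \<open>\<bar>x - \<nu>\<bar> < s\<close> is symmetric, integrating \<open>(H \<nu> - H x)\<^sup>2\<close> over it gives zero, so \<open>H\<close> is almost
  everywhere constant on each window and therefore, walking from window to window, everywhere.
  The constant is the limit \<open>0\<close> at one end, which contradicts the positive mean.\<close>
lemma window_average_not_constant:
  fixes H f :: "real \<Rightarrow> real" and e g s :: real
  defines "\<mu> \<equiv> density lborel (\<lambda>x. ennreal (f x))"
  assumes H[measurable]: "H \<in> borel_measurable borel" and f[measurable]: "f \<in> borel_measurable borel"
    and f_pos: "\<And>x. f x > 0" and prob: "prob_space \<mu>"
    and H01: "\<And>x. 0 \<le> H x \<and> H x \<le> 1" and s: "s > 0"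
    and e: "e = 1 \<or> e = -1" and lim: "((\<lambda>x. H (e * x)) \<longlongrightarrow> 0) at_top"
    and pos: "(\<integral>x. H x \<partial>\<mu>) > 0"
  shows "\<not> (AE \<nu> in lborel. (\<integral>x. (if \<bar>x - \<nu>\<bar> < s then H \<nu> else H x) \<partial>\<mu>) = g)"
proof
  assume G: "AE \<nu> in lborel. (\<integral>x. (if \<bar>x - \<nu>\<bar> < s then H \<nu> else H x) \<partial>\<mu>) = g"
  interpret prob_space \<mu> by (rule prob)
  interpret P: pair_prob_space \<mu> \<mu> ..
  have sets_\<mu>[measurable_cong]: "sets \<mu> = sets borel" by (simp add: \<mu>_def)
  have AE_\<mu>: "(AE x in \<mu>. P x) \<longleftrightarrow> (AE x in lborel. P x)" for P
    unfolding \<mu>_def by (subst AE_density) (auto simp: f_pos)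
  have ex_of_AE: "\<exists>x. a < x \<and> x < b \<and> P x" if P: "AE x in lborel. P x" and ab: "a < b" for a b :: real and P
  proof (rule ccontr)
    assume "\<not> ?thesis"
    then have sub: "{a<..<b} \<subseteq> {x. \<not> P x}" by auto
    from P have "AE x in lborel. x \<notin> {a<..<b}" by eventually_elim (use sub in blast)
    then have "emeasure lborel {a<..<b} = 0" by (subst (asm) AE_iff_null_sets[symmetric]) auto
    then show False using ab by simp
  qed
  define g0 where "g0 = (\<integral>x. H x \<partial>\<mu>)"
  define k where "k \<nu> x = (if \<bar>x - \<nu>\<bar> < s then H \<nu> - H x else 0)" for \<nu> x
  have [measurable]: "case_prod k \<in> borel_measurable (borel \<Otimes>\<^sub>M borel)"
    unfolding k_def[abs_def] by measurable
  have [measurable]: "k \<nu> \<in> borel_measurable borel" for \<nu>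
    unfolding k_def[abs_def] by measurable
  have k1: "\<bar>k \<nu> x\<bar> \<le> 1" for \<nu> x using H01[of \<nu>] H01[of x] by (auto simp: k_def)
  have bdd: "integrable \<mu> h" if "h \<in> borel_measurable borel" "\<And>x. \<bar>h x\<bar> \<le> 1" for h :: "real \<Rightarrow> real"
    using that by (intro integrable_const_bound[where B=1]) (auto simp: measurable_cong_sets[OF sets_\<mu>])
  have H_int: "integrable \<mu> H" using H01 by (intro bdd) (auto simp: abs_le_iff intro: order_trans[of _ 0])
  have k_int: "integrable \<mu> (k \<nu>)" for \<nu> using k1 by (intro bdd) measurable
  have G_eq: "(\<integral>x. (if \<bar>x - \<nu>\<bar> < s then H \<nu> else H x) \<partial>\<mu>) = g0 + (\<integral>x. k \<nu> x \<partial>\<mu>)" for \<nu>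
    unfolding g0_def using H_int k_int
    by (subst Bochner_Integration.integral_add[symmetric]) (auto intro!: Bochner_Integration.integral_cong simp: k_def)
  \<comment> \<open>The window escapes to infinity, so the constant can only be the mean of \<open>H\<close>.\<close>
  have "((\<lambda>\<nu>. \<integral>x. k \<nu> x \<partial>\<mu>) \<longlongrightarrow> (\<integral>x. 0 \<partial>\<mu>)) at_top"
  proof (rule integral_dominated_convergence_at_top[where w="\<lambda>_. 1"])
    show "AE x in \<mu>. ((\<lambda>\<nu>. k \<nu> x) \<longlongrightarrow> 0) at_top"
    proof (rule AE_I2)
      fix x
      have "\<forall>\<^sub>F \<nu> in at_top. k \<nu> x = 0"
        using eventually_ge_at_top[of "x + s"] by eventually_elim (auto simp: k_def)
      then show "((\<lambda>\<nu>. k \<nu> x) \<longlongrightarrow> 0) at_top" by (rule tendsto_eventually)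
    qed
    show "\<forall>\<^sub>F \<nu> in at_top. AE x in \<mu>. norm (k \<nu> x) \<le> 1" using k1 by simp
  qed simp_all
  then have klim: "((\<lambda>\<nu>. \<integral>x. k \<nu> x \<partial>\<mu>) \<longlongrightarrow> 0) at_top" by simp
  have g: "g = g0"
  proof (rule ccontr)
    assume "g \<noteq> g0"
    then have "\<forall>\<^sub>F \<nu> in at_top. \<bar>\<integral>x. k \<nu> x \<partial>\<mu>\<bar> < \<bar>g - g0\<bar>"
      using tendstoD[OF klim, of "\<bar>g - g0\<bar>"] by (simp add: dist_real_def)
    then obtain n where n: "\<And>\<nu>. \<nu> \<ge> n \<Longrightarrow> \<bar>\<integral>x. k \<nu> x \<partial>\<mu>\<bar> < \<bar>g - g0\<bar>"
      by (auto simp: eventually_at_top_linorder)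
    obtain \<nu> where "n < \<nu>" "(\<integral>x. (if \<bar>x - \<nu>\<bar> < s then H \<nu> else H x) \<partial>\<mu>) = g"
      using ex_of_AE[OF G, of n "n + 1"] by auto
    then show False using n[of \<nu>] by (simp add: G_eq)
  qed
  have k0: "AE \<nu> in \<mu>. (\<integral>x. k \<nu> x \<partial>\<mu>) = 0"
    using G unfolding AE_\<mu> G_eq g by auto
  \<comment> \<open>The kernel is reversible, so a function equal to its own window averages has
    vanishing Dirichlet form.\<close>
  have bdd2: "integrable (\<mu> \<Otimes>\<^sub>M \<mu>) h" if "h \<in> borel_measurable (borel \<Otimes>\<^sub>M borel)" "\<And>x. \<bar>h x\<bar> \<le> 1"
    for h :: "real \<times> real \<Rightarrow> real"
  proof (rule P.integrable_const_bound[where B=1])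
    show "h \<in> borel_measurable (\<mu> \<Otimes>\<^sub>M \<mu>)" using that(1) by measurable
  qed (use that in auto)
  define I1 where "I1 = (\<integral>p. k (fst p) (snd p) * H (fst p) \<partial>(\<mu> \<Otimes>\<^sub>M \<mu>))"
  have kH: "\<bar>k \<nu> x * H y\<bar> \<le> 1" for \<nu> x y
    using mult_mono[OF k1[of \<nu> x], of "\<bar>H y\<bar>" 1] H01[of y] by (simp add: abs_mult)
  have int1: "integrable (\<mu> \<Otimes>\<^sub>M \<mu>) (\<lambda>p. k (fst p) (snd p) * H (fst p))"
    and int2: "integrable (\<mu> \<Otimes>\<^sub>M \<mu>) (\<lambda>p. k (fst p) (snd p) * H (snd p))"
    using kH by (auto intro!: bdd2)
  have "I1 = (\<integral>\<nu>. (\<integral>x. k \<nu> x * H \<nu> \<partial>\<mu>) \<partial>\<mu>)"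
    unfolding I1_def using P.integral_fst'[OF int1] by simp
  also have "\<dots> = (\<integral>\<nu>. 0 \<partial>\<mu>)"
  proof (rule integral_cong_AE)
    show "AE \<nu> in \<mu>. (\<integral>x. k \<nu> x * H \<nu> \<partial>\<mu>) = 0" using k0 by eventually_elim simp
  qed measurable
  finally have I1: "I1 = 0" by simp
  have "I1 = (\<integral>p. k (snd p) (fst p) * H (snd p) \<partial>(\<mu> \<Otimes>\<^sub>M \<mu>))"
    unfolding I1_def using P.integral_product_swap[of "\<lambda>p. k (fst p) (snd p) * H (fst p)"]
    by (simp add: split_beta')
  also have "\<dots> = (\<integral>p. - (k (fst p) (snd p) * H (snd p)) \<partial>(\<mu> \<Otimes>\<^sub>M \<mu>))"
    by (intro Bochner_Integration.integral_cong) (auto simp: k_def abs_minus_commute algebra_simps)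
  finally have I2: "(\<integral>p. k (fst p) (snd p) * H (snd p) \<partial>(\<mu> \<Otimes>\<^sub>M \<mu>)) = 0" using I1 by simp
  have sq: "(k \<nu> x)\<^sup>2 = k \<nu> x * H \<nu> - k \<nu> x * H x" for \<nu> x
    by (simp add: k_def power2_eq_square algebra_simps)
  have "(\<integral>p. (k (fst p) (snd p))\<^sup>2 \<partial>(\<mu> \<Otimes>\<^sub>M \<mu>)) = 0"
    unfolding sq using int1 int2 I1 I2 by (simp add: I1_def)
  moreover have "integrable (\<mu> \<Otimes>\<^sub>M \<mu>) (\<lambda>p. (k (fst p) (snd p))\<^sup>2)"
    unfolding sq using int1 int2 by simp
  ultimately have "AE p in \<mu> \<Otimes>\<^sub>M \<mu>. (k (fst p) (snd p))\<^sup>2 = 0"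
    by (subst (asm) integral_nonneg_eq_0_iff_AE) auto
  then have "AE p in \<mu> \<Otimes>\<^sub>M \<mu>. k (fst p) (snd p) = 0" by simp
  then have "AE \<nu> in \<mu>. AE x in \<mu>. k \<nu> x = 0"
    using P.AE_pair by force
  then have AEAE: "AE \<nu> in lborel. AE x in lborel. k \<nu> x = 0" by (simp add: AE_\<mu>)
  define D where "D = {\<nu>. AE x in lborel. k \<nu> x = 0}"
  have D: "AE \<nu> in lborel. \<nu> \<in> D" using AEAE by (simp add: D_def)
  have step: "\<exists>\<nu>'\<in>D. e * \<nu> + s / 2 \<le> e * \<nu>' \<and> H \<nu>' = H \<nu>" if "\<nu> \<in> D" for \<nu>
  proof -
    have "AE x in lborel. k \<nu> x = 0" using that by (simp add: D_def)
    with D have A: "AE x in lborel. x \<in> D \<and> k \<nu> x = 0" by eventually_elim simp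
    show ?thesis
    proof (cases "e = 1")
      case True
      obtain x where "\<nu> + s / 2 < x" "x < \<nu> + s" "x \<in> D" "k \<nu> x = 0"
        using ex_of_AE[OF A, of "\<nu> + s / 2" "\<nu> + s"] s by auto
      then show ?thesis using True s by (intro bexI[of _ x]) (auto simp: k_def split: if_splits)
    next
      case False
      then have "e = -1" using e by simp
      obtain x where "\<nu> - s < x" "x < \<nu> - s / 2" "x \<in> D" "k \<nu> x = 0"
        using ex_of_AE[OF A, of "\<nu> - s" "\<nu> - s / 2"] s by auto
      then show ?thesis using \<open>e = -1\<close> s by (intro bexI[of _ x]) (auto simp: k_def split: if_splits)
    qed
  qed
  have walk: "\<exists>\<nu>'\<in>D. e * \<nu> + real n * (s / 2) \<le> e * \<nu>' \<and> H \<nu>' = H \<nu>" if "\<nu> \<in> D" for \<nu> n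
  proof (induction n)
    case 0 then show ?case using that by auto
  next
    case (Suc n)
    then obtain \<nu>' where 1: "\<nu>' \<in> D" "e * \<nu> + real n * (s / 2) \<le> e * \<nu>'" "H \<nu>' = H \<nu>" by blast
    obtain \<nu>'' where "\<nu>'' \<in> D" "e * \<nu>' + s / 2 \<le> e * \<nu>''" "H \<nu>'' = H \<nu>'"
      using step[OF 1(1)] by blast
    with 1 show ?case by (intro bexI[of _ \<nu>'']) (auto simp: algebra_simps add_divide_distrib)
  qed
  have H0: "H \<nu> = 0" if \<nu>D: "\<nu> \<in> D" for \<nu>
  proof (rule ccontr)
    assume "H \<nu> \<noteq> 0"
    then have "H \<nu> > 0" using H01[of \<nu>] by linarith
    then have "\<forall>\<^sub>F x in at_top. H (e * x) < H \<nu>" by (rule order_tendstoD(2)[OF lim])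
    then obtain N where N: "\<And>x. x \<ge> N \<Longrightarrow> H (e * x) < H \<nu>" by (auto simp: eventually_at_top_linorder)
    obtain n where n: "N - e * \<nu> < real n * (s / 2)"
      using ex_less_of_nat_mult[of "s / 2" "N - e * \<nu>"] s by auto
    obtain \<nu>' where \<nu>': "e * \<nu> + real n * (s / 2) \<le> e * \<nu>'" "H \<nu>' = H \<nu>" using walk[OF \<nu>D, of n] by blast
    have "H (e * (e * \<nu>')) < H \<nu>" using \<nu>' n by (intro N) linarith
    moreover have "e * (e * \<nu>') = \<nu>'" using e by auto
    ultimately show False using \<nu>' by simp
  qed
  from D have "AE x in lborel. H x = 0" by eventually_elim (rule H0)
  then have "AE x in \<mu>. H x = 0" unfolding AE_\<mu> .
  then have "(\<integral>x. H x \<partial>\<mu>) = (\<integral>x. 0 \<partial>\<mu>)" by (intro integral_cong_AE) measurable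
  then show False using pos by simp
qed

section \<open>The limiting distribution function\<close>

text \<open>The limit law of the post-model-selection estimator under the local alternatives
  \<open>\<theta> + (\<nu> / sqrt n) e\<^sub>i\<close>. Here \<open>L \<zeta>\<close> is the limit of \<open>sqrt n\<close> times the error of the full estimator, so that
  \<open>L \<zeta> $ i + \<nu>\<close> is the limit of the rescaled estimate of the \<open>i\<close>-th coordinate, which the pretest sets
  to zero if its modulus is below \<open>s\<close>.\<close>
definition limit_cdf :: "real^'p^'k \<Rightarrow> real^'k \<Rightarrow> real^'p \<Rightarrow> 'p \<Rightarrow> real \<Rightarrow> (real^'p \<Rightarrow> real^'p) \<Rightarrow> real \<Rightarrow> real"
  where "limit_cdf A t b i s L \<nu> = measure std_gauss {\<zeta>.
    if \<bar>L \<zeta> $ i + \<nu>\<bar> < s then A *v (L \<zeta> - (L \<zeta> $ i + \<nu>) *\<^sub>R b) \<le> t else A *v L \<zeta> \<le> t}"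

lemma pred_le_vec[measurable (raw)]:
  fixes f g :: "'a \<Rightarrow> real^'n"
  assumes [measurable]: "f \<in> M \<rightarrow>\<^sub>M borel" "g \<in> M \<rightarrow>\<^sub>M borel"
  shows "Measurable.pred M (\<lambda>x. f x \<le> g x)"
proof -
  have eq: "(\<lambda>x. f x \<le> g x) = (\<lambda>x. \<forall>j\<in>UNIV. f x $ j \<le> g x $ j)"
    by (auto simp: less_eq_vec_def)
  show ?thesis unfolding eq by measurable
qed

lemma limit_cdf_orthogonal:
  assumes T: "orthogonal_transformation T" and L: "linear L"
  shows "limit_cdf A t b i s (L \<circ> T) \<nu> = limit_cdf A t b i s L \<nu>"
proof -
  let ?S = "{\<zeta>. if \<bar>L \<zeta> $ i + \<nu>\<bar> < s then A *v (L \<zeta> - (L \<zeta> $ i + \<nu>) *\<^sub>R b) \<le> t else A *v L \<zeta> \<le> t}"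
  have [measurable]: "T \<in> borel \<rightarrow>\<^sub>M borel"
    by (rule borel_measurable_linear[OF orthogonal_transformation_linear[OF T]])
  have [measurable]: "L \<in> borel \<rightarrow>\<^sub>M borel" by (rule borel_measurable_linear[OF L])
  have S: "?S \<in> sets borel" by measurable
  have "limit_cdf A t b i s L \<nu> = measure (distr std_gauss borel T) ?S"
    by (simp add: std_gauss_orthogonal_invariant[OF T] limit_cdf_def)
  also have "\<dots> = measure std_gauss (T -` ?S)"
    using S by (subst measure_distr) auto
  finally show ?thesis by (simp add: limit_cdf_def vimage_def)
qed

lemma std_gauss_open_pos:
  fixes U :: "'a::euclidean_space set"
  assumes "open U" "U \<noteq> {}"
  shows "measure std_gauss U > 0"
proof (rule ccontr)
  interpret prob_space "std_gauss :: 'a measure" by (rule prob_space_std_gauss)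
  assume "\<not> ?thesis"
  then have "measure std_gauss U = 0" using measure_nonneg[of std_gauss U] by linarith
  then have "emeasure std_gauss U = 0" by (simp add: emeasure_eq_measure)
  then have "U \<in> null_sets std_gauss" using assms(1) by auto
  then have "AE x in std_gauss. x \<notin> U" by (rule AE_not_in)
  then have "AE x in lborel. x \<notin> U"
    unfolding std_gauss_eq_density by (subst (asm) AE_density) (auto simp: gauss_density_pos)
  then have "U \<in> null_sets lborel" using assms(1) by (subst (asm) AE_iff_null_sets[symmetric]) auto
  then have "negligible U" by (simp add: negligible_iff_null_sets null_sets_completionI)
  then show False using open_not_negligible[OF assms] by simp
qed

lemma std_gauss_hyperplane:
  fixes w :: "'a::euclidean_space"
  assumes "w \<noteq> 0"
  shows "AE \<zeta> in std_gauss. \<zeta> \<bullet> w \<noteq> a"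
proof -
  define e where "e = w /\<^sub>R norm w"
  have e: "norm e = 1" using assms by (simp add: e_def)
  have "AE x in lborel. x \<noteq> a / norm w" by (rule AE_lborel_singleton)
  then have "AE x in (std_gauss :: real measure). x \<noteq> a / norm w"
    unfolding std_gauss_real by (subst AE_density) auto
  then have "AE x in distr std_gauss borel (\<lambda>x. x \<bullet> e). x \<noteq> a / norm w"
    by (subst std_gauss_marginal[OF e])
  then have "AE \<zeta> in std_gauss. \<zeta> \<bullet> e \<noteq> a / norm w"
    by (subst (asm) AE_distr_iff) auto
  then show ?thesis
  proof eventually_elim
    case (elim \<zeta>)
    then show ?case using assms by (auto simp: e_def field_simps)
  qed
qed

lemma measure_std_gauss_resample:
  fixes e :: "'a::euclidean_space"
  assumes e: "norm e = 1" and S: "S \<in> sets borel"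
  shows "measure std_gauss S
    = (\<integral>z. measure std_gauss {\<zeta>. \<zeta> - (\<zeta> \<bullet> e) *\<^sub>R e + z *\<^sub>R e \<in> S} \<partial>(std_gauss :: real measure))"
proof -
  interpret g: prob_space "std_gauss :: 'a measure" by (rule prob_space_std_gauss)
  interpret g1: prob_space "std_gauss :: real measure" by (rule prob_space_std_gauss)
  interpret P: pair_prob_space "std_gauss :: 'a measure" "std_gauss :: real measure" ..
  let ?\<phi> = "\<lambda>(\<zeta>, z). \<zeta> - (\<zeta> \<bullet> e) *\<^sub>R e + z *\<^sub>R e"
  have [measurable]: "S \<in> sets borel" by (rule S)
  have \<phi>: "?\<phi> \<in> std_gauss \<Otimes>\<^sub>M std_gauss \<rightarrow>\<^sub>M borel" by measurable
  have pre: "?\<phi> -` S \<in> sets (std_gauss \<Otimes>\<^sub>M std_gauss)"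
    using measurable_sets[OF \<phi> S] by (simp add: space_pair_measure)
  have "emeasure std_gauss S = emeasure (distr (std_gauss \<Otimes>\<^sub>M std_gauss) borel ?\<phi>) S"
    by (simp only: std_gauss_resample[OF e])
  also have "\<dots> = emeasure (std_gauss \<Otimes>\<^sub>M std_gauss) (?\<phi> -` S)"
    using \<phi> S by (simp add: emeasure_distr space_pair_measure)
  also have "\<dots> = (\<integral>\<^sup>+z. emeasure std_gauss ((\<lambda>\<zeta>. (\<zeta>, z)) -` (?\<phi> -` S)) \<partial>(std_gauss :: real measure))"
    by (rule P.emeasure_pair_measure_alt2[OF pre])
  also have "\<dots> = (\<integral>\<^sup>+z. ennreal (measure std_gauss {\<zeta>. \<zeta> - (\<zeta> \<bullet> e) *\<^sub>R e + z *\<^sub>R e \<in> S}) \<partial>(std_gauss :: real measure))"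
    by (simp add: vimage_def g.emeasure_eq_measure)
  finally have *: "ennreal (measure std_gauss S)
      = (\<integral>\<^sup>+z. ennreal (measure std_gauss {\<zeta>. \<zeta> - (\<zeta> \<bullet> e) *\<^sub>R e + z *\<^sub>R e \<in> S}) \<partial>(std_gauss :: real measure))"
    by (simp add: g.emeasure_eq_measure)
  have "(\<lambda>z. measure std_gauss ((\<lambda>\<zeta>. (\<zeta>, z)) -` (?\<phi> -` S))) \<in> borel_measurable std_gauss"
    unfolding measure_def using P.measurable_emeasure_Pair2[OF pre] by measurable
  then have m: "(\<lambda>z. measure std_gauss {\<zeta>. \<zeta> - (\<zeta> \<bullet> e) *\<^sub>R e + z *\<^sub>R e \<in> S}) \<in> borel_measurable std_gauss"
    by (simp add: vimage_def)
  show ?thesis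
    using m by (subst integral_eq_nn_integral) (simp_all add: *[symmetric])
qed

text \<open>Along the direction that determines the \<open>i\<close>-th coordinate the limit is a window average
  of \<open>H x = P (V \<le> t + x d)\<close>, where \<open>V\<close> is the part of the restricted estimator that is
  independent of this coordinate, and \<open>d \<noteq> 0\<close> makes \<open>H\<close> vanish at one end.\<close>
lemma limit_cdf_not_constant:
  fixes A :: "real^'p^'k" and L :: "real^'p \<Rightarrow> real^'p"
  assumes rank: "rank A = CARD('k)" and L: "linear L" "surj L" and s: "s > 0"
    and b: "L (adjoint L (axis i 1)) = (norm (adjoint L (axis i 1)))\<^sup>2 *\<^sub>R b"
    and Ab: "A *v b \<noteq> 0"
  shows "\<not> (AE \<nu> in lborel. limit_cdf A t b i s L \<nu> = g)"
proof -
  let ?a = "adjoint L (axis i 1)"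
  define \<tau> where "\<tau> = norm ?a"
  have Li: "L x $ i = x \<bullet> ?a" for x
    using adjoint_works[OF L(1), of x "axis i 1"] by (simp add: inner_axis)
  obtain x0 where "L x0 = axis i 1" using L(2) by (metis surjD)
  then have "?a \<noteq> 0" using Li[of x0] by auto
  then have \<tau>: "\<tau> > 0" by (simp add: \<tau>_def)
  define e where "e = (- 1 / \<tau>) *\<^sub>R ?a"
  have e: "norm e = 1" using \<tau> by (simp add: e_def \<tau>_def)
  have ee: "e \<bullet> e = 1" using e by (simp add: norm_eq_1)
  have Le: "L e = (- \<tau>) *\<^sub>R b"
    using b \<tau> unfolding e_def linear_cmul[OF L(1)] \<tau>_def[symmetric] by (simp add: power2_eq_square)
  have Lie: "L x $ i = - \<tau> * (x \<bullet> e)" for x using \<tau> by (simp add: Li e_def)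
  define d where "d = A *v b"
  define V where "V \<zeta> = A *v L (\<zeta> - (\<zeta> \<bullet> e) *\<^sub>R e)" for \<zeta>
  define H where "H x = measure std_gauss {\<zeta>. V \<zeta> \<le> t + x *\<^sub>R d}" for x
  interpret g: prob_space "std_gauss :: (real^'p) measure" by (rule prob_space_std_gauss)
  interpret g1: prob_space "std_gauss :: real measure" by (rule prob_space_std_gauss)
  interpret P: pair_prob_space "std_gauss :: (real^'p) measure" "std_gauss :: real measure" ..
  have [measurable]: "L \<in> borel \<rightarrow>\<^sub>M borel" by (rule borel_measurable_linear[OF L(1)])
  have [measurable]: "V \<in> borel \<rightarrow>\<^sub>M borel" unfolding V_def[abs_def] by measurable
  have H[measurable]: "H \<in> borel_measurable borel"
  proof -
    have "{p. V (fst p) \<le> t + snd p *\<^sub>R d} \<in> sets (std_gauss \<Otimes>\<^sub>M (std_gauss :: real measure))"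
    proof -
      have "{p \<in> space (std_gauss \<Otimes>\<^sub>M (std_gauss :: real measure)). V (fst p) \<le> t + snd p *\<^sub>R d}
          \<in> sets (std_gauss \<Otimes>\<^sub>M (std_gauss :: real measure))" by measurable
      then show ?thesis by (simp add: space_pair_measure)
    qed
    from P.measurable_emeasure_Pair2[OF this] have "H \<in> borel_measurable std_gauss"
      unfolding H_def[abs_def] measure_def by (simp add: vimage_def)
    then show ?thesis by (simp cong: measurable_cong_sets)
  qed
  let ?\<mu> = "density lborel (\<lambda>x. ennreal (normal_density 0 \<tau> x))"
  have \<mu>: "?\<mu> = distr std_gauss borel (\<lambda>z. \<tau> * z)"
    using distr_std_normal_affine[OF \<tau>, of 0] by simp
  have int: "(\<integral>x. F x \<partial>?\<mu>) = (\<integral>z. F (\<tau> * z) \<partial>std_gauss)" if "F \<in> borel_measurable borel" for F :: "real \<Rightarrow> real"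
    unfolding \<mu> using that by (subst integral_distr) auto
  have Lres: "L (\<zeta> - (\<zeta> \<bullet> e) *\<^sub>R e + z *\<^sub>R e) = L (\<zeta> - (\<zeta> \<bullet> e) *\<^sub>R e) - (\<tau> * z) *\<^sub>R b" for \<zeta> z
    using L(1) Le by (simp add: linear_add linear_cmul)
  have ALres: "A *v L (\<zeta> - (\<zeta> \<bullet> e) *\<^sub>R e + z *\<^sub>R e) \<le> t \<longleftrightarrow> V \<zeta> \<le> t + (\<tau> * z) *\<^sub>R d" for \<zeta> z
  proof -
    have "A *v L (\<zeta> - (\<zeta> \<bullet> e) *\<^sub>R e + z *\<^sub>R e) = V \<zeta> - (\<tau> * z) *\<^sub>R d"
      by (simp only: Lres matrix_vector_mult_diff_distrib matrix_vector_mult_scaleR V_def d_def)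
    then show ?thesis by (simp only: diff_le_eq)
  qed
  have Lires: "L (\<zeta> - (\<zeta> \<bullet> e) *\<^sub>R e + z *\<^sub>R e) $ i = - (\<tau> * z)" for \<zeta> z
    unfolding Lie by (simp add: inner_add inner_diff ee)
  have win: "limit_cdf A t b i s L \<nu> = (\<integral>x. (if \<bar>x - \<nu>\<bar> < s then H \<nu> else H x) \<partial>?\<mu>)" for \<nu>
  proof -
    let ?S = "{\<zeta>. if \<bar>L \<zeta> $ i + \<nu>\<bar> < s then A *v (L \<zeta> - (L \<zeta> $ i + \<nu>) *\<^sub>R b) \<le> t else A *v L \<zeta> \<le> t}"
    have S: "?S \<in> sets borel" by measurable
    have in_S: "\<zeta> - (\<zeta> \<bullet> e) *\<^sub>R e + z *\<^sub>R e \<in> ?S \<longleftrightarrow>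
        (if \<bar>\<tau> * z - \<nu>\<bar> < s then V \<zeta> \<le> t + \<nu> *\<^sub>R d else V \<zeta> \<le> t + (\<tau> * z) *\<^sub>R d)" for \<zeta> z
    proof -
      let ?x = "\<zeta> - (\<zeta> \<bullet> e) *\<^sub>R e + z *\<^sub>R e"
      have 1: "L ?x $ i + \<nu> = - (\<tau> * z - \<nu>)" by (simp only: Lires)
      have 2: "A *v (L ?x - (- (\<tau> * z - \<nu>)) *\<^sub>R b) \<le> t \<longleftrightarrow> V \<zeta> \<le> t + \<nu> *\<^sub>R d"
      proof -
        have "L ?x - (- (\<tau> * z - \<nu>)) *\<^sub>R b = L (\<zeta> - (\<zeta> \<bullet> e) *\<^sub>R e) - \<nu> *\<^sub>R b"
          by (simp only: Lres) (simp add: scaleR_diff_left)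
        then have "A *v (L ?x - (- (\<tau> * z - \<nu>)) *\<^sub>R b) = V \<zeta> - \<nu> *\<^sub>R d"
          by (simp only: matrix_vector_mult_diff_distrib matrix_vector_mult_scaleR V_def d_def)
        then show ?thesis by (simp only: diff_le_eq)
      qed
      show ?thesis unfolding mem_Collect_eq 1 2 ALres abs_minus_cancel by (rule refl)
    qed
    have "limit_cdf A t b i s L \<nu>
        = (\<integral>z. measure std_gauss {\<zeta>. \<zeta> - (\<zeta> \<bullet> e) *\<^sub>R e + z *\<^sub>R e \<in> ?S} \<partial>(std_gauss :: real measure))"
      unfolding limit_cdf_def by (rule measure_std_gauss_resample[OF e S])
    also have "\<dots> = (\<integral>z. (if \<bar>\<tau> * z - \<nu>\<bar> < s then H \<nu> else H (\<tau> * z)) \<partial>(std_gauss :: real measure))"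
      unfolding in_S by (intro Bochner_Integration.integral_cong refl) (simp add: H_def)
    also have "\<dots> = (\<integral>x. (if \<bar>x - \<nu>\<bar> < s then H \<nu> else H x) \<partial>?\<mu>)"
      by (rule int[symmetric]) measurable
    finally show ?thesis .
  qed
  have pos: "(\<integral>x. H x \<partial>?\<mu>) > 0"
  proof -
    have "(\<integral>x. H x \<partial>?\<mu>) = measure std_gauss {\<zeta>. A *v L \<zeta> \<le> t}"
      unfolding int[OF H] by (subst measure_std_gauss_resample[OF e]) (simp_all add: ALres H_def)
    also have "\<dots> > 0"
    proof -
      let ?U = "\<Inter>j\<in>UNIV. {\<zeta>. (A *v L \<zeta>) $ j < t $ j}"
      have "continuous_on UNIV (\<lambda>\<zeta>. A *v L \<zeta>)"
        using linear_compose[OF L(1) matrix_vector_mul_linear, of A]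
        by (intro linear_continuous_on) (simp add: comp_def linear_linear)
      then have "open ?U"
        by (intro open_INT ballI open_Collect_less continuous_intros) auto
      moreover have "?U \<noteq> {}"
      proof -
        obtain y where "A *v y = t - (\<chi> j. 1)" using rank full_rank_surjective[of A] by (metis surjD)
        moreover obtain \<zeta> where "L \<zeta> = y" using L(2) by (metis surjD)
        ultimately have "\<zeta> \<in> ?U" by simp
        then show ?thesis by blast
      qed
      ultimately have "0 < measure std_gauss ?U" by (rule std_gauss_open_pos)
      also have "\<dots> \<le> measure std_gauss {\<zeta>. A *v L \<zeta> \<le> t}"
        by (intro g.finite_measure_mono) (auto simp: less_eq_vec_def intro: less_imp_le)
      finally show ?thesis .
    qed
    finally show ?thesis .
  qed
  obtain j where j: "d $ j \<noteq> 0" using Ab unfolding d_def[symmetric] by (metis vec_eq_iff zero_index)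
  define \<epsilon> where "\<epsilon> = - sgn (d $ j)"
  have \<epsilon>: "\<epsilon> = 1 \<or> \<epsilon> = -1" using j by (auto simp: \<epsilon>_def sgn_if)
  have \<epsilon>d: "\<epsilon> * d $ j = - \<bar>d $ j\<bar>" by (simp add: \<epsilon>_def sgn_if)
  have lim: "((\<lambda>x. H (\<epsilon> * x)) \<longlongrightarrow> 0) at_top"
  proof -
    have "((\<lambda>x. \<integral>\<zeta>. indicator {\<zeta>. V \<zeta> \<le> t + (\<epsilon> * x) *\<^sub>R d} \<zeta> \<partial>std_gauss) \<longlongrightarrow> (\<integral>\<zeta>. (0::real) \<partial>(std_gauss :: (real^'p) measure))) at_top"
    proof (rule integral_dominated_convergence_at_top[where w="\<lambda>_. 1"])
      show "AE \<zeta> in std_gauss. ((\<lambda>x. indicator {\<zeta>. V \<zeta> \<le> t + (\<epsilon> * x) *\<^sub>R d} \<zeta> :: real) \<longlongrightarrow> 0) at_top"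
      proof (rule AE_I2)
        fix \<zeta> :: "real^'p"
        have "\<forall>\<^sub>F x in at_top. indicator {\<zeta>. V \<zeta> \<le> t + (\<epsilon> * x) *\<^sub>R d} \<zeta> = (0::real)"
          using eventually_gt_at_top[of "(t $ j - V \<zeta> $ j) / \<bar>d $ j\<bar>"]
        proof eventually_elim
          case (elim x)
          then have "t $ j - V \<zeta> $ j < x * \<bar>d $ j\<bar>" using j by (simp add: pos_divide_less_eq)
          then have "t $ j + (\<epsilon> * x) * d $ j < V \<zeta> $ j"
          proof -
            have "(\<epsilon> * x) * d $ j = x * (\<epsilon> * d $ j)" by simp
            then show ?thesis using \<open>t $ j - V \<zeta> $ j < x * \<bar>d $ j\<bar>\<close> by (simp only: \<epsilon>d)
          qed
          then have "\<not> V \<zeta> \<le> t + (\<epsilon> * x) *\<^sub>R d"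
            by (auto simp: less_eq_vec_def not_le intro!: exI[of _ j])
          then show ?case by simp
        qed
        then show "((\<lambda>x. indicator {\<zeta>. V \<zeta> \<le> t + (\<epsilon> * x) *\<^sub>R d} \<zeta> :: real) \<longlongrightarrow> 0) at_top"
          by (rule tendsto_eventually)
      qed
    qed (simp_all add: indicator_def)
    then show ?thesis by (simp add: H_def)
  qed
  show ?thesis
    unfolding win
  proof (rule window_average_not_constant[OF _ _ _ _ _ s \<epsilon> lim pos])
    show "prob_space ?\<mu>" by (rule prob_space_normal_density[OF \<tau>])
    show "0 \<le> H x \<and> H x \<le> 1" for x by (simp add: H_def)
  qed (use \<tau> in \<open>simp_all add: normal_density_pos\<close>)
qed

section \<open>Continuity of the limit in its parameters\<close>

text \<open>By Cramer's rule the entries of the inverse are quotients of determinants.\<close>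
lemma matrix_inv_tendsto:
  fixes M :: "nat \<Rightarrow> real^'n^'n"
  assumes lim: "M \<longlonglongrightarrow> Q" and Q: "invertible Q"
  shows "(\<lambda>n. matrix_inv (M n)) \<longlonglongrightarrow> matrix_inv Q"
proof -
  have entries: "(\<lambda>n. M n $ a $ b) \<longlonglongrightarrow> Q $ a $ b" for a b
    by (intro tendsto_vec_nth lim)
  have det_lim: "(\<lambda>n. det (F n)) \<longlonglongrightarrow> det G"
    if "\<And>a b. (\<lambda>n. F n $ a $ b) \<longlonglongrightarrow> G $ a $ b" for F and G :: "real^'n^'n"
    unfolding det_def by (intro tendsto_sum tendsto_mult tendsto_prod tendsto_const that)
  have dQ: "det Q \<noteq> 0" using Q by (simp add: invertible_det_nz)
  have dlim: "(\<lambda>n. det (M n)) \<longlonglongrightarrow> det Q" by (rule det_lim[OF entries])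
  then have ev: "\<forall>\<^sub>F n in sequentially. det (M n) \<noteq> 0" by (rule tendsto_imp_eventually_ne[OF _ dQ])
  let ?N = "\<lambda>F a b. (\<chi> i j. if j = a then axis b 1 $ i else F $ i $ j) :: real^'n^'n"
  have cram: "matrix_inv F $ a $ b = det (?N F a b) / det F" if "det F \<noteq> 0" for F :: "real^'n^'n" and a b
  proof -
    have "F *v (matrix_inv F *v axis b 1) = axis b 1"
      using that by (simp add: matrix_inv_works invertible_det_nz)
    then have "matrix_inv F *v axis b 1 = (\<chi> k. det (?N F k b) / det F)"
      using cramer[OF that] by blast
    then have "(matrix_inv F *v axis b 1) $ a = det (?N F a b) / det F" by simp
    then show ?thesis by (simp add: matrix_vector_mul_component inner_axis)
  qed
  have "(\<lambda>n. matrix_inv (M n) $ a $ b) \<longlonglongrightarrow> matrix_inv Q $ a $ b" for a b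
  proof -
    have "(\<lambda>n. det (?N (M n) a b)) \<longlonglongrightarrow> det (?N Q a b)"
      by (rule det_lim) (use entries in auto)
    then have "(\<lambda>n. det (?N (M n) a b) / det (M n)) \<longlonglongrightarrow> det (?N Q a b) / det Q"
      by (intro tendsto_divide dlim dQ)
    moreover have "\<forall>\<^sub>F n in sequentially. det (?N (M n) a b) / det (M n) = matrix_inv (M n) $ a $ b"
      using ev by eventually_elim (simp add: cram)
    ultimately show ?thesis unfolding cram[OF dQ] by (rule Lim_transform_eventually)
  qed
  then show ?thesis by (intro vec_tendstoI)
qed

text \<open>\<open>W = L\<^sup>-\<^sup>1 L'\<close> satisfies \<open>W W\<^sup>T = L\<^sup>-\<^sup>1 (L L\<^sup>T) (L\<^sup>-\<^sup>1)\<^sup>T\<close>, the identity.\<close>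
lemma orthogonal_right_factor:
  fixes L L' :: "real^'n^'n"
  assumes eq: "L ** transpose L = L' ** transpose L'" and inv: "invertible (L ** transpose L)"
  obtains W where "orthogonal_transformation ((*v) W)" "(*v) L' = (*v) L \<circ> (*v) W"
proof -
  have iL: "invertible L"
    using inv by (metis det_mul invertible_det_nz mult_zero_left)
  then obtain K where K: "L ** K = mat 1" "K ** L = mat 1" by (auto simp: invertible_def)
  define W where "W = K ** L'"
  have LW: "L ** W = L'" by (simp add: W_def matrix_mul_assoc K)
  have "W ** transpose W = K ** (L' ** transpose L') ** transpose K"
    by (simp add: W_def matrix_transpose_mul matrix_mul_assoc)
  also have "\<dots> = (K ** L) ** (transpose L ** transpose K)"
    by (simp add: eq[symmetric] matrix_mul_assoc)
  also have "\<dots> = mat 1" by (simp add: matrix_transpose_mul[symmetric] K transpose_mat)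
  finally have "orthogonal_matrix W"
    by (simp add: orthogonal_matrix_def matrix_left_right_inverse)
  then have "orthogonal_transformation ((*v) W)"
    by (simp add: orthogonal_transformation_matrix)
  moreover have "(*v) L' = (*v) L \<circ> (*v) W"
    by (simp add: fun_eq_iff matrix_vector_mul_assoc LW)
  ultimately show ?thesis by (rule that)
qed

lemma matrix_factor_facts:
  fixes L :: "real^'p^'p"
  assumes L: "L ** transpose L = \<sigma>\<^sup>2 *\<^sub>R matrix_inv Q" and Q: "invertible Q" and \<sigma>: "\<sigma> > 0"
  shows "surj ((*v) L)" "adjoint ((*v) L) (axis i 1) \<noteq> 0" "matrix_inv Q $ i $ i > 0"
    "L *v (adjoint ((*v) L) (axis i 1)) = (norm (adjoint ((*v) L) (axis i 1)))\<^sup>2 *\<^sub>R drop_dir Q i"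
    "(norm (adjoint ((*v) L) (axis i 1)))\<^sup>2 = \<sigma>\<^sup>2 * matrix_inv Q $ i $ i"
proof -
  let ?a = "adjoint ((*v) L) (axis i 1)"
  have a: "?a = transpose L *v axis i 1" by (simp add: adjoint_matrix)
  have LLx: "L *v (transpose L *v x) = \<sigma>\<^sup>2 *\<^sub>R (matrix_inv Q *v x)" for x
    by (simp only: matrix_vector_mul_assoc L scaleR_matrix_vector_assoc)
  show surj: "surj ((*v) L)"
  proof (rule surjI)
    fix y
    show "L *v (transpose L *v ((1 / \<sigma>\<^sup>2) *\<^sub>R (Q *v y))) = y"
      using \<sigma> unfolding matrix_vector_mult_scaleR LLx by (simp add: matrix_inv_works[OF Q])
  qed
  have Li: "(L *v x) $ i = x \<bullet> ?a" for x
    using adjoint_works[of "(*v) L" x "axis i 1"] by (simp add: inner_axis)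
  obtain x0 where "L *v x0 = axis i 1" using surj by (metis surjD)
  then show a0: "?a \<noteq> 0" using Li[of x0] by auto
  have "(norm ?a)\<^sup>2 = (L *v ?a) $ i" by (simp add: Li power2_norm_eq_inner)
  moreover have La: "L *v ?a = \<sigma>\<^sup>2 *\<^sub>R (matrix_inv Q *v axis i 1)"
    unfolding a by (rule LLx)
  ultimately show n: "(norm ?a)\<^sup>2 = \<sigma>\<^sup>2 * matrix_inv Q $ i $ i"
    by (simp only: vector_scaleR_component real_scaleR_def mult_axis_diag)
  have "(norm ?a)\<^sup>2 > 0" using a0 by simp
  then show pos: "matrix_inv Q $ i $ i > 0" unfolding n using \<sigma> by (simp add: zero_less_mult_iff)
  show "L *v ?a = (norm ?a)\<^sup>2 *\<^sub>R drop_dir Q i"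
    unfolding n La using pos by (simp add: drop_dir_def)
qed

lemma eventually_le_vec_iff:
  fixes x :: "nat \<Rightarrow> real^'k"
  assumes x: "x \<longlonglongrightarrow> y" and ne: "\<And>j. y $ j \<noteq> t $ j"
  shows "\<forall>\<^sub>F n in sequentially. (x n \<le> t) = (y \<le> t)"
proof -
  have "\<forall>\<^sub>F n in sequentially. (x n $ j \<le> t $ j) = (y $ j \<le> t $ j)" for j
  proof -
    have l: "(\<lambda>n. x n $ j) \<longlonglongrightarrow> y $ j" by (intro tendsto_vec_nth x)
    show ?thesis
    proof (cases "y $ j < t $ j")
      case True
      then show ?thesis using order_tendstoD(2)[OF l True] by (auto elim!: eventually_mono)
    next
      case False
      then have "t $ j < y $ j" using ne[of j] by linarith
      then show ?thesis using order_tendstoD(1)[OF l, of "t $ j"] by (auto elim!: eventually_mono)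
    qed
  qed
  then have "\<forall>\<^sub>F n in sequentially. \<forall>j. (x n $ j \<le> t $ j) = (y $ j \<le> t $ j)"
    by (rule eventually_all_finite)
  then show ?thesis by eventually_elim (simp add: less_eq_vec_def)
qed

text \<open>A coordinate of the limit of the restricted estimator may be degenerate, for instance when
  \<open>A\<close> selects just the \<open>i\<close>-th coordinate. Its atom then lies on the boundary of the orthant at \<open>t\<close>
  for one exceptional \<open>\<nu>\<close>, at which the distribution functions need not converge.\<close>
definition boundary_points :: "real^'k \<Rightarrow> real^'k \<Rightarrow> real set" where
  "boundary_points t d = {\<nu>. \<exists>j. d $ j \<noteq> 0 \<and> t $ j + \<nu> * d $ j = 0}"

lemma finite_boundary_points: "finite (boundary_points t d)"
proof (rule finite_subset)
  show "boundary_points t d \<subseteq> range (\<lambda>j. - t $ j / d $ j)"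
  proof
    fix \<nu> assume "\<nu> \<in> boundary_points t d"
    then obtain j where j: "d $ j \<noteq> 0" "t $ j + \<nu> * d $ j = 0" by (auto simp: boundary_points_def)
    then have "\<nu> * d $ j = - t $ j" by linarith
    then have "\<nu> = - t $ j / d $ j" by (rule eq_divide_imp[OF j(1)])
    then show "\<nu> \<in> range (\<lambda>j. - t $ j / d $ j)" by (rule image_eqI) simp
  qed
qed simp

text \<open>By dominated convergence, since almost surely no coordinate lies on the boundary of the orthant and
  the pretest statistic differs from its critical value: the coordinates in question are nonzero linear
  forms in a Gaussian vector, apart from degenerate ones, which are kept off the boundary
  by the choice of \<open>\<nu>\<close>.\<close>
lemma limit_cdf_tendsto_of_convergent:
  fixes A :: "real^'p^'k" and L :: "nat \<Rightarrow> real^'p^'p"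
  assumes rank: "rank A = CARD('k)"
    and lim: "L \<longlonglongrightarrow> L'" "b \<longlonglongrightarrow> b'" "s \<longlonglongrightarrow> s'"
    and L': "surj ((*v) L')"
    and \<nu>: "\<nu> \<notin> boundary_points t (A *v b')"
  shows "(\<lambda>n. limit_cdf A t (b n) i (s n) ((*v) (L n)) \<nu>) \<longlonglongrightarrow> limit_cdf A t b' i s' ((*v) L') \<nu>"
proof -
  interpret g: prob_space "std_gauss :: (real^'p) measure" by (rule prob_space_std_gauss)
  let ?F = "\<lambda>(M :: real^'p^'p) \<zeta>. A *v (M *v \<zeta>)"
  let ?R = "\<lambda>(M :: real^'p^'p) b \<zeta>. A *v (M *v \<zeta> - ((M *v \<zeta>) $ i + \<nu>) *\<^sub>R b)"
  let ?S = "\<lambda>M b s. {\<zeta>. if \<bar>(M *v \<zeta>) $ i + \<nu>\<bar> < s then ?R M b \<zeta> \<le> t else ?F M \<zeta> \<le> t}"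
  have S: "?S M b s \<in> sets std_gauss" for M b s
  proof -
    have "{\<zeta> \<in> space std_gauss. if \<bar>(M *v \<zeta>) $ i + \<nu>\<bar> < s then ?R M b \<zeta> \<le> t else ?F M \<zeta> \<le> t} \<in> sets std_gauss"
      by measurable
    then show ?thesis by simp
  qed
  have surj: "surj (\<lambda>\<zeta>. ?F L' \<zeta>)"
  proof -
    have "surj ((*v) A)" using rank full_rank_surjective by blast
    from comp_surj[OF L' this] show ?thesis by (simp add: comp_def)
  qed
  have comp: "(M *v \<zeta>) $ j = \<zeta> \<bullet> M $ j" for M :: "real^'p^'m" and \<zeta> j
    by (simp add: matrix_vector_mul_component inner_commute)
  define AL where "AL = A ** L'"
  have AL: "?F L' \<zeta> = AL *v \<zeta>" for \<zeta> by (simp add: AL_def matrix_vector_mul_assoc)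
  have AL_nz: "AL $ j \<noteq> 0" for j
  proof
    assume "AL $ j = 0"
    then have "(?F L' \<zeta>) $ j = 0" for \<zeta> by (simp add: AL comp)
    moreover obtain \<zeta> where "?F L' \<zeta> = axis j 1" using surj by (metis surjD)
    ultimately show False by (metis axis_nth zero_neq_one)
  qed
  have L'_nz: "L' $ i \<noteq> 0"
  proof
    assume "L' $ i = 0"
    then have "(L' *v \<zeta>) $ i = 0" for \<zeta> by (simp add: comp)
    moreover obtain \<zeta> where "L' *v \<zeta> = axis i 1" using L' by (metis surjD)
    ultimately show False by (metis axis_nth zero_neq_one)
  qed
  define d where "d = A *v b'"
  have R: "?R L' b' \<zeta> $ j = \<zeta> \<bullet> (AL $ j - d $ j *\<^sub>R L' $ i) - \<nu> * d $ j" for \<zeta> j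
    by (simp add: matrix_vector_mult_diff_distrib matrix_vector_mult_scaleR AL d_def[symmetric] comp
        inner_diff algebra_simps)
  have ae1: "AE \<zeta> in std_gauss. \<forall>j\<in>UNIV. ?F L' \<zeta> $ j \<noteq> t $ j"
    unfolding AL comp using AL_nz by (intro AE_finite_allI std_gauss_hyperplane) auto
  have ae2: "AE \<zeta> in std_gauss. \<forall>j\<in>UNIV. ?R L' b' \<zeta> $ j \<noteq> t $ j"
  proof (intro AE_finite_allI)
    fix j
    show "AE \<zeta> in std_gauss. ?R L' b' \<zeta> $ j \<noteq> t $ j"
    proof (cases "AL $ j - d $ j *\<^sub>R L' $ i = 0")
      case True
      then have "d $ j \<noteq> 0" using AL_nz[of j] by auto
      then have "t $ j + \<nu> * d $ j \<noteq> 0" using \<nu> by (auto simp: boundary_points_def d_def)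
      then show ?thesis unfolding R True by (intro AE_I2) auto
    next
      case False
      from std_gauss_hyperplane[OF this, of "t $ j + \<nu> * d $ j"] show ?thesis
        unfolding R by eventually_elim auto
    qed
  qed simp
  have ae3: "AE \<zeta> in std_gauss. (L' *v \<zeta>) $ i \<noteq> s' - \<nu>" "AE \<zeta> in std_gauss. (L' *v \<zeta>) $ i \<noteq> - s' - \<nu>"
    unfolding comp by (rule std_gauss_hyperplane[OF L'_nz])+
  have "(\<lambda>n. \<integral>\<zeta>. indicator (?S (L n) (b n) (s n)) \<zeta> \<partial>std_gauss)
      \<longlonglongrightarrow> (\<integral>\<zeta>. (indicator (?S L' b' s') \<zeta> :: real) \<partial>std_gauss)"
  proof (rule integral_dominated_convergence[where w="\<lambda>_. 1"])
    show "AE \<zeta> in std_gauss. (\<lambda>n. indicator (?S (L n) (b n) (s n)) \<zeta> :: real)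
        \<longlonglongrightarrow> indicator (?S L' b' s') \<zeta>"
      using ae1 ae2 ae3
    proof eventually_elim
      case (elim \<zeta>)
      have l1: "(\<lambda>n. L n *v \<zeta>) \<longlonglongrightarrow> L' *v \<zeta>"
        unfolding matrix_vector_mult_def
        by (intro vec_tendstoI) (auto intro!: tendsto_sum tendsto_mult tendsto_vec_nth lim)
      have Av: "(\<lambda>n. A *v x n) \<longlonglongrightarrow> A *v y" if "x \<longlonglongrightarrow> y" for x y
        unfolding matrix_vector_mult_def
        by (intro vec_tendstoI) (auto intro!: tendsto_sum tendsto_mult tendsto_vec_nth that)
      have e1: "\<forall>\<^sub>F n in sequentially. (?F (L n) \<zeta> \<le> t) = (?F L' \<zeta> \<le> t)"
        using elim(1) by (intro eventually_le_vec_iff Av l1) auto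
      have e2: "\<forall>\<^sub>F n in sequentially. (?R (L n) (b n) \<zeta> \<le> t) = (?R L' b' \<zeta> \<le> t)"
        using elim(2) by (intro eventually_le_vec_iff Av tendsto_intros l1 lim) auto
      have "(\<lambda>n. \<bar>(L n *v \<zeta>) $ i + \<nu>\<bar> - s n) \<longlonglongrightarrow> \<bar>(L' *v \<zeta>) $ i + \<nu>\<bar> - s'"
        by (intro tendsto_intros l1 lim)
      moreover have "\<bar>(L' *v \<zeta>) $ i + \<nu>\<bar> - s' \<noteq> 0" using elim(3,4) by (auto simp: abs_if split: if_splits)
      ultimately have e3: "\<forall>\<^sub>F n in sequentially. (\<bar>(L n *v \<zeta>) $ i + \<nu>\<bar> < s n) = (\<bar>(L' *v \<zeta>) $ i + \<nu>\<bar> < s')"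
      proof (cases "\<bar>(L' *v \<zeta>) $ i + \<nu>\<bar> - s' < 0")
        case True
        then show ?thesis
          using order_tendstoD(2)[OF \<open>(\<lambda>n. \<bar>(L n *v \<zeta>) $ i + \<nu>\<bar> - s n) \<longlonglongrightarrow> _\<close> True]
          by (auto elim!: eventually_mono)
      next
        case False
        then have "0 < \<bar>(L' *v \<zeta>) $ i + \<nu>\<bar> - s'" using \<open>\<bar>(L' *v \<zeta>) $ i + \<nu>\<bar> - s' \<noteq> 0\<close> by linarith
        from order_tendstoD(1)[OF \<open>(\<lambda>n. \<bar>(L n *v \<zeta>) $ i + \<nu>\<bar> - s n) \<longlonglongrightarrow> _\<close> this] False
        show ?thesis by (auto elim!: eventually_mono)
      qed
      from e1 e2 e3 have "\<forall>\<^sub>F n in sequentially. indicator (?S (L n) (b n) (s n)) \<zeta>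
          = (indicator (?S L' b' s') \<zeta> :: real)"
        by eventually_elim (simp add: indicator_def)
      then show ?case by (rule tendsto_eventually)
    qed
  qed (use S in \<open>auto simp: indicator_def\<close>)
  then show ?thesis using S by (simp add: limit_cdf_def)
qed

text \<open>The squared norms of the rows of a factor are the diagonal entries of the product, which bounds
  the factors.\<close>
lemma factor_subsequence:
  fixes L :: "nat \<Rightarrow> real^'p^'p"
  assumes LL: "\<And>n. L n ** transpose (L n) = V n" and V: "V \<longlonglongrightarrow> W"
  obtains l q where "strict_mono (q :: nat \<Rightarrow> nat)" "(\<lambda>n. L (q n)) \<longlonglongrightarrow> l" "l ** transpose l = W"
proof -
  have "bounded (range V)" using V convergent_def convergent_imp_bounded by blast
  then obtain B where B: "\<And>n. norm (V n) \<le> B" by (auto simp: bounded_iff)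
  have "norm (L n) \<le> (\<Sum>a\<in>(UNIV::'p set). (\<Sum>c\<in>(UNIV::'p set). sqrt B))" for n
  proof -
    have "\<bar>L n $ a $ c\<bar> \<le> sqrt B" for a c
    proof -
      have "(L n $ a $ c)\<^sup>2 \<le> (\<Sum>k\<in>UNIV. (L n $ a $ k)\<^sup>2)"
        by (intro member_le_sum) auto
      also have "\<dots> = V n $ a $ a"
        by (simp add: LL[symmetric] matrix_matrix_mult_def transpose_def power2_eq_square)
      also have "\<dots> \<le> B"
        using B[of n] component_le_norm_cart[of "V n $ a" a] Finite_Cartesian_Product.norm_nth_le[of "V n" a]
        by linarith
      finally show ?thesis using real_le_rsqrt real_sqrt_le_mono real_sqrt_abs by metis
    qed
    then have "norm (L n $ a) \<le> (\<Sum>c\<in>(UNIV::'p set). sqrt B)" for a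
      using norm_le_l1_cart[of "L n $ a"] by (meson order_trans sum_mono)
    then show ?thesis
      unfolding norm_vec_def[of "L n"] by (intro order_trans[OF L2_set_le_sum] sum_mono) auto
  qed
  then have "bounded (range L)" by (auto simp: bounded_iff)
  then obtain l q where q: "strict_mono (q :: nat \<Rightarrow> nat)" and l: "(L \<circ> q) \<longlonglongrightarrow> l"
    using bounded_imp_convergent_subsequence by blast
  have lq: "(\<lambda>n. L (q n)) \<longlonglongrightarrow> l" using l by (simp add: comp_def)
  have "l ** transpose l = W"
  proof (rule LIMSEQ_unique)
    show "(\<lambda>n. V (q n)) \<longlonglongrightarrow> W"
      using LIMSEQ_subseq_LIMSEQ[OF V q] by (simp add: comp_def)
    show "(\<lambda>n. V (q n)) \<longlonglongrightarrow> l ** transpose l"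
      unfolding LL[symmetric] matrix_matrix_mult_def transpose_def
      by (intro vec_tendstoI) (auto intro!: tendsto_sum tendsto_mult tendsto_vec_nth lq)
  qed
  with q lq show ?thesis by (rule that)
qed

text \<open>The factors \<open>L n\<close> need not converge, but they stay bounded, and any two limit points differ by
  a rotation, which leaves the limit law unchanged.\<close>
lemma limit_cdf_tendsto:
  fixes A :: "real^'p^'k" and L :: "nat \<Rightarrow> real^'p^'p"
  assumes rank: "rank A = CARD('k)" and \<sigma>: "\<sigma> > 0" and Q: "invertible Q"
    and LL: "\<And>n. L n ** transpose (L n) = V n" and V: "V \<longlonglongrightarrow> \<sigma>\<^sup>2 *\<^sub>R matrix_inv Q"
    and lim: "b \<longlonglongrightarrow> b'" "s \<longlonglongrightarrow> s'"
    and L': "L' ** transpose L' = \<sigma>\<^sup>2 *\<^sub>R matrix_inv Q"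
    and \<nu>: "\<nu> \<notin> boundary_points t (A *v b')"
  shows "(\<lambda>n. limit_cdf A t (b n) i (s n) ((*v) (L n)) \<nu>) \<longlonglongrightarrow> limit_cdf A t b' i s' ((*v) L') \<nu>"
    (is "?K \<longlonglongrightarrow> ?G")
proof (rule ccontr)
  assume "\<not> ?K \<longlonglongrightarrow> ?G"
  then obtain \<epsilon> where \<epsilon>: "\<epsilon> > 0" and "\<not> (\<forall>\<^sub>F n in sequentially. dist (?K n) ?G < \<epsilon>)"
    by (auto simp: tendsto_iff)
  then obtain r :: "nat \<Rightarrow> nat" where r: "strict_mono r" and far: "\<And>n. \<not> dist (?K (r n)) ?G < \<epsilon>"
    using not_eventually_sequentiallyD by blast
  obtain l r' where r': "strict_mono (r' :: nat \<Rightarrow> nat)" and l: "(\<lambda>n. L (r (r' n))) \<longlonglongrightarrow> l"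
    and ll: "l ** transpose l = \<sigma>\<^sup>2 *\<^sub>R matrix_inv Q"
    using LIMSEQ_subseq_LIMSEQ[OF V r]
    by (rule factor_subsequence[where L="\<lambda>n. L (r n)" and V="V \<circ> r", rotated]) (auto simp: LL)
  define q where "q = r \<circ> r'"
  have q: "strict_mono q" unfolding q_def using r r' by (rule strict_mono_o)
  have lq: "(\<lambda>n. L (q n)) \<longlonglongrightarrow> l" using l by (simp add: q_def comp_def)
  have "(\<lambda>n. limit_cdf A t (b (q n)) i (s (q n)) ((*v) (L (q n))) \<nu>) \<longlonglongrightarrow> limit_cdf A t b' i s' ((*v) l) \<nu>"
    using lim[THEN LIMSEQ_subseq_LIMSEQ, OF q] matrix_factor_facts(1)[OF ll Q \<sigma>]
    by (intro limit_cdf_tendsto_of_convergent rank lq \<nu>) (simp_all add: comp_def)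
  moreover have "limit_cdf A t b' i s' ((*v) l) \<nu> = ?G"
  proof -
    have "invertible (L' ** transpose L')"
      unfolding invertible_iff_kernel
      using \<sigma> by (auto simp: L' scaleR_matrix_vector_assoc[symmetric]) (metis Q matrix_inv_works(1) matrix_vector_mult_0_right)
    from orthogonal_right_factor[OF _ this, of l] obtain W where
      W: "orthogonal_transformation ((*v) W)" "(*v) l = (*v) L' \<circ> (*v) W"
      using L' ll by metis
    show ?thesis unfolding W(2) by (rule limit_cdf_orthogonal[OF W(1)]) simp
  qed
  ultimately have "\<forall>\<^sub>F n in sequentially. dist (?K (q n)) ?G < \<epsilon>"
    using \<epsilon> by (simp add: tendsto_iff)
  then obtain n where "dist (?K (q n)) ?G < \<epsilon>" by (auto simp: eventually_sequentially)
  then show False using far[of "r' n"] by (simp add: q_def)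
qed

section \<open>The residual variance\<close>

lemma integrable_std_gauss_centered_square:
  "integrable std_gauss (\<lambda>x. x\<^sup>2 - 1 :: real)" "integrable std_gauss (\<lambda>x. (x\<^sup>2 - 1)\<^sup>2 :: real)"
proof -
  have i: "integrable lborel (\<lambda>x. std_normal_density x * x ^ k)" for k
    by (rule integrable_std_normal_moment)
  have "integrable lborel (\<lambda>x. std_normal_density x * x ^ 2 - std_normal_density x * x ^ 0)"
    using i[of 2] i[of 0] by (rule Bochner_Integration.integrable_diff)
  then show "integrable std_gauss (\<lambda>x. x\<^sup>2 - 1 :: real)"
    unfolding std_gauss_real by (subst integrable_density) (auto simp: algebra_simps)
  have "integrable lborel (\<lambda>x. std_normal_density x * x ^ 4 - 2 * (std_normal_density x * x ^ 2)
      + std_normal_density x * x ^ 0)"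
    using i[of 4] i[of 2] i[of 0] by (intro Bochner_Integration.integrable_add
        Bochner_Integration.integrable_diff integrable_mult_right) auto
  moreover have "std_normal_density x * x ^ 4 - 2 * (std_normal_density x * x ^ 2)
      + std_normal_density x * x ^ 0 = std_normal_density x * (x\<^sup>2 - 1)\<^sup>2" for x
    by (simp add: power2_diff power_mult[symmetric] algebra_simps)
  ultimately show "integrable std_gauss (\<lambda>x. (x\<^sup>2 - 1)\<^sup>2 :: real)"
    unfolding std_gauss_real by (subst integrable_density) auto
qed

lemma integral_std_gauss_centered_square: "(\<integral>x. x\<^sup>2 - 1 \<partial>(std_gauss :: real measure)) = 0"
proof -
  have i: "integrable lborel (\<lambda>x. std_normal_density x * x ^ k)" for k
    by (rule integrable_std_normal_moment)
  have "(\<integral>x. x\<^sup>2 - 1 \<partial>(std_gauss :: real measure))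
      = (\<integral>x. std_normal_density x * x ^ 2 - std_normal_density x \<partial>lborel)"
    unfolding std_gauss_real by (subst integral_density) (auto simp: algebra_simps)
  also have "\<dots> = (\<integral>x. std_normal_density x * x ^ 2 \<partial>lborel) - (\<integral>x. std_normal_density x \<partial>lborel)"
    using i[of 2] by (intro Bochner_Integration.integral_diff) auto
  also have "\<dots> = 0"
    using integral_std_normal_moment_even[of 1] by (simp add: fact_2)
  finally show ?thesis .
qed

text \<open>Chebyshev's inequality: the centred squares are uncorrelated with a common finite variance.\<close>
lemma iid_normal_squares_concentrate:
  assumes \<eta>: "\<eta> > 0"
  shows "(\<lambda>n. measure (iid_normal n)
    {u \<in> space (iid_normal n). \<bar>(\<Sum>i<n. (u i)\<^sup>2) - real n\<bar> > \<eta> * real n}) \<longlonglongrightarrow> 0"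
proof -
  define g where "g x = x\<^sup>2 - 1" for x :: real
  define v where "v = (\<integral>x. (g x)\<^sup>2 \<partial>(std_gauss :: real measure))"
  interpret G: prob_space "std_gauss :: real measure" by (rule prob_space_std_gauss)
  interpret g: product_sigma_finite "\<lambda>_::nat. std_gauss :: real measure"
    by (simp add: product_sigma_finite_def G.sigma_finite_measure_axioms)
  have bound: "measure (iid_normal n)
      {u \<in> space (iid_normal n). \<bar>(\<Sum>i<n. (u i)\<^sup>2) - real n\<bar> > \<eta> * real n} \<le> (v / \<eta>\<^sup>2) / real n"
    if n: "n > 0" for n
  proof -
    interpret I: prob_space "iid_normal n" by (rule prob_space_iid_normal)
    let ?f = "\<lambda>u. (\<Sum>i<n. (u i)\<^sup>2) - real n"
    \<comment> \<open>\<open>g (u i) * g (u j)\<close> written as a product over all coordinates, so that its mean factorises.\<close>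
    define h where "h i j k x = (if k = i then g x else 1) * (if k = j then g x else 1)"
      for i j k :: nat and x :: real
    have h_int: "integrable std_gauss (h i j k)" for i j k
      using integrable_std_gauss_centered_square unfolding h_def[abs_def] g_def
      by (cases "k = i"; cases "k = j") (simp_all add: power2_eq_square)
    have prod: "(\<Prod>k<n. h i j k (u k)) = g (u i) * g (u j)" if "i < n" "j < n" for i j u
    proof -
      have "(\<Prod>k<n. h i j k (u k)) = (\<Prod>k<n. if k = i then g (u k) else 1) * (\<Prod>k<n. if k = j then g (u k) else 1)"
        by (simp add: h_def prod.distrib)
      also have "\<dots> = g (u i) * g (u j)" using that by (simp add: prod.delta)
      finally show ?thesis .
    qed
    have int_ij: "integrable (iid_normal n) (\<lambda>u. g (u i) * g (u j))" if "i < n" "j < n" for i j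
      using g.product_integrable_prod[of "{..<n}" "h i j"] h_int
      unfolding iid_normal_def[symmetric] by (simp add: prod[OF that])
    have val_ij: "(\<integral>u. g (u i) * g (u j) \<partial>iid_normal n) = (if i = j then v else 0)"
      if "i < n" "j < n" for i j
    proof -
      have "(\<integral>u. g (u i) * g (u j) \<partial>iid_normal n) = (\<Prod>k<n. \<integral>x. h i j k x \<partial>std_gauss)"
        using g.product_integral_prod[of "{..<n}" "h i j"] h_int
        unfolding iid_normal_def[symmetric] by (simp add: prod[OF that])
      also have "\<dots> = (if i = j then v else 0)"
      proof (cases "i = j")
        case True
        have "(\<integral>x. h i j k x \<partial>std_gauss) = (if k = i then v else 1)" for k
          using True using G.prob_space by (simp add: h_def v_def power2_eq_square)
        then show ?thesis using True that by (simp add: prod.delta)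
      next
        case False
        have "(\<integral>x. h i j i x \<partial>std_gauss) = 0"
          using False integral_std_gauss_centered_square by (simp add: h_def g_def)
        then have "(\<Prod>k<n. \<integral>x. h i j k x \<partial>std_gauss) = 0"
          using that by (intro prod_zero) auto
        then show ?thesis using False by simp
      qed
      finally show ?thesis .
    qed
    have f2: "(?f u)\<^sup>2 = (\<Sum>i<n. \<Sum>j<n. g (u i) * g (u j))" for u
    proof -
      have "?f u = (\<Sum>i<n. g (u i))" by (simp add: g_def sum_subtractf)
      then show ?thesis by (simp add: power2_eq_square sum_product)
    qed
    have f2_int: "integrable (iid_normal n) (\<lambda>u. (?f u)\<^sup>2)"
      unfolding f2 by (intro Bochner_Integration.integrable_sum int_ij) auto
    have "(\<integral>u. (?f u)\<^sup>2 \<partial>iid_normal n) = (\<Sum>i<n. \<Sum>j<n. \<integral>u. g (u i) * g (u j) \<partial>iid_normal n)"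
      unfolding f2 using int_ij
      by (subst Bochner_Integration.integral_sum, force intro!: Bochner_Integration.integrable_sum)
        (intro sum.cong refl Bochner_Integration.integral_sum, auto)
    also have "\<dots> = (\<Sum>i<n. \<Sum>j<n. if i = j then v else 0)"
      by (intro sum.cong refl val_ij) auto
    also have "\<dots> = real n * v" by simp
    finally have E: "(\<integral>u. (?f u)\<^sup>2 \<partial>iid_normal n) = real n * v" .
    have "measure (iid_normal n) {u \<in> space (iid_normal n). \<bar>?f u\<bar> > \<eta> * real n}
        \<le> measure (iid_normal n) {u \<in> space (iid_normal n). (?f u)\<^sup>2 \<ge> (\<eta> * real n)\<^sup>2}"
    proof (rule I.finite_measure_mono)
      show "{u \<in> space (iid_normal n). \<bar>?f u\<bar> > \<eta> * real n}
          \<subseteq> {u \<in> space (iid_normal n). (?f u)\<^sup>2 \<ge> (\<eta> * real n)\<^sup>2}"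
        using \<eta> by (auto simp: abs_le_square_iff[symmetric])
      show "{u \<in> space (iid_normal n). (?f u)\<^sup>2 \<ge> (\<eta> * real n)\<^sup>2} \<in> sets (iid_normal n)"
        using borel_measurable_integrable[OF f2_int] by measurable
    qed
    also have "\<dots> \<le> (real n * v) / (\<eta> * real n)\<^sup>2"
      unfolding E[symmetric] using \<eta> n
      by (intro integral_Markov_inequality_measure[OF f2_int sets.empty_sets]) auto
    also have "\<dots> = (v / \<eta>\<^sup>2) / real n" using n by (simp add: power2_eq_square)
    finally show ?thesis .
  qed
  have "(\<lambda>n. (v / \<eta>\<^sup>2) / real n) \<longlonglongrightarrow> 0"
    by (rule tendsto_divide_0[OF tendsto_const]) (simp add: filterlim_real_at_infinity_sequentially)
  then show ?thesis
  proof (rule tendsto_sandwich[OF _ _ tendsto_const, rotated -1])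
    show "\<forall>\<^sub>F n in sequentially. measure (iid_normal n)
      {u \<in> space (iid_normal n). \<bar>(\<Sum>i<n. (u i)\<^sup>2) - real n\<bar> > \<eta> * real n} \<le> (v / \<eta>\<^sup>2) / real n"
      using eventually_gt_at_top[of "0::nat"] by eventually_elim (rule bound)
  qed simp
qed

text \<open>The standardised error of the full estimator is a linear image of a standard normal vector
  of fixed dimension.\<close>
lemma lse_error_law:
  fixes X :: "nat \<Rightarrow> nat \<Rightarrow> real^'p"
  assumes fr: "full_rank X n"
  shows "\<exists>L :: real^'p^'p. distr (iid_normal n) borel (lse_error X n \<sigma>) = distr std_gauss borel ((*v) L)
    \<and> L ** transpose L = \<sigma>\<^sup>2 *\<^sub>R matrix_inv (scaled_gram X n)"
proof -
  obtain F :: "real^'p \<Rightarrow> real^'p" where F: "linear F"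
    and law: "distr (iid_normal n) borel (\<lambda>u. \<Sum>i<n. u i *\<^sub>R lse_coef X n \<sigma> i) = distr std_gauss borel F"
    and cov: "\<And>x y. (\<Sum>i<n. (lse_coef X n \<sigma> i \<bullet> x) * (lse_coef X n \<sigma> i \<bullet> y)) = adjoint F x \<bullet> adjoint F y"
    using iid_normal_linear_combination[of n "lse_coef X n \<sigma>"] by blast
  define L where "L = matrix F"
  have LF: "(*v) L = F" using F by (simp add: L_def fun_eq_iff)
  have adj: "adjoint F x = transpose L *v x" for x
    by (simp only: LF[symmetric] adjoint_matrix)
  have "(L ** transpose L) *v y = (\<sigma>\<^sup>2 *\<^sub>R matrix_inv (scaled_gram X n)) *v y" for y
  proof (rule vector_eq_rdot[THEN iffD1], intro allI)
    fix x
    have "((L ** transpose L) *v y) \<bullet> x = F (adjoint F y) \<bullet> x"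
      by (simp only: matrix_vector_mul_assoc[symmetric] LF adj)
    also have "\<dots> = adjoint F y \<bullet> adjoint F x" by (simp add: adjoint_works[OF F])
    also have "\<dots> = \<sigma>\<^sup>2 * (x \<bullet> (matrix_inv (scaled_gram X n) *v y))"
      by (simp only: cov[symmetric] lse_coef_covariance[OF fr, symmetric] inner_commute mult.commute)
    also have "\<dots> = ((\<sigma>\<^sup>2 *\<^sub>R matrix_inv (scaled_gram X n)) *v y) \<bullet> x"
      by (simp add: scaleR_matrix_vector_assoc[symmetric] inner_commute)
    finally show "((L ** transpose L) *v y) \<bullet> x = ((\<sigma>\<^sup>2 *\<^sub>R matrix_inv (scaled_gram X n)) *v y) \<bullet> x" .
  qed
  then have "L ** transpose L = \<sigma>\<^sup>2 *\<^sub>R matrix_inv (scaled_gram X n)" by (simp add: matrix_eq)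
  then show ?thesis using law LF by (auto simp: lse_error_def[abs_def])
qed

lemma borel_measurable_iid_normal_coord:
  assumes "i \<in> {..<n}" shows "(\<lambda>u. u i) \<in> borel_measurable (iid_normal n)"
  unfolding measurable_cong_sets[OF sets_iid_normal refl]
  using assms by (rule measurable_component_singleton)

lemma borel_measurable_lse_error[measurable]: "lse_error X n \<sigma> \<in> iid_normal n \<rightarrow>\<^sub>M borel"
proof -
  note [measurable] = borel_measurable_iid_normal_coord
  show ?thesis unfolding lse_error_def[abs_def] by measurable
qed

lemma measure_lse_error:
  fixes L :: "real^'p^'p"
  assumes law: "distr (iid_normal n) borel (lse_error X n \<sigma>) = distr std_gauss borel ((*v) L)"
    and S: "S \<in> sets borel"
  shows "measure (iid_normal n) {u \<in> space (iid_normal n). lse_error X n \<sigma> u \<in> S}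
    = measure std_gauss {\<zeta>. L *v \<zeta> \<in> S}"
proof -
  have m: "(*v) L \<in> std_gauss \<rightarrow>\<^sub>M borel" by measurable
  have "measure (iid_normal n) {u \<in> space (iid_normal n). lse_error X n \<sigma> u \<in> S}
      = measure (distr (iid_normal n) borel (lse_error X n \<sigma>)) S"
    using S by (subst measure_distr) (auto intro!: arg_cong[where f="measure _"])
  also have "\<dots> = measure std_gauss {\<zeta>. L *v \<zeta> \<in> S}"
    unfolding law using S m by (subst measure_distr) (auto simp: vimage_def)
  finally show ?thesis .
qed

text \<open>Up to the factor \<open>\<sigma>\<^sup>2\<close> the explained sum of squares is the squared length of the standard
  normal vector, hence stochastically bounded.\<close>
lemma explained_sum_of_squares:
  fixes L :: "real^'p^'p"
  assumes fr: "full_rank X n" and \<sigma>: "\<sigma> > 0"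
    and L: "L ** transpose L = \<sigma>\<^sup>2 *\<^sub>R matrix_inv (scaled_gram X n)"
  shows "(scaled_gram X n *v (L *v \<zeta>)) \<bullet> (L *v \<zeta>) = \<sigma>\<^sup>2 * (norm \<zeta>)\<^sup>2"
proof -
  let ?G = "scaled_gram X n"
  define x where "x = ?G *v (L *v \<zeta>)"
  have "surj ((*v) L)"
    by (rule matrix_factor_facts(1)[OF L invertible_scaled_gram[OF fr] \<sigma>])
  then have inj: "inj ((*v) L)" by (simp add: linear_surj_imp_inj)
  have "L *v (transpose L *v x) = (L ** transpose L) *v x" by (rule matrix_vector_mul_assoc)
  also have "\<dots> = \<sigma>\<^sup>2 *\<^sub>R (matrix_inv ?G *v x)"
    by (simp only: L scaleR_matrix_vector_assoc)
  also have "\<dots> = L *v (\<sigma>\<^sup>2 *\<^sub>R \<zeta>)"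
    by (simp only: x_def gram_inv_works[OF fr] matrix_vector_mult_scaleR)
  finally have t: "transpose L *v x = \<sigma>\<^sup>2 *\<^sub>R \<zeta>" using inj by (simp only: inj_eq)
  have "x \<bullet> (L *v \<zeta>) = (transpose L *v x) \<bullet> \<zeta>"
    using adjoint_works[OF matrix_vector_mul_linear[of L], of \<zeta> x]
    by (simp only: adjoint_matrix inner_commute)
  also have "\<dots> = \<sigma>\<^sup>2 * (norm \<zeta>)\<^sup>2" by (simp only: t) (simp add: power2_norm_eq_inner)
  finally show ?thesis by (simp only: x_def)
qed

lemma explained_sum_of_squares_negligible:
  fixes X :: "nat \<Rightarrow> nat \<Rightarrow> real^'p"
  assumes des: "design X Q" and \<sigma>: "\<sigma> > 0" and \<eta>: "\<eta> > 0"
  shows "(\<lambda>n. measure (iid_normal n) {u \<in> space (iid_normal n).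
    (scaled_gram X n *v lse_error X n \<sigma> u) \<bullet> lse_error X n \<sigma> u > \<eta> * real n}) \<longlonglongrightarrow> 0"
proof -
  interpret g: prob_space "std_gauss :: (real^'p) measure" by (rule prob_space_std_gauss)
  have S: "{\<zeta> :: real^'p. \<sigma>\<^sup>2 * (norm \<zeta>)\<^sup>2 > \<eta> * real n} \<in> sets std_gauss" for n
  proof -
    have "{\<zeta> \<in> space (std_gauss :: (real^'p) measure). \<sigma>\<^sup>2 * (norm \<zeta>)\<^sup>2 > \<eta> * real n} \<in> sets std_gauss" by measurable
    then show ?thesis by simp
  qed
  have "(\<lambda>n. \<integral>\<zeta>. indicator {\<zeta> :: real^'p. \<sigma>\<^sup>2 * (norm \<zeta>)\<^sup>2 > \<eta> * real n} \<zeta> \<partial>std_gauss)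
      \<longlonglongrightarrow> (\<integral>\<zeta>. (0 :: real) \<partial>(std_gauss :: (real^'p) measure))"
  proof (rule integral_dominated_convergence[where w="\<lambda>_. 1"])
    show "AE \<zeta> in std_gauss. (\<lambda>n. indicator {\<zeta> :: real^'p. \<sigma>\<^sup>2 * (norm \<zeta>)\<^sup>2 > \<eta> * real n} \<zeta> :: real) \<longlonglongrightarrow> 0"
    proof (rule AE_I2)
      fix \<zeta> :: "real^'p"
      obtain N :: nat where N: "\<sigma>\<^sup>2 * (norm \<zeta>)\<^sup>2 < real N * \<eta>"
        using ex_less_of_nat_mult[OF \<eta>] by blast
      have "\<forall>\<^sub>F n in sequentially. indicator {\<zeta> :: real^'p. \<sigma>\<^sup>2 * (norm \<zeta>)\<^sup>2 > \<eta> * real n} \<zeta> = (0::real)"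
        using eventually_ge_at_top[of N]
      proof eventually_elim
        case (elim n)
        then have "real N * \<eta> \<le> \<eta> * real n" using \<eta> by simp
        then show ?case using N by (simp add: indicator_def)
      qed
      then show "(\<lambda>n. indicator {\<zeta> :: real^'p. \<sigma>\<^sup>2 * (norm \<zeta>)\<^sup>2 > \<eta> * real n} \<zeta> :: real) \<longlonglongrightarrow> 0"
        by (rule tendsto_eventually)
    qed
  qed (use S in \<open>auto simp: indicator_def\<close>)
  then have lim: "(\<lambda>n. measure std_gauss {\<zeta> :: real^'p. \<sigma>\<^sup>2 * (norm \<zeta>)\<^sup>2 > \<eta> * real n}) \<longlonglongrightarrow> 0"
    using S by simp
  have "\<forall>\<^sub>F n in sequentially. measure std_gauss {\<zeta> :: real^'p. \<sigma>\<^sup>2 * (norm \<zeta>)\<^sup>2 > \<eta> * real n}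
    = measure (iid_normal n) {u \<in> space (iid_normal n).
        (scaled_gram X n *v lse_error X n \<sigma> u) \<bullet> lse_error X n \<sigma> u > \<eta> * real n}"
    using eventually_gt_at_top[of "CARD('p)"]
  proof eventually_elim
    case (elim n)
    have fr: "full_rank X n" by (rule design_full_rank[OF des elim])
    obtain L :: "real^'p^'p" where law: "distr (iid_normal n) borel (lse_error X n \<sigma>) = distr std_gauss borel ((*v) L)"
      and L: "L ** transpose L = \<sigma>\<^sup>2 *\<^sub>R matrix_inv (scaled_gram X n)"
      using lse_error_law[OF fr] by blast
    have "{z. (scaled_gram X n *v z) \<bullet> z > \<eta> * real n} \<in> sets borel" by measurable
    from measure_lse_error[OF law this] show ?case
      by (simp add: explained_sum_of_squares[OF fr \<sigma> L])
  qed
  then show ?thesis by (rule Lim_transform_eventually[OF lim])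
qed

lemma sample_law_eq_distr_sample:
  "\<sigma> > 0 \<Longrightarrow> sample_law X n \<theta> \<sigma> = distr (iid_normal n) (sample_space n) (sample X n \<theta> \<sigma>)"
  unfolding sample_def[abs_def] by (rule sample_law_eq_distr)

lemma borel_measurable_sample[measurable]: "sample X n \<theta> \<sigma> \<in> iid_normal n \<rightarrow>\<^sub>M sample_space n"
  unfolding sample_def[abs_def] sample_space_def iid_normal_def by measurable

lemma measure_sample_law:
  assumes \<sigma>: "\<sigma> > 0" and S: "{y \<in> space (sample_space n). P y} \<in> sets (sample_space n)"
  shows "measure (sample_law X n \<theta> \<sigma>) {y \<in> space (sample_space n). P y}
    = measure (iid_normal n) {u \<in> space (iid_normal n). P (sample X n \<theta> \<sigma> u)}"
  unfolding sample_law_eq_distr_sample[OF \<sigma>] using S measurable_space[OF borel_measurable_sample]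
  by (subst measure_distr) (auto intro!: arg_cong[where f="measure _"])

text \<open>The residual sum of squares is \<open>\<sigma>\<^sup>2 (\<Sum>i<n. (u i)\<^sup>2)\<close> less the explained sum of squares. The first
  term divided by \<open>n\<close> tends to \<open>\<sigma>\<^sup>2\<close> and the second one is negligible.\<close>
lemma sigma_hat_consistent:
  fixes X :: "nat \<Rightarrow> nat \<Rightarrow> real^'p"
  assumes des: "design X Q" and \<sigma>: "\<sigma> > 0" and \<epsilon>: "\<epsilon> > 0"
  shows "(\<lambda>n. measure (iid_normal n) {u \<in> space (iid_normal n).
    \<bar>sigma_hat X n (sample X n (\<theta> n) \<sigma> u) - \<sigma>\<bar> > \<epsilon>}) \<longlonglongrightarrow> 0"
proof -
  \<comment> \<open>Deviations of both sums below \<open>\<eta> n\<close> leave \<open>sigma_hat\<^sup>2\<close> within about \<open>(\<sigma>\<^sup>2 + 1) \<eta> = \<epsilon> \<sigma> / 2\<close> of \<open>\<sigma>\<^sup>2\<close>.\<close>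
  define \<eta> where "\<eta> = \<epsilon> * \<sigma> / (2 * (\<sigma>\<^sup>2 + 1))"
  have s1: "\<sigma>\<^sup>2 + 1 > 0" by (simp add: add_nonneg_pos)
  have \<eta>: "\<eta> > 0" using \<epsilon> \<sigma> s1 by (simp add: \<eta>_def)
  let ?P = "CARD('p)"
  let ?E1 = "\<lambda>n. {u \<in> space (iid_normal n). \<bar>(\<Sum>i<n. (u i)\<^sup>2) - real n\<bar> > \<eta> * real n}"
  let ?E2 = "\<lambda>n. {u \<in> space (iid_normal n).
    (scaled_gram X n *v lse_error X n \<sigma> u) \<bullet> lse_error X n \<sigma> u > \<eta> * real n}"
  let ?E = "\<lambda>n. {u \<in> space (iid_normal n). \<bar>sigma_hat X n (sample X n (\<theta> n) \<sigma> u) - \<sigma>\<bar> > \<epsilon>}"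
  have "(\<lambda>n. ((\<sigma>\<^sup>2 + 1) * \<eta> * real n + \<sigma>\<^sup>2 * real ?P) / (real n - real ?P)) \<longlonglongrightarrow> (\<sigma>\<^sup>2 + 1) * \<eta>"
    by real_asymp
  moreover have "(\<sigma>\<^sup>2 + 1) * \<eta> < \<epsilon> * \<sigma>"
  proof -
    have "a * (\<epsilon> * \<sigma> / (2 * a)) = \<epsilon> * \<sigma> / 2" if "a > 0" for a :: real using that by simp
    then have "(\<sigma>\<^sup>2 + 1) * \<eta> = \<epsilon> * \<sigma> / 2" unfolding \<eta>_def using s1 by blast
    moreover have "\<epsilon> * \<sigma> > 0" using \<epsilon> \<sigma> by simp
    ultimately show ?thesis by linarith
  qed
  ultimately have "\<forall>\<^sub>F n in sequentially. ((\<sigma>\<^sup>2 + 1) * \<eta> * real n + \<sigma>\<^sup>2 * real ?P) / (real n - real ?P) < \<epsilon> * \<sigma>"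
    by (rule order_tendstoD(2))
  then have le: "\<forall>\<^sub>F n in sequentially. measure (iid_normal n) (?E n)
      \<le> measure (iid_normal n) (?E1 n) + measure (iid_normal n) (?E2 n)"
    using eventually_gt_at_top[of ?P]
  proof eventually_elim
    case (elim n)
    have fr: "full_rank X n" by (rule design_full_rank[OF des elim(2)])
    have np: "real n - real ?P > 0" using elim(2) by simp
    interpret I: prob_space "iid_normal n" by (rule prob_space_iid_normal)
    note [measurable] = borel_measurable_iid_normal_coord
    have m1: "?E1 n \<in> sets (iid_normal n)" by measurable
    have m2: "?E2 n \<in> sets (iid_normal n)" by measurable
    have "?E n \<subseteq> ?E1 n \<union> ?E2 n"
    proof (rule subsetI, rule ccontr)
      fix u assume u: "u \<in> ?E n" and no: "u \<notin> ?E1 n \<union> ?E2 n"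
      let ?S = "\<Sum>i<n. (u i)\<^sup>2"
      define q where "q = (scaled_gram X n *v lse_error X n \<sigma> u) \<bullet> lse_error X n \<sigma> u"
      have b1: "\<bar>?S - real n\<bar> \<le> \<eta> * real n" and b2: "q \<le> \<eta> * real n"
        using no u by (auto simp: q_def)
      have q0: "q \<ge> 0"
      proof -
        have "real n * q \<ge> 0"
          unfolding q_def inner_scaled_gram power2_eq_square[symmetric] by (intro sum_nonneg) simp
        then show ?thesis using elim(2) by (simp add: zero_le_mult_iff)
      qed
      define \<rho> where "\<rho> = rss X n (sample X n (\<theta> n) \<sigma> u) (full_lse X n (sample X n (\<theta> n) \<sigma> u))"
      define w where "w = sigma_hat X n (sample X n (\<theta> n) \<sigma> u)"
      have \<rho>: "\<rho> = \<sigma>\<^sup>2 * ?S - q" unfolding \<rho>_def q_def by (rule rss_sample[OF fr])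
      have \<rho>0: "\<rho> \<ge> 0" unfolding \<rho>_def rss_def by (intro sum_nonneg) simp
      have w: "w = sqrt (\<rho> / (real n - real ?P))"
        by (simp add: w_def sigma_hat_def restricted_lse_UNIV[OF fr] \<rho>_def)
      have w0: "w \<ge> 0" unfolding w using \<rho>0 np by simp
      have w2: "w\<^sup>2 = \<rho> / (real n - real ?P)" unfolding w using \<rho>0 np by simp
      have "w\<^sup>2 - \<sigma>\<^sup>2 = (\<sigma>\<^sup>2 * (?S - real n) + \<sigma>\<^sup>2 * real ?P - q) / (real n - real ?P)"
        unfolding w2 \<rho> using np by (simp add: field_simps)
      then have "\<bar>w\<^sup>2 - \<sigma>\<^sup>2\<bar> = \<bar>\<sigma>\<^sup>2 * (?S - real n) + \<sigma>\<^sup>2 * real ?P - q\<bar> / (real n - real ?P)"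
        using np by (simp add: abs_divide)
      also have "\<dots> \<le> ((\<sigma>\<^sup>2 + 1) * \<eta> * real n + \<sigma>\<^sup>2 * real ?P) / (real n - real ?P)"
      proof (rule divide_right_mono)
        have "\<bar>\<sigma>\<^sup>2 * (?S - real n)\<bar> \<le> \<sigma>\<^sup>2 * (\<eta> * real n)"
          using b1 by (simp add: abs_mult mult_left_mono)
        moreover have "(\<sigma>\<^sup>2 + 1) * \<eta> * real n = \<sigma>\<^sup>2 * (\<eta> * real n) + \<eta> * real n"
          by (simp add: algebra_simps)
        moreover have "\<sigma>\<^sup>2 * real ?P \<ge> 0" by simp
        ultimately show "\<bar>\<sigma>\<^sup>2 * (?S - real n) + \<sigma>\<^sup>2 * real ?P - q\<bar> \<le> (\<sigma>\<^sup>2 + 1) * \<eta> * real n + \<sigma>\<^sup>2 * real ?P"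
          using b2 q0 by linarith
      qed (use np in simp)
      also have "\<dots> < \<epsilon> * \<sigma>" by (rule elim(1))
      finally have "\<bar>w\<^sup>2 - \<sigma>\<^sup>2\<bar> < \<epsilon> * \<sigma>" .
      moreover have "\<bar>w\<^sup>2 - \<sigma>\<^sup>2\<bar> = \<bar>w - \<sigma>\<bar> * (w + \<sigma>)"
      proof -
        have "w\<^sup>2 - \<sigma>\<^sup>2 = (w - \<sigma>) * (w + \<sigma>)" by (simp add: power2_eq_square algebra_simps)
        then show ?thesis using w0 \<sigma> by (simp add: abs_mult)
      qed
      moreover have "\<epsilon> * \<sigma> \<le> \<bar>w - \<sigma>\<bar> * (w + \<sigma>)"
        using u \<epsilon> \<sigma> w0 by (intro mult_mono) (auto simp: w_def)
      ultimately show False by linarith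
    qed
    then have "measure (iid_normal n) (?E n) \<le> measure (iid_normal n) (?E1 n \<union> ?E2 n)"
      using m1 m2 by (intro I.finite_measure_mono) auto
    also have "\<dots> \<le> measure (iid_normal n) (?E1 n) + measure (iid_normal n) (?E2 n)"
      using m1 m2 by (rule measure_Un_le)
    finally show ?case .
  qed
  have "(\<lambda>n. measure (iid_normal n) (?E1 n) + measure (iid_normal n) (?E2 n)) \<longlonglongrightarrow> 0 + 0"
    by (intro tendsto_add iid_normal_squares_concentrate[OF \<eta>]
        explained_sum_of_squares_negligible[OF des \<sigma> \<eta>])
  then show ?thesis
    by (intro tendsto_sandwich[OF _ le tendsto_const]) auto
qed

section \<open>Local alternatives\<close>

definition local_param :: "real^'p \<Rightarrow> 'p \<Rightarrow> nat \<Rightarrow> real \<Rightarrow> real^'p" where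
  "local_param \<theta> i n \<nu> = \<theta> + (\<nu> / sqrt (real n)) *\<^sub>R axis i 1"

lemma local_param_0[simp]: "local_param \<theta> i n 0 = \<theta>"
  by (simp add: local_param_def)

lemma sets_sample_law[measurable_cong]: "sets (sample_law X n \<theta> \<sigma>) = sets (sample_space n)"
  unfolding sample_law_def sample_space_def by (rule sets_PiM_cong) auto

lemma space_sample_law: "space (sample_law X n \<theta> \<sigma>) = space (sample_space n)"
  by (rule sets_eq_imp_space_eq) (rule sets_sample_law)

lemma prob_space_sample_law: "\<sigma> > 0 \<Longrightarrow> prob_space (sample_law X n \<theta> \<sigma>)"
  unfolding sample_law_def by (intro prob_space_PiM prob_space_normal_density)

text \<open>The means differ by \<open>(\<nu>' - \<nu>) X e\<^sub>i / sqrt n\<close>, whose squared length is \<open>(\<nu>' - \<nu>)\<^sup>2 (X'X / n)\<^sub>i\<^sub>i\<close> and stays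
  bounded as \<open>n\<close> grows.\<close>
lemma local_shift:
  fixes X :: "nat \<Rightarrow> nat \<Rightarrow> real^'p" and \<theta> :: "real^'p" and i :: 'p and \<sigma> \<nu> \<nu>' :: real
  assumes \<sigma>: "\<sigma> > 0" and n: "n > 0" and B: "B \<in> sets (sample_space n)"
  defines "P \<equiv> \<lambda>\<nu>. sample_law X n (local_param \<theta> i n \<nu>) \<sigma>"
    and "C \<equiv> exp ((\<nu>' - \<nu>)\<^sup>2 * scaled_gram X n $ i $ i / \<sigma>\<^sup>2)"
  shows "\<bar>measure (P \<nu>') B - measure (P \<nu>) B\<bar> \<le> sqrt (C - 1)"
    and "measure (P \<nu>') B \<le> sqrt (C * measure (P \<nu>) B)"
proof -
  have inner: "X n j \<bullet> local_param \<theta> i n \<kappa> = X n j \<bullet> \<theta> + \<kappa> / sqrt (real n) * X n j $ i" for j \<kappa>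
    by (simp add: local_param_def inner_add inner_axis)
  have "(\<Sum>j<n. (X n j \<bullet> local_param \<theta> i n \<nu>' - X n j \<bullet> local_param \<theta> i n \<nu>)\<^sup>2)
      = (\<Sum>j<n. (\<nu>' - \<nu>)\<^sup>2 * (X n j $ i * X n j $ i / real n))"
  proof (rule sum.cong[OF refl])
    fix j
    have "X n j \<bullet> local_param \<theta> i n \<nu>' - X n j \<bullet> local_param \<theta> i n \<nu> = (\<nu>' - \<nu>) / sqrt (real n) * X n j $ i"
      unfolding inner by (simp add: diff_divide_distrib left_diff_distrib)
    then show "(X n j \<bullet> local_param \<theta> i n \<nu>' - X n j \<bullet> local_param \<theta> i n \<nu>)\<^sup>2
        = (\<nu>' - \<nu>)\<^sup>2 * (X n j $ i * X n j $ i / real n)"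
      by (simp add: power_mult_distrib power_divide) (simp add: power2_eq_square)
  qed
  also have "\<dots> = (\<nu>' - \<nu>)\<^sup>2 * scaled_gram X n $ i $ i"
    by (simp add: scaled_gram_def sum_distrib_left sum_divide_distrib)
  finally have C: "C = exp ((\<Sum>j<n. (X n j \<bullet> local_param \<theta> i n \<nu>' - X n j \<bullet> local_param \<theta> i n \<nu>)\<^sup>2) / \<sigma>\<^sup>2)"
    by (simp add: C_def)
  have B': "B \<in> sets (PiM {..<n} (\<lambda>j. density lborel (normal_density (X n j \<bullet> local_param \<theta> i n \<nu>) \<sigma>)))"
    using B sets_sample_law[of X n "local_param \<theta> i n \<nu>" \<sigma>] by (simp add: sample_law_def)
  show "\<bar>measure (P \<nu>') B - measure (P \<nu>) B\<bar> \<le> sqrt (C - 1)"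
    and "measure (P \<nu>') B \<le> sqrt (C * measure (P \<nu>) B)"
    unfolding P_def C sample_law_def
    by (rule normal_product_shift[OF _ \<sigma> B'], simp)+
qed

lemma (in finite_measure) measure_sym_diff_le:
  assumes [measurable]: "S \<in> sets M" "S' \<in> sets M" "B \<in> sets M" and sub: "sym_diff S S' \<subseteq> B"
  shows "\<bar>measure M S - measure M S'\<bar> \<le> measure M B"
proof -
  have "measure M S \<le> measure M (S' \<union> B)" using sub by (intro finite_measure_mono) auto
  also have "\<dots> \<le> measure M S' + measure M B" by (rule measure_Un_le) auto
  finally have 1: "measure M S \<le> measure M S' + measure M B" .
  have "measure M S' \<le> measure M (S \<union> B)" using sub by (intro finite_measure_mono) auto
  also have "\<dots> \<le> measure M S + measure M B" by (rule measure_Un_le) auto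
  finally show ?thesis using 1 by linarith
qed

definition scaled_le :: "real^'p^'k \<Rightarrow> real^'k \<Rightarrow> nat \<Rightarrow> real^'p \<Rightarrow> real^'p \<Rightarrow> bool" where
  "scaled_le A t n \<theta> \<theta>' \<longleftrightarrow> sqrt (real n) *\<^sub>R (A *v (\<theta>' - \<theta>)) \<le> t"

lemma pred_scaled_le[measurable (raw)]:
  assumes [measurable]: "f \<in> M \<rightarrow>\<^sub>M borel"
  shows "Measurable.pred M (\<lambda>y. scaled_le A t n \<theta> (f y))"
  unfolding scaled_le_def by measurable

lemma post_selection_estimator_eq:
  fixes R :: "'p::finite set set"
  assumes "rhat n y \<in> R"
  shows "post_selection_estimator X R rhat n y = restricted_lse X n (rhat n y) y"
proof -
  have "finite R" by (rule finite_subset[OF subset_UNIV]) simp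
  then show ?thesis using assms by (simp add: post_selection_estimator_def sum.delta)
qed

text \<open>Off the two symmetric differences the selection procedure coincides with the pretest based on
  the \<open>t\<close>-statistic.\<close>
lemma pms_cdf_pretest:
  fixes X :: "nat \<Rightarrow> nat \<Rightarrow> real^'p" and R :: "'p set set"
  assumes fr: "full_rank X n" and \<sigma>: "\<sigma> > 0"
    and sel: "rhat n \<in> sample_space n \<rightarrow>\<^sub>M count_space UNIV"
    and R: "\<And>y. y \<in> space (sample_space n) \<Longrightarrow> rhat n y \<in> R"
  shows "\<bar>pms_cdf X R rhat A n \<theta> \<sigma> t - measure (sample_law X n \<theta> \<sigma>) {y \<in> space (sample_space n).
        scaled_le A t n \<theta> (if \<bar>t_stat X n r y\<bar> < c then restricted_lse X n r y else restricted_lse X n UNIV y)}\<bar>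
    \<le> measure (sample_law X n \<theta> \<sigma>) (sym_diff {y \<in> space (sample_space n). rhat n y = UNIV}
            {y \<in> space (sample_space n). \<bar>t_stat X n r y\<bar> \<ge> c})
      + measure (sample_law X n \<theta> \<sigma>) (sym_diff {y \<in> space (sample_space n). rhat n y = r}
            {y \<in> space (sample_space n). \<bar>t_stat X n r y\<bar> < c})"
    (is "\<bar>_ - measure ?M ?S'\<bar> \<le> measure ?M ?B1 + measure ?M ?B2")
proof -
  interpret M: prob_space ?M by (rule prob_space_sample_law[OF \<sigma>])
  note [measurable] = sel borel_measurable_restricted_lse[OF fr] borel_measurable_t_stat[OF fr]
    borel_measurable_post_selection_estimator[where X=X and n=n and rhat=rhat and R=R, OF fr sel]
  let ?S = "{y \<in> space (sample_space n). scaled_le A t n \<theta> (post_selection_estimator X R rhat n y)}"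
  have S: "?S \<in> sets ?M" "?S' \<in> sets ?M"
    unfolding sets_sample_law by measurable
  have "{y \<in> space (sample_space n). rhat n y = q} \<in> sets (sample_space n)" for q by measurable
  moreover have "{y \<in> space (sample_space n). \<bar>t_stat X n r y\<bar> < c} \<in> sets (sample_space n)"
    "{y \<in> space (sample_space n). \<bar>t_stat X n r y\<bar> \<ge> c} \<in> sets (sample_space n)" by measurable
  ultimately have B: "?B1 \<in> sets ?M" "?B2 \<in> sets ?M" unfolding sets_sample_law by auto
  have "sym_diff ?S ?S' \<subseteq> ?B1 \<union> ?B2"
  proof (rule subsetI, rule ccontr)
    fix y assume y: "y \<in> sym_diff ?S ?S'" and no: "y \<notin> ?B1 \<union> ?B2"
    have sp: "y \<in> space (sample_space n)" using y by auto
    have "(rhat n y = UNIV) = (\<bar>t_stat X n r y\<bar> \<ge> c)" "(rhat n y = r) = (\<bar>t_stat X n r y\<bar> < c)"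
      using no sp by blast+
    then have "rhat n y = (if \<bar>t_stat X n r y\<bar> < c then r else UNIV)"
      by (cases "\<bar>t_stat X n r y\<bar> < c") (simp_all add: not_less)
    then have "post_selection_estimator X R rhat n y
        = (if \<bar>t_stat X n r y\<bar> < c then restricted_lse X n r y else restricted_lse X n UNIV y)"
      unfolding post_selection_estimator_eq[where X=X and n=n and rhat=rhat and R=R and y=y, OF R[OF sp]] by simp
    then have "y \<in> ?S \<longleftrightarrow> y \<in> ?S'" using sp by simp
    then show False using y by blast
  qed
  then have "\<bar>measure ?M ?S - measure ?M ?S'\<bar> \<le> measure ?M (?B1 \<union> ?B2)"
    using S B by (intro M.measure_sym_diff_le) auto
  also have "\<dots> \<le> measure ?M ?B1 + measure ?M ?B2" using B by (rule measure_Un_le)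
  finally show ?thesis by (simp only: pms_cdf_def scaled_le_def)
qed

lemma std_gauss_interval_le:
  assumes "h \<ge> 0"
  shows "measure (std_gauss :: real measure) {x. \<bar>x - m\<bar> \<le> h} \<le> 2 * h"
proof -
  interpret prob_space "std_gauss :: real measure" by (rule prob_space_std_gauss)
  have eq: "{x. \<bar>x - m\<bar> \<le> h} = {m - h..m + h}" by (auto simp: abs_le_iff)
  have le1: "std_normal_density x \<le> 1" for x
  proof -
    have "1 \<le> sqrt (2 * pi)" using pi_gt3 by (intro real_le_rsqrt) simp
    then have "1 / sqrt (2 * pi) \<le> 1" by simp
    then show ?thesis unfolding std_normal_density_def
      using mult_mono[of "1 / sqrt (2 * pi)" 1 "exp (- x\<^sup>2 / 2)" 1] by simp
  qed
  have "emeasure (std_gauss :: real measure) {m - h..m + h}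
      = (\<integral>\<^sup>+x. ennreal (std_normal_density x) * indicator {m - h..m + h} x \<partial>lborel)"
    unfolding std_gauss_real by (simp add: emeasure_density)
  also have "\<dots> \<le> (\<integral>\<^sup>+x. indicator {m - h..m + h} x \<partial>lborel)"
    using le1 by (intro nn_integral_mono) (auto simp: indicator_def)
  also have "\<dots> = ennreal (2 * h)" using assms by simp
  finally show ?thesis unfolding eq using assms by (simp add: emeasure_eq_measure)
qed

text \<open>The standard normal density is at most \<open>1\<close>, and the slab consists of two intervals.\<close>
lemma std_gauss_slab_le:
  fixes a :: "'a::euclidean_space"
  assumes a: "a \<noteq> 0" and \<delta>: "\<delta> \<ge> 0"
  shows "measure std_gauss {\<zeta>. \<bar>\<bar>\<zeta> \<bullet> a + \<nu>\<bar> - s\<bar> \<le> \<delta>} \<le> 4 * \<delta> / norm a"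
proof -
  define \<tau> where "\<tau> = norm a"
  have \<tau>: "\<tau> > 0" using a by (simp add: \<tau>_def)
  define e where "e = a /\<^sub>R \<tau>"
  have e: "norm e = 1" using \<tau> by (simp add: e_def \<tau>_def)
  have ae: "\<zeta> \<bullet> a = \<tau> * (\<zeta> \<bullet> e)" for \<zeta> using \<tau> by (simp add: e_def)
  interpret g: prob_space "std_gauss :: real measure" by (rule prob_space_std_gauss)
  let ?I = "\<lambda>m. {x :: real. \<bar>x - m\<bar> \<le> \<delta> / \<tau>}"
  let ?J = "{x :: real. \<bar>\<bar>\<tau> * x + \<nu>\<bar> - s\<bar> \<le> \<delta>}"
  have J: "?J \<in> sets borel" by measurable
  have I: "?I m \<in> sets std_gauss" for m
  proof -
    have "?I m \<in> sets borel" by measurable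
    then show ?thesis by simp
  qed
  have "measure std_gauss {\<zeta>. \<bar>\<bar>\<zeta> \<bullet> a + \<nu>\<bar> - s\<bar> \<le> \<delta>} = measure (distr std_gauss borel (\<lambda>\<zeta>. \<zeta> \<bullet> e)) ?J"
    using J by (subst measure_distr) (auto simp: ae vimage_def)
  also have "\<dots> = measure (std_gauss :: real measure) ?J" by (subst std_gauss_marginal[OF e]) (rule refl)
  also have "\<dots> \<le> measure std_gauss (?I ((s - \<nu>) / \<tau>) \<union> ?I ((- s - \<nu>) / \<tau>))"
  proof (rule g.finite_measure_mono)
    show "?J \<subseteq> ?I ((s - \<nu>) / \<tau>) \<union> ?I ((- s - \<nu>) / \<tau>)"
    proof
      fix x assume x: "x \<in> ?J"
      have scale: "\<bar>x - m / \<tau>\<bar> \<le> \<delta> / \<tau> \<longleftrightarrow> \<bar>\<tau> * x - m\<bar> \<le> \<delta>" for m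
      proof -
        have "\<bar>\<tau> * x - m\<bar> = \<tau> * \<bar>x - m / \<tau>\<bar>"
        proof -
          have "\<tau> * x - m = \<tau> * (x - m / \<tau>)" using \<tau> by (simp add: algebra_simps)
          then show ?thesis using \<tau> by (simp add: abs_mult)
        qed
        then show ?thesis using \<tau> by (simp add: pos_le_divide_eq mult.commute)
      qed
      have "\<bar>\<tau> * x - (s - \<nu>)\<bar> \<le> \<delta> \<or> \<bar>\<tau> * x - (- s - \<nu>)\<bar> \<le> \<delta>" using x by (auto simp: abs_if split: if_splits)
      then show "x \<in> ?I ((s - \<nu>) / \<tau>) \<union> ?I ((- s - \<nu>) / \<tau>)" using scale by blast
    qed
  qed (use I in auto)
  also have "\<dots> \<le> measure std_gauss (?I ((s - \<nu>) / \<tau>)) + measure std_gauss (?I ((- s - \<nu>) / \<tau>))"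
    by (rule measure_Un_le) (rule I)+
  also have "\<dots> \<le> 2 * (\<delta> / \<tau>) + 2 * (\<delta> / \<tau>)"
    using \<delta> \<tau> by (intro add_mono std_gauss_interval_le) auto
  finally show ?thesis by (simp add: \<tau>_def)
qed

text \<open>Estimating the error variance does not matter asymptotically: the pretest decision changes
  only if the variance estimate is off or the standardised coordinate is close to its critical value.\<close>
lemma pretest_known_variance:
  fixes X :: "nat \<Rightarrow> nat \<Rightarrow> real^'p"
  assumes fr: "full_rank X n" and \<sigma>: "\<sigma> > 0" and c: "c > 0" and \<theta>: "\<theta> $ i = 0"
    and \<epsilon>: "0 < \<epsilon>" "\<epsilon> < \<sigma>"
    and law: "distr (iid_normal n) borel (lse_error X n \<sigma>) = distr std_gauss borel ((*v) L)"
    and L: "L ** transpose L = \<sigma>\<^sup>2 *\<^sub>R matrix_inv (scaled_gram X n)"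
  shows "\<bar>measure (sample_law X n (local_param \<theta> i n \<nu>) \<sigma>) {y \<in> space (sample_space n).
        scaled_le A t n (local_param \<theta> i n \<nu>) (if \<bar>t_stat X n (UNIV - {i}) y\<bar> < c
          then restricted_lse X n (UNIV - {i}) y else restricted_lse X n UNIV y)}
      - limit_cdf A t (drop_dir (scaled_gram X n) i) i
          (c * \<sigma> * sqrt (matrix_inv (scaled_gram X n) $ i $ i)) ((*v) L) \<nu>\<bar>
    \<le> measure (iid_normal n) {u \<in> space (iid_normal n).
        \<bar>sigma_hat X n (sample X n (local_param \<theta> i n \<nu>) \<sigma> u) - \<sigma>\<bar> > \<epsilon>} + 4 * c * \<epsilon> / \<sigma>"
proof -
  let ?\<theta> = "local_param \<theta> i n \<nu>" and ?r = "UNIV - {i}" and ?I = "iid_normal n"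
  let ?b = "drop_dir (scaled_gram X n) i"
  let ?Z = "lse_error X n \<sigma>"
  define \<xi> where "\<xi> = sqrt (matrix_inv (scaled_gram X n) $ i $ i)"
  let ?s = "c * \<sigma> * \<xi>"
  let ?Q = "\<lambda>z. if \<bar>z $ i + \<nu>\<bar> < ?s then A *v (z - (z $ i + \<nu>) *\<^sub>R ?b) \<le> t else A *v z \<le> t"
  interpret I: prob_space ?I by (rule prob_space_iid_normal)
  have n: "n > 0" using fr by (simp add: full_rank_def)
  have \<xi>: "\<xi> > 0" unfolding \<xi>_def using inv_gram_diag_pos[OF fr] by simp
  note [measurable] = borel_measurable_restricted_lse[OF fr] borel_measurable_t_stat[OF fr]
    borel_measurable_sigma_hat[OF fr]
  let ?P = "\<lambda>y. scaled_le A t n ?\<theta> (if \<bar>t_stat X n ?r y\<bar> < c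
          then restricted_lse X n ?r y else restricted_lse X n UNIV y)"
  have zi: "zero_index ?r = i" by (simp add: zero_index_def)
  have full: "scaled_le A t n ?\<theta> (restricted_lse X n UNIV (sample X n ?\<theta> \<sigma> u)) \<longleftrightarrow> A *v ?Z u \<le> t" for u
    unfolding scaled_le_def restricted_lse_UNIV[OF fr] full_lse_sample[OF fr, where \<theta>="?\<theta>" and u=u, symmetric]
    by (simp only: matrix_vector_mult_scaleR)
  have coord: "sqrt (real n) * full_lse X n (sample X n ?\<theta> \<sigma> u) $ i = ?Z u $ i + \<nu>" for u
  proof -
    have "?Z u $ i = sqrt (real n) * (full_lse X n (sample X n ?\<theta> \<sigma> u) $ i - ?\<theta> $ i)"
      by (simp add: full_lse_sample[OF fr, where \<theta>="?\<theta>" and u=u, symmetric])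
    moreover have "?\<theta> $ i = \<nu> / sqrt (real n)" by (simp add: local_param_def \<theta>)
    ultimately show ?thesis using n by (simp add: right_diff_distrib)
  qed
  have restr: "scaled_le A t n ?\<theta> (restricted_lse X n ?r (sample X n ?\<theta> \<sigma> u))
      \<longleftrightarrow> A *v (?Z u - (?Z u $ i + \<nu>) *\<^sub>R ?b) \<le> t" for u
  proof -
    let ?f = "full_lse X n (sample X n ?\<theta> \<sigma> u)"
    have "sqrt (real n) *\<^sub>R (?f - (?f $ i) *\<^sub>R ?b - ?\<theta>)
        = sqrt (real n) *\<^sub>R (?f - ?\<theta>) - (sqrt (real n) * ?f $ i) *\<^sub>R ?b"
      by (simp add: algebra_simps)
    also have "\<dots> = ?Z u - (?Z u $ i + \<nu>) *\<^sub>R ?b"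
      by (simp only: full_lse_sample[OF fr] coord)
    finally have "A *v (?Z u - (?Z u $ i + \<nu>) *\<^sub>R ?b)
        = sqrt (real n) *\<^sub>R (A *v (?f - (?f $ i) *\<^sub>R ?b - ?\<theta>))"
      by (metis matrix_vector_mult_scaleR)
    then show ?thesis unfolding scaled_le_def restricted_lse_drop[OF fr] by simp
  qed
  have tst: "t_stat X n ?r (sample X n ?\<theta> \<sigma> u)
      = (?Z u $ i + \<nu>) / (sigma_hat X n (sample X n ?\<theta> \<sigma> u) * \<xi>)" for u
    unfolding t_stat_def Let_def zi restricted_lse_UNIV[OF fr] coord \<xi>_def ..
  let ?S1 = "{u \<in> space ?I. ?P (sample X n ?\<theta> \<sigma> u)}"
  let ?S2 = "{u \<in> space ?I. ?Q (?Z u)}"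
  let ?B1 = "{u \<in> space ?I. \<bar>sigma_hat X n (sample X n ?\<theta> \<sigma> u) - \<sigma>\<bar> > \<epsilon>}"
  let ?B2 = "{u \<in> space ?I. \<bar>\<bar>?Z u $ i + \<nu>\<bar> - ?s\<bar> \<le> c * \<epsilon> * \<xi>}"
  have m: "?S1 \<in> sets ?I" "?S2 \<in> sets ?I" "?B1 \<in> sets ?I" "?B2 \<in> sets ?I" by measurable
  have "sym_diff ?S1 ?S2 \<subseteq> ?B1 \<union> ?B2"
  proof (rule subsetI, rule ccontr)
    fix u assume u: "u \<in> sym_diff ?S1 ?S2" and no: "u \<notin> ?B1 \<union> ?B2"
    define w where "w = sigma_hat X n (sample X n ?\<theta> \<sigma> u)"
    define x where "x = ?Z u $ i + \<nu>"
    have sp: "u \<in> space ?I" using u by auto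
    have w: "\<bar>w - \<sigma>\<bar> \<le> \<epsilon>" and x: "\<bar>\<bar>x\<bar> - ?s\<bar> > c * \<epsilon> * \<xi>" using no sp by (auto simp: w_def x_def)
    have w0: "w > 0" using w \<epsilon> by linarith
    have "\<bar>x / (w * \<xi>)\<bar> < c \<longleftrightarrow> \<bar>x\<bar> < c * (w * \<xi>)"
      using w0 \<xi> by (simp add: abs_mult pos_divide_less_eq)
    also have "\<dots> \<longleftrightarrow> \<bar>x\<bar> < ?s"
    proof -
      have "\<bar>c * (w * \<xi>) - ?s\<bar> = c * \<xi> * \<bar>w - \<sigma>\<bar>"
      proof -
        have "c * (w * \<xi>) - ?s = c * \<xi> * (w - \<sigma>)" by (simp add: algebra_simps)
        then show ?thesis using c \<xi> by (simp add: abs_mult)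
      qed
      also have "\<dots> \<le> c * \<xi> * \<epsilon>" using w c \<xi> by (intro mult_left_mono) auto
      finally have "\<bar>c * (w * \<xi>) - ?s\<bar> \<le> c * \<epsilon> * \<xi>" by (simp add: ac_simps)
      then show ?thesis using x by linarith
    qed
    finally have "\<bar>t_stat X n ?r (sample X n ?\<theta> \<sigma> u)\<bar> < c \<longleftrightarrow> \<bar>?Z u $ i + \<nu>\<bar> < ?s"
      unfolding tst w_def x_def .
    then have "?P (sample X n ?\<theta> \<sigma> u) \<longleftrightarrow> ?Q (?Z u)" by (simp add: full restr)
    then show False using u by auto
  qed
  then have "\<bar>measure ?I ?S1 - measure ?I ?S2\<bar> \<le> measure ?I (?B1 \<union> ?B2)"
    using m by (intro I.measure_sym_diff_le) auto
  also have "\<dots> \<le> measure ?I ?B1 + measure ?I ?B2" using m by (intro measure_Un_le)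
  also have "measure ?I ?B2 \<le> 4 * c * \<epsilon> / \<sigma>"
  proof -
    let ?a = "adjoint ((*v) L) (axis i 1)"
    have inv: "invertible (scaled_gram X n)" by (rule invertible_scaled_gram[OF fr])
    have Li: "(L *v \<zeta>) $ i = \<zeta> \<bullet> ?a" for \<zeta>
      using adjoint_works[OF matrix_vector_mul_linear[of L], of \<zeta> "axis i 1"] by (simp add: inner_axis)
    have "(norm ?a)\<^sup>2 = (\<sigma> * \<xi>)\<^sup>2"
      using matrix_factor_facts(5)[OF L inv \<sigma>, of i] inv_gram_diag_pos[OF fr, of i]
      by (simp add: \<xi>_def power_mult_distrib)
    then have na: "norm ?a = \<sigma> * \<xi>" using \<sigma> \<xi> by (simp add: power2_eq_iff_nonneg)
    have a0: "?a \<noteq> 0" by (rule matrix_factor_facts(2)[OF L inv \<sigma>])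
    have "{z :: real^'p. \<bar>\<bar>z $ i + \<nu>\<bar> - ?s\<bar> \<le> c * \<epsilon> * \<xi>} \<in> sets borel" by measurable
    from measure_lse_error[OF law this]
    have "measure ?I ?B2 = measure std_gauss {\<zeta>. \<bar>\<bar>\<zeta> \<bullet> ?a + \<nu>\<bar> - ?s\<bar> \<le> c * \<epsilon> * \<xi>}"
      by (simp add: Li)
    also have "\<dots> \<le> 4 * (c * \<epsilon> * \<xi>) / norm ?a"
      using c \<epsilon> \<xi> by (intro std_gauss_slab_le a0) simp
    also have "\<dots> = 4 * c * \<epsilon> / \<sigma>" unfolding na using \<xi> \<sigma> by simp
    finally show ?thesis .
  qed
  finally have diff: "\<bar>measure ?I ?S1 - measure ?I ?S2\<bar> \<le> measure ?I ?B1 + 4 * c * \<epsilon> / \<sigma>" by simp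
  have "{y \<in> space (sample_space n). ?P y} \<in> sets (sample_space n)" by measurable
  then have S1: "measure (sample_law X n ?\<theta> \<sigma>) {y \<in> space (sample_space n). ?P y} = measure ?I ?S1"
    by (rule measure_sample_law[OF \<sigma>])
  have "{z. ?Q z} \<in> sets borel" by measurable
  from measure_lse_error[OF law this] have S2: "measure ?I ?S2 = limit_cdf A t ?b i ?s ((*v) L) \<nu>"
    by (simp add: limit_cdf_def)
  show ?thesis using diff unfolding S1[symmetric] S2 unfolding \<xi>_def .
qed

lemma design_error_laws:
  fixes X :: "nat \<Rightarrow> nat \<Rightarrow> real^'p"
  assumes des: "design X Q" and \<sigma>: "\<sigma> > 0"
  obtains L V :: "nat \<Rightarrow> real^'p^'p" where
    "\<forall>n. L n ** transpose (L n) = V n" "V \<longlonglongrightarrow> \<sigma>\<^sup>2 *\<^sub>R matrix_inv Q"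
    "\<forall>n>CARD('p). V n = \<sigma>\<^sup>2 *\<^sub>R matrix_inv (scaled_gram X n)"
    "\<forall>n>CARD('p). distr (iid_normal n) borel (lse_error X n \<sigma>) = distr std_gauss borel ((*v) (L n))"
proof -
  have "\<exists>L :: real^'p^'p. n > CARD('p) \<longrightarrow>
      distr (iid_normal n) borel (lse_error X n \<sigma>) = distr std_gauss borel ((*v) L)
      \<and> L ** transpose L = \<sigma>\<^sup>2 *\<^sub>R matrix_inv (scaled_gram X n)" for n
    using lse_error_law[OF design_full_rank[OF des], of n \<sigma>] by blast
  then obtain L :: "nat \<Rightarrow> real^'p^'p" where L: "\<And>n. n > CARD('p) \<Longrightarrow>
      distr (iid_normal n) borel (lse_error X n \<sigma>) = distr std_gauss borel ((*v) (L n))"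
    "\<And>n. n > CARD('p) \<Longrightarrow> L n ** transpose (L n) = \<sigma>\<^sup>2 *\<^sub>R matrix_inv (scaled_gram X n)"
    by metis
  have G: "(\<lambda>n. scaled_gram X n) \<longlonglongrightarrow> Q" and Q: "invertible Q" using des by (auto simp: design_def)
  have "(\<lambda>n. \<sigma>\<^sup>2 *\<^sub>R matrix_inv (scaled_gram X n)) \<longlonglongrightarrow> \<sigma>\<^sup>2 *\<^sub>R matrix_inv Q"
    by (intro tendsto_scaleR tendsto_const matrix_inv_tendsto[OF G Q])
  moreover have "\<forall>\<^sub>F n in sequentially. \<sigma>\<^sup>2 *\<^sub>R matrix_inv (scaled_gram X n) = L n ** transpose (L n)"
    using eventually_gt_at_top[of "CARD('p)"] by eventually_elim (simp add: L)
  ultimately have lim: "(\<lambda>n. L n ** transpose (L n)) \<longlonglongrightarrow> \<sigma>\<^sup>2 *\<^sub>R matrix_inv Q"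
    by (rule Lim_transform_eventually)
  show ?thesis
  proof (rule that[of L "\<lambda>n. L n ** transpose (L n)"])
    show "(\<lambda>n. L n ** transpose (L n)) \<longlonglongrightarrow> \<sigma>\<^sup>2 *\<^sub>R matrix_inv Q" by (rule lim)
  qed (use L in auto)
qed

lemma design_factor:
  fixes X :: "nat \<Rightarrow> nat \<Rightarrow> real^'p"
  assumes des: "design X Q" and \<sigma>: "\<sigma> > 0"
  shows "\<exists>L :: real^'p^'p. L ** transpose L = \<sigma>\<^sup>2 *\<^sub>R matrix_inv Q"
proof -
  obtain L V :: "nat \<Rightarrow> real^'p^'p" where LL: "\<forall>n. L n ** transpose (L n) = V n"
    and V: "V \<longlonglongrightarrow> \<sigma>\<^sup>2 *\<^sub>R matrix_inv Q"
    and Vn: "\<forall>n>CARD('p). V n = \<sigma>\<^sup>2 *\<^sub>R matrix_inv (scaled_gram X n)"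
    and law: "\<forall>n>CARD('p). distr (iid_normal n) borel (lse_error X n \<sigma>) = distr std_gauss borel ((*v) (L n))"
    by (rule design_error_laws[OF des \<sigma>])
  obtain l :: "real^'p^'p" where "l ** transpose l = \<sigma>\<^sup>2 *\<^sub>R matrix_inv Q"
    by (rule factor_subsequence[OF LL[rule_format] V])
  then show ?thesis by (rule exI)
qed

lemma sqrt_mult_tendsto_0:
  assumes "C \<longlonglongrightarrow> (C' :: real)" "e \<longlonglongrightarrow> 0"
  shows "(\<lambda>n. sqrt (C n * e n)) \<longlonglongrightarrow> 0"
  using tendsto_real_sqrt[OF tendsto_mult[OF assms]] by simp

text \<open>Assumption (S) concerns the law at \<open>\<theta>\<close> only; contiguity transfers it to the local alternatives.\<close>
lemma pms_cdf_tendsto: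
  fixes X :: "nat \<Rightarrow> nat \<Rightarrow> real^'p" and A :: "real^'p^'k"
  assumes rank: "rank A = CARD('k)" and \<sigma>: "\<sigma> > 0" and des: "design X Q"
    and sel: "selection_procedure R rhat" and S: "S_constant X rhat (UNIV - {i}) c"
    and ozp: "one_zero_point (UNIV - {i}) \<theta>"
    and L': "L' ** transpose L' = \<sigma>\<^sup>2 *\<^sub>R matrix_inv Q"
    and \<nu>: "\<nu> \<notin> boundary_points t (A *v drop_dir Q i)"
  shows "(\<lambda>n. pms_cdf X R rhat A n (local_param \<theta> i n \<nu>) \<sigma> t)
    \<longlonglongrightarrow> limit_cdf A t (drop_dir Q i) i (c * \<sigma> * sqrt (matrix_inv Q $ i $ i)) ((*v) L') \<nu>"
    (is "?K \<longlonglongrightarrow> ?G")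
proof -
  have G: "(\<lambda>n. scaled_gram X n) \<longlonglongrightarrow> Q" and Q: "invertible Q" using des by (auto simp: design_def)
  have c: "c > 0" using S by (simp add: S_constant_def)
  have \<theta>: "\<theta> $ i = 0" using ozp by (simp add: one_zero_point_def model_def)
  have H: "(\<lambda>n. matrix_inv (scaled_gram X n)) \<longlonglongrightarrow> matrix_inv Q" by (rule matrix_inv_tendsto[OF G Q])
  have pos: "matrix_inv Q $ i $ i > 0" by (rule matrix_factor_facts(3)[OF L' Q \<sigma>])
  obtain L V :: "nat \<Rightarrow> real^'p^'p" where LL: "\<forall>n. L n ** transpose (L n) = V n"
    and V: "V \<longlonglongrightarrow> \<sigma>\<^sup>2 *\<^sub>R matrix_inv Q"
    and Vn: "\<forall>n>CARD('p). V n = \<sigma>\<^sup>2 *\<^sub>R matrix_inv (scaled_gram X n)"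
    and law: "\<forall>n>CARD('p). distr (iid_normal n) borel (lse_error X n \<sigma>) = distr std_gauss borel ((*v) (L n))"
    by (rule design_error_laws[OF des \<sigma>])
  let ?\<theta> = "\<lambda>n. local_param \<theta> i n \<nu>" and ?r = "UNIV - {i}"
  let ?B1 = "\<lambda>n. sym_diff {y \<in> space (sample_space n). rhat n y = UNIV}
      {y \<in> space (sample_space n). \<bar>t_stat X n ?r y\<bar> \<ge> c}"
  let ?B2 = "\<lambda>n. sym_diff {y \<in> space (sample_space n). rhat n y = ?r}
      {y \<in> space (sample_space n). \<bar>t_stat X n ?r y\<bar> < c}"
  let ?P = "\<lambda>n \<kappa>. measure (sample_law X n (local_param \<theta> i n \<kappa>) \<sigma>)"
  define T where "T n = ?P n \<nu> {y \<in> space (sample_space n). scaled_le A t n (?\<theta> n)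
      (if \<bar>t_stat X n ?r y\<bar> < c then restricted_lse X n ?r y else restricted_lse X n UNIV y)}" for n
  define l where "l n = limit_cdf A t (drop_dir (scaled_gram X n) i) i
      (c * \<sigma> * sqrt (matrix_inv (scaled_gram X n) $ i $ i)) ((*v) (L n)) \<nu>" for n
  have entry: "(\<lambda>n. matrix_inv (scaled_gram X n) $ a $ i) \<longlonglongrightarrow> matrix_inv Q $ a $ i" for a
    by (intro tendsto_vec_nth H)
  have "(\<lambda>n. matrix_inv (scaled_gram X n) *v axis i 1) \<longlonglongrightarrow> matrix_inv Q *v axis i 1"
    unfolding matrix_vector_mult_basis column_def by (rule vec_tendstoI) (simp add: entry)
  then have dl: "(\<lambda>n. drop_dir (scaled_gram X n) i) \<longlonglongrightarrow> drop_dir Q i"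
    unfolding drop_dir_def using pos
    by (intro tendsto_scaleR tendsto_divide[OF tendsto_const entry]) auto
  have sl: "(\<lambda>n. c * \<sigma> * sqrt (matrix_inv (scaled_gram X n) $ i $ i)) \<longlonglongrightarrow> c * \<sigma> * sqrt (matrix_inv Q $ i $ i)"
    by (intro tendsto_mult tendsto_const tendsto_real_sqrt entry)
  have "(\<lambda>n. l n) \<longlonglongrightarrow> ?G"
    unfolding l_def by (rule limit_cdf_tendsto[where L=L and V=V, OF rank \<sigma> Q LL[rule_format] V dl sl L' \<nu>])
  moreover have "(\<lambda>n. ?K n - T n) \<longlonglongrightarrow> 0"
  proof (rule Lim_null_comparison)
    define C where "C n = exp ((\<nu> - 0)\<^sup>2 * scaled_gram X n $ i $ i / \<sigma>\<^sup>2)" for n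
    have C: "C \<longlonglongrightarrow> exp ((\<nu> - 0)\<^sup>2 * Q $ i $ i / \<sigma>\<^sup>2)"
      unfolding C_def using \<sigma> by (intro tendsto_intros G) auto
    show "\<forall>\<^sub>F n in sequentially. norm (?K n - T n)
        \<le> sqrt (C n * ?P n 0 (?B1 n)) + sqrt (C n * ?P n 0 (?B2 n))"
      using eventually_gt_at_top[of "CARD('p)"]
    proof eventually_elim
      case (elim n)
      have fr: "full_rank X n" by (rule design_full_rank[OF des elim])
      have sel_n: "rhat n \<in> sample_space n \<rightarrow>\<^sub>M count_space UNIV"
        and R_n: "\<And>y. y \<in> space (sample_space n) \<Longrightarrow> rhat n y \<in> R"
        using sel elim by (auto simp: selection_procedure_def)
      note [measurable] = sel_n borel_measurable_t_stat[OF fr]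
      have "{y \<in> space (sample_space n). rhat n y = q} \<in> sets (sample_space n)" for q by measurable
      moreover have "{y \<in> space (sample_space n). \<bar>t_stat X n ?r y\<bar> < c} \<in> sets (sample_space n)"
        "{y \<in> space (sample_space n). \<bar>t_stat X n ?r y\<bar> \<ge> c} \<in> sets (sample_space n)" by measurable
      ultimately have B: "?B1 n \<in> sets (sample_space n)" "?B2 n \<in> sets (sample_space n)" by auto
      have n: "n > 0" using elim by simp
      have "\<bar>?K n - T n\<bar> \<le> ?P n \<nu> (?B1 n) + ?P n \<nu> (?B2 n)"
        unfolding T_def by (rule pms_cdf_pretest[OF fr \<sigma>, where rhat=rhat]) (use sel_n R_n in auto)
      also have "\<dots> \<le> sqrt (C n * ?P n 0 (?B1 n)) + sqrt (C n * ?P n 0 (?B2 n))"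
        unfolding C_def by (intro add_mono local_shift(2)[OF \<sigma> n] B)
      finally show ?case by simp
    qed
    have S0: "(\<lambda>n. ?P n 0 (?B1 n)) \<longlonglongrightarrow> 0" "(\<lambda>n. ?P n 0 (?B2 n)) \<longlonglongrightarrow> 0"
      using S ozp \<sigma> by (auto simp: S_constant_def)
    show "(\<lambda>n. sqrt (C n * ?P n 0 (?B1 n)) + sqrt (C n * ?P n 0 (?B2 n))) \<longlonglongrightarrow> 0"
      using tendsto_add[OF sqrt_mult_tendsto_0[OF C S0(1)] sqrt_mult_tendsto_0[OF C S0(2)]] by simp
  qed
  moreover have "(\<lambda>n. T n - l n) \<longlonglongrightarrow> 0"
  proof (rule tendstoI)
    fix e :: real assume e: "e > 0"
    \<comment> \<open>Small enough for the critical band to have probability at most \<open>e / 2\<close>.\<close>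
    define \<epsilon> where "\<epsilon> = min (\<sigma> / 2) (e * \<sigma> / (8 * c))"
    have \<epsilon>: "0 < \<epsilon>" "\<epsilon> < \<sigma>" using e \<sigma> c by (auto simp: \<epsilon>_def)
    have "4 * c * \<epsilon> / \<sigma> \<le> 4 * c * (e * \<sigma> / (8 * c)) / \<sigma>"
      using c \<sigma> by (intro divide_right_mono mult_left_mono) (auto simp: \<epsilon>_def)
    also have "\<dots> = e / 2" using c \<sigma> by simp
    finally have small: "4 * c * \<epsilon> / \<sigma> \<le> e / 2" .
    have "\<forall>\<^sub>F n in sequentially. measure (iid_normal n) {u \<in> space (iid_normal n).
        \<bar>sigma_hat X n (sample X n (?\<theta> n) \<sigma> u) - \<sigma>\<bar> > \<epsilon>} < e / 2"
      using order_tendstoD(2)[OF sigma_hat_consistent[OF des \<sigma> \<epsilon>(1), of ?\<theta>], of "e / 2"] e by simp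
    then show "\<forall>\<^sub>F n in sequentially. dist (T n - l n) 0 < e"
      using eventually_gt_at_top[of "CARD('p)"]
    proof eventually_elim
      case (elim n)
      have fr: "full_rank X n" by (rule design_full_rank[OF des elim(2)])
      have "\<bar>T n - l n\<bar> \<le> measure (iid_normal n) {u \<in> space (iid_normal n).
          \<bar>sigma_hat X n (sample X n (?\<theta> n) \<sigma> u) - \<sigma>\<bar> > \<epsilon>} + 4 * c * \<epsilon> / \<sigma>"
        unfolding T_def l_def
        by (rule pretest_known_variance[OF fr \<sigma> c \<theta> \<epsilon> law[rule_format, OF elim(2)]])
          (simp only: LL[rule_format] Vn[rule_format, OF elim(2)])
      then show ?case using elim(1) small by simp
    qed
  qed
  ultimately have "(\<lambda>n. (?K n - T n) + (T n - l n) + l n) \<longlonglongrightarrow> 0 + 0 + ?G"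
    by (intro tendsto_add)
  then show ?thesis by simp
qed

section \<open>Lower bounds for the estimation error\<close>

text \<open>An estimator cannot be within \<open>\<delta>\<close> of two values further apart than \<open>2 \<delta>\<close>. The two events
  of failure therefore cover the sample space, and the shift bounds compare their probabilities
  under the two laws: the first bound is sharp when the laws are close, the second one is the
  useful one when \<open>e\<close> tends to zero.\<close>
lemma two_point_bound:
  fixes X :: "nat \<Rightarrow> nat \<Rightarrow> real^'p" and \<theta> :: "real^'p" and i :: 'p and \<sigma> \<nu> \<nu>' \<delta> :: real
  assumes \<sigma>: "\<sigma> > 0" and n: "n > 0" and K: "K \<in> estimators n"
    and far: "2 * \<delta> < \<bar>pms_cdf X R rhat A n (local_param \<theta> i n \<nu>) \<sigma> t
      - pms_cdf X R rhat A n (local_param \<theta> i n \<nu>') \<sigma> t\<bar>"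
  defines "C \<equiv> exp ((\<nu>' - \<nu>)\<^sup>2 * scaled_gram X n $ i $ i / \<sigma>\<^sup>2)"
    and "e \<equiv> error_prob X R rhat A t \<sigma> n K \<delta> (local_param \<theta> i n \<nu>)"
    and "e' \<equiv> error_prob X R rhat A t \<sigma> n K \<delta> (local_param \<theta> i n \<nu>')"
  shows "1 - sqrt (C - 1) \<le> e + e'" and "1 \<le> e' + sqrt (C * e)"
proof -
  let ?P = "\<lambda>\<nu>. sample_law X n (local_param \<theta> i n \<nu>) \<sigma>"
  let ?k = "\<lambda>\<nu>. pms_cdf X R rhat A n (local_param \<theta> i n \<nu>) \<sigma> t"
  let ?B = "{y \<in> space (sample_space n). \<bar>K y - ?k \<nu>\<bar> > \<delta>}"
  let ?B' = "{y \<in> space (sample_space n). \<bar>K y - ?k \<nu>'\<bar> > \<delta>}"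
  interpret P': prob_space "?P \<nu>'" by (rule prob_space_sample_law[OF \<sigma>])
  have [measurable]: "K \<in> borel_measurable (sample_space n)" using K by (simp add: estimators_def)
  have B: "?B \<in> sets (sample_space n)" and B': "?B' \<in> sets (sample_space n)" by measurable
  have "space (?P \<nu>') \<subseteq> ?B \<union> ?B'"
  proof
    fix y assume "y \<in> space (?P \<nu>')"
    moreover have "\<bar>K y - ?k \<nu>\<bar> > \<delta> \<or> \<bar>K y - ?k \<nu>'\<bar> > \<delta>" using far by linarith
    ultimately show "y \<in> ?B \<union> ?B'" by (auto simp: space_sample_law)
  qed
  then have "1 \<le> measure (?P \<nu>') (?B \<union> ?B')"
    using P'.finite_measure_mono[of "space (?P \<nu>')" "?B \<union> ?B'"] B B' P'.prob_space
    by (simp add: sets_sample_law)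
  also have "\<dots> \<le> measure (?P \<nu>') ?B + measure (?P \<nu>') ?B'"
    using B B' by (intro measure_Un_le) (simp_all add: sets_sample_law)
  finally have "1 \<le> measure (?P \<nu>') ?B + e'" by (simp add: e'_def error_prob_def)
  moreover have "\<bar>measure (?P \<nu>') ?B - e\<bar> \<le> sqrt (C - 1)" "measure (?P \<nu>') ?B \<le> sqrt (C * e)"
    unfolding e_def error_prob_def C_def by (rule local_shift[OF \<sigma> n B])+
  ultimately show "1 - sqrt (C - 1) \<le> e + e'" "1 \<le> e' + sqrt (C * e)" by linarith+
qed

lemma local_sup_error_ge:
  assumes "\<bar>\<nu>\<bar> < \<rho>" "n > 0"
  shows "ereal (error_prob X R rhat A t \<sigma> n K \<delta> (local_param \<theta> i n \<nu>)) \<le> local_sup_error X R rhat A t \<sigma> \<theta> \<rho> n K \<delta>"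
proof -
  have "norm (local_param \<theta> i n \<nu> - \<theta>) < \<rho> / sqrt (real n)"
    using assms by (simp add: local_param_def divide_strict_right_mono)
  then show ?thesis unfolding local_sup_error_def by (intro SUP_upper) simp
qed

lemma local_sup_error_le_1:
  assumes "\<sigma> > 0"
  shows "local_sup_error X R rhat A t \<sigma> \<theta> \<rho> n K \<delta> \<le> 1"
  unfolding local_sup_error_def
proof (rule SUP_least)
  fix \<eta>
  interpret prob_space "sample_law X n \<eta> \<sigma>" by (rule prob_space_sample_law[OF assms])
  show "ereal (error_prob X R rhat A t \<sigma> n K \<delta> \<eta>) \<le> 1" by (simp add: error_prob_def)
qed

text \<open>Otherwise \<open>G\<close> would not change along a chain of steps shorter than \<open>\<eta>\<close> from \<open>a\<close> to \<open>b\<close> that avoids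
  the finite set \<open>E\<close>.\<close>
lemma close_points_with_different_values:
  fixes G :: "real \<Rightarrow> real"
  assumes E: "finite E" and a: "a \<notin> E" and b: "b \<notin> E" and ab: "a \<le> b" and ne: "G a \<noteq> G b" and \<eta>: "\<eta> > 0"
  shows "\<exists>x y. x \<notin> E \<and> y \<notin> E \<and> a \<le> x \<and> x \<le> b \<and> a \<le> y \<and> y \<le> b \<and> \<bar>y - x\<bar> < \<eta> \<and> G x \<noteq> G y"
proof (rule ccontr)
  assume no: "\<not> ?thesis"
  then have close: "G x = G y" if "x \<notin> E" "y \<notin> E" "a \<le> x" "x \<le> b" "a \<le> y" "y \<le> b" "\<bar>y - x\<bar> < \<eta>" for x y
    using that no by blast
  have "G x = G b" if "a \<le> x" "x \<le> b" "x \<notin> E" "b - x < real k * (\<eta> / 2)" for x k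
    using that
  proof (induction k arbitrary: x)
    case 0 then show ?case by simp
  next
    case (Suc k)
    show ?case
    proof (cases "b - x < \<eta>")
      case True
      then show ?thesis using Suc.prems ab b by (intro close) auto
    next
      case False
      have "infinite {x + \<eta> / 2<..<x + \<eta>}" using \<eta> by simp
      then have "{x + \<eta> / 2<..<x + \<eta>} - E \<noteq> {}" using E by (metis Diff_eq_empty_iff finite_subset)
      then obtain x' where "x' \<in> {x + \<eta> / 2<..<x + \<eta>} - E" by blast
      then have x': "x + \<eta> / 2 < x'" "x' < x + \<eta>" "x' \<notin> E" by auto
      have "b - x' < real k * (\<eta> / 2)" using Suc.prems(4) x'(1) by (simp add: algebra_simps add_divide_distrib)
      then have "G x' = G b" using Suc.prems x' False \<eta> by (intro Suc.IH) auto
      moreover have "G x = G x'" using Suc.prems x' False \<eta> by (intro close) auto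
      ultimately show ?thesis by simp
    qed
  qed
  moreover obtain k where "b - a < real k * (\<eta> / 2)" using ex_less_of_nat_mult[of "\<eta> / 2" "b - a"] \<eta> by auto
  ultimately show False using a ab ne by blast
qed

lemma limit_cdf_two_values:
  fixes A :: "real^'p^'k" and Q L :: "real^'p^'p" and t :: "real^'k" and i :: 'p and \<sigma> c :: real
  assumes rank: "rank A = CARD('k)" and \<sigma>: "\<sigma> > 0" and c: "c > 0" and Q: "invertible Q"
    and L: "L ** transpose L = \<sigma>\<^sup>2 *\<^sub>R matrix_inv Q" and A: "A *v (matrix_inv Q *v axis i 1) \<noteq> 0"
  defines "G \<equiv> limit_cdf A t (drop_dir Q i) i (c * \<sigma> * sqrt (matrix_inv Q $ i $ i)) ((*v) L)"
    and "E \<equiv> boundary_points t (A *v drop_dir Q i)"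
  shows "\<exists>\<nu>\<^sub>1 \<nu>\<^sub>2. \<nu>\<^sub>1 \<notin> E \<and> \<nu>\<^sub>2 \<notin> E \<and> G \<nu>\<^sub>1 \<noteq> G \<nu>\<^sub>2"
proof (rule ccontr)
  assume no: "\<not> ?thesis"
  have E: "finite E" unfolding E_def by (rule finite_boundary_points)
  then obtain \<nu>\<^sub>0 where \<nu>\<^sub>0: "\<nu>\<^sub>0 \<notin> E" using infinite_UNIV_char_0[where 'a=real] ex_new_if_finite by blast
  have "G \<nu> = G \<nu>\<^sub>0" if "\<nu> \<notin> E" for \<nu> using no that \<nu>\<^sub>0 by blast
  then have "{\<nu>. G \<nu> \<noteq> G \<nu>\<^sub>0} \<subseteq> E" by blast
  moreover have "E \<in> null_sets lborel" using E by (rule finite_imp_null_set_lborel)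
  ultimately have "AE \<nu> in lborel. G \<nu> = G \<nu>\<^sub>0" by (intro AE_I'[of E]) auto
  moreover have pos: "matrix_inv Q $ i $ i > 0" by (rule matrix_factor_facts(3)[OF L Q \<sigma>])
  have "A *v drop_dir Q i = (1 / matrix_inv Q $ i $ i) *\<^sub>R (A *v (matrix_inv Q *v axis i 1))"
    by (simp only: drop_dir_def matrix_vector_mult_scaleR)
  then have "A *v drop_dir Q i \<noteq> 0" using A pos by simp
  then have "\<not> (AE \<nu> in lborel. G \<nu> = G \<nu>\<^sub>0)"
    unfolding G_def using c \<sigma> pos
    by (intro limit_cdf_not_constant[OF rank] matrix_factor_facts[OF L Q \<sigma>]) auto
  ultimately show False by blast
qed

lemma eventually_gap:
  fixes k\<^sub>1 k\<^sub>2 :: "nat \<Rightarrow> real"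
  assumes "k\<^sub>1 \<longlonglongrightarrow> g\<^sub>1" "k\<^sub>2 \<longlonglongrightarrow> g\<^sub>2" "D < \<bar>g\<^sub>1 - g\<^sub>2\<bar>"
  shows "\<forall>\<^sub>F n in sequentially. D < \<bar>k\<^sub>1 n - k\<^sub>2 n\<bar>"
  by (rule order_tendstoD(1)[OF tendsto_rabs[OF tendsto_diff[OF assms(1,2)]] assms(3)])

lemma likelihood_constant_tendsto:
  fixes X :: "nat \<Rightarrow> nat \<Rightarrow> real^'p"
  assumes "design X Q" "\<sigma> > 0"
  shows "(\<lambda>n. exp (h\<^sup>2 * scaled_gram X n $ i $ i / \<sigma>\<^sup>2)) \<longlonglongrightarrow> exp (h\<^sup>2 * Q $ i $ i / \<sigma>\<^sup>2)"
proof -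
  have "(\<lambda>n. scaled_gram X n $ i $ i) \<longlonglongrightarrow> Q $ i $ i"
    using assms(1) by (intro tendsto_vec_nth) (simp add: design_def)
  then show ?thesis using assms(2) by (intro tendsto_exp tendsto_divide tendsto_mult tendsto_const) auto
qed

text \<open>Consistency at \<open>\<theta>\<close> makes the estimator stay, by contiguity, close to the estimand at \<open>\<theta>\<close> also under
  the local alternatives, while the estimand itself moves. Two alternatives with distinct limits are
  used because the estimand at \<open>\<theta>\<close> need not converge: for each \<open>n\<close> it differs from one of the two.\<close>
lemma consistent_estimator_fails_locally:
  fixes X :: "nat \<Rightarrow> nat \<Rightarrow> real^'p" and A :: "real^'p^'k"
  assumes \<sigma>: "\<sigma> > 0" and des: "design X Q" and \<delta>: "\<delta> > 0"
    and \<nu>: "\<bar>\<nu>\<^sub>1\<bar> < \<rho>" "\<bar>\<nu>\<^sub>2\<bar> < \<rho>"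
    and lim: "(\<lambda>n. pms_cdf X R rhat A n (local_param \<theta> i n \<nu>\<^sub>1) \<sigma> t) \<longlonglongrightarrow> g\<^sub>1"
      "(\<lambda>n. pms_cdf X R rhat A n (local_param \<theta> i n \<nu>\<^sub>2) \<sigma> t) \<longlonglongrightarrow> g\<^sub>2"
    and gap: "4 * \<delta> < \<bar>g\<^sub>1 - g\<^sub>2\<bar>"
    and K: "\<And>n. n > CARD('p) \<Longrightarrow> K n \<in> estimators n"
    and cons: "(\<lambda>n. error_prob X R rhat A t \<sigma> n (K n) \<delta> \<theta>) \<longlonglongrightarrow> 0"
  shows "(\<lambda>n. local_sup_error X R rhat A t \<sigma> \<theta> \<rho> n (K n) \<delta>) \<longlonglongrightarrow> 1"
proof -
  let ?k = "\<lambda>n \<nu>. pms_cdf X R rhat A n (local_param \<theta> i n \<nu>) \<sigma> t"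
  define C where "C \<nu> n = exp (\<nu>\<^sup>2 * scaled_gram X n $ i $ i / \<sigma>\<^sup>2)" for \<nu> n
  define e where "e n = error_prob X R rhat A t \<sigma> n (K n) \<delta> \<theta>" for n
  have e0: "e n \<ge> 0" for n by (simp add: e_def error_prob_def)
  have lo: "(\<lambda>n. ereal (1 - (sqrt (C \<nu>\<^sub>1 n * e n) + sqrt (C \<nu>\<^sub>2 n * e n)))) \<longlonglongrightarrow> 1"
  proof -
    have z: "(\<lambda>n. sqrt (C \<nu> n * e n)) \<longlonglongrightarrow> 0" for \<nu>
      unfolding C_def e_def by (rule sqrt_mult_tendsto_0[OF likelihood_constant_tendsto[OF des \<sigma>] cons])
    have "(\<lambda>n. 1 - (sqrt (C \<nu>\<^sub>1 n * e n) + sqrt (C \<nu>\<^sub>2 n * e n))) \<longlonglongrightarrow> 1 - (0 + 0)"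
      by (intro tendsto_diff tendsto_add tendsto_const z)
    then show ?thesis by (simp add: one_ereal_def)
  qed
  have "\<forall>\<^sub>F n in sequentially. 4 * \<delta> < \<bar>?k n \<nu>\<^sub>1 - ?k n \<nu>\<^sub>2\<bar>" by (rule eventually_gap[OF lim gap])
  then have ge: "\<forall>\<^sub>F n in sequentially. ereal (1 - (sqrt (C \<nu>\<^sub>1 n * e n) + sqrt (C \<nu>\<^sub>2 n * e n)))
      \<le> local_sup_error X R rhat A t \<sigma> \<theta> \<rho> n (K n) \<delta>"
    using eventually_gt_at_top[of "CARD('p)"]
  proof eventually_elim
    case (elim n)
    have n: "n > 0" using elim(2) by simp
    have key: "1 - sqrt (C \<nu> n * e n) \<le> error_prob X R rhat A t \<sigma> n (K n) \<delta> (local_param \<theta> i n \<nu>)"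
      if "2 * \<delta> < \<bar>?k n 0 - ?k n \<nu>\<bar>" for \<nu>
      using two_point_bound(2)[OF \<sigma> n K[OF elim(2)] that] by (simp add: C_def e_def)
    have s: "0 \<le> sqrt (C \<nu> n * e n)" for \<nu> using e0[of n] by (simp add: C_def)
    have "2 * \<delta> < \<bar>?k n 0 - ?k n \<nu>\<^sub>1\<bar> \<or> 2 * \<delta> < \<bar>?k n 0 - ?k n \<nu>\<^sub>2\<bar>"
      using elim(1) by linarith
    then obtain \<nu> where \<nu>': "\<bar>\<nu>\<bar> < \<rho>" "\<nu> = \<nu>\<^sub>1 \<or> \<nu> = \<nu>\<^sub>2" "2 * \<delta> < \<bar>?k n 0 - ?k n \<nu>\<bar>"
      using \<nu> by blast
    have "1 - (sqrt (C \<nu>\<^sub>1 n * e n) + sqrt (C \<nu>\<^sub>2 n * e n)) \<le> 1 - sqrt (C \<nu> n * e n)"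
      using \<nu>'(2) s[of \<nu>\<^sub>1] s[of \<nu>\<^sub>2] by auto
    also have "\<dots> \<le> error_prob X R rhat A t \<sigma> n (K n) \<delta> (local_param \<theta> i n \<nu>)"
      by (rule key[OF \<nu>'(3)])
    finally have "ereal (1 - (sqrt (C \<nu>\<^sub>1 n * e n) + sqrt (C \<nu>\<^sub>2 n * e n)))
        \<le> ereal (error_prob X R rhat A t \<sigma> n (K n) \<delta> (local_param \<theta> i n \<nu>))" by simp
    also have "\<dots> \<le> local_sup_error X R rhat A t \<sigma> \<theta> \<rho> n (K n) \<delta>"
      by (rule local_sup_error_ge[OF \<nu>'(1) n])
    finally show ?case .
  qed
  show ?thesis
    by (rule tendsto_sandwich[OF ge _ lo tendsto_const]) (simp add: local_sup_error_le_1[OF \<sigma>])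
qed

text \<open>Contiguity prevents the probabilities of failure at both alternatives from being small.\<close>
lemma local_minimax_error_pos:
  fixes X :: "nat \<Rightarrow> nat \<Rightarrow> real^'p" and A :: "real^'p^'k"
  assumes \<sigma>: "\<sigma> > 0" and des: "design X Q"
    and \<nu>: "\<bar>\<nu>\<^sub>1\<bar> < \<rho>" "\<bar>\<nu>\<^sub>2\<bar> < \<rho>"
    and lim: "(\<lambda>n. pms_cdf X R rhat A n (local_param \<theta> i n \<nu>\<^sub>1) \<sigma> t) \<longlonglongrightarrow> g\<^sub>1"
      "(\<lambda>n. pms_cdf X R rhat A n (local_param \<theta> i n \<nu>\<^sub>2) \<sigma> t) \<longlonglongrightarrow> g\<^sub>2"
    and gap: "2 * \<delta> < \<bar>g\<^sub>1 - g\<^sub>2\<bar>"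
  shows "liminf (\<lambda>n. INF K\<in>estimators n. local_sup_error X R rhat A t \<sigma> \<theta> \<rho> n K \<delta>) > 0"
proof -
  let ?k = "\<lambda>n \<nu>. pms_cdf X R rhat A n (local_param \<theta> i n \<nu>) \<sigma> t"
  define C where "C n = exp ((\<nu>\<^sub>2 - \<nu>\<^sub>1)\<^sup>2 * scaled_gram X n $ i $ i / \<sigma>\<^sup>2)" for n
  define B where "B = exp ((\<nu>\<^sub>2 - \<nu>\<^sub>1)\<^sup>2 * Q $ i $ i / \<sigma>\<^sup>2) + 1"
  have B: "B \<ge> 1" by (simp add: B_def)
  have Clim: "C \<longlonglongrightarrow> exp ((\<nu>\<^sub>2 - \<nu>\<^sub>1)\<^sup>2 * Q $ i $ i / \<sigma>\<^sup>2)"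
    unfolding C_def by (rule likelihood_constant_tendsto[OF des \<sigma>])
  then have "\<forall>\<^sub>F n in sequentially. C n < B" by (rule order_tendstoD) (simp add: B_def)
  moreover have "\<forall>\<^sub>F n in sequentially. 2 * \<delta> < \<bar>?k n \<nu>\<^sub>1 - ?k n \<nu>\<^sub>2\<bar>" by (rule eventually_gap[OF lim gap])
  ultimately have "\<forall>\<^sub>F n in sequentially. ereal (1 / (4 * B))
      \<le> (INF K\<in>estimators n. local_sup_error X R rhat A t \<sigma> \<theta> \<rho> n K \<delta>)"
    using eventually_gt_at_top[of 0]
  proof eventually_elim
    case (elim n)
    show ?case
    proof (rule INF_greatest)
      fix K assume K: "K \<in> estimators n"
      let ?e = "\<lambda>\<nu>. error_prob X R rhat A t \<sigma> n K \<delta> (local_param \<theta> i n \<nu>)"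
      have two: "1 \<le> ?e \<nu>\<^sub>2 + sqrt (C n * ?e \<nu>\<^sub>1)"
        using two_point_bound(2)[OF \<sigma> elim(3) K elim(2)] by (simp only: C_def)
      have e0: "?e \<nu> \<ge> 0" for \<nu> by (simp add: error_prob_def)
      \<comment> \<open>With \<open>?e \<nu>\<^sub>1 < 1 / (4 B)\<close> the square root is at most \<open>1 / 2\<close>, and so \<open>?e \<nu>\<^sub>2\<close> is at least \<open>1 / 2\<close>.\<close>
      have "1 / (4 * B) \<le> ?e \<nu>\<^sub>1 \<or> 1 / (4 * B) \<le> ?e \<nu>\<^sub>2"
      proof (rule ccontr)
        assume no: "\<not> ?thesis"
        have "C n * ?e \<nu>\<^sub>1 \<le> B * (1 / (4 * B))"
          using elim(1) no B e0[of \<nu>\<^sub>1] by (intro mult_mono) auto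
        also have "\<dots> = 1 / 4" using B by simp
        finally have "sqrt (C n * ?e \<nu>\<^sub>1) \<le> sqrt (1 / 4)" by (rule real_sqrt_le_mono)
        then have "sqrt (C n * ?e \<nu>\<^sub>1) \<le> 1 / 2" by (simp add: real_sqrt_divide)
        moreover have "1 / (4 * B) \<le> 1 / 4" using B by (simp add: divide_simps)
        ultimately show False using two no by linarith
      qed
      then obtain \<nu> where \<nu>': "\<bar>\<nu>\<bar> < \<rho>" "1 / (4 * B) \<le> ?e \<nu>" using \<nu> by blast
      have "ereal (1 / (4 * B)) \<le> ereal (?e \<nu>)" using \<nu>'(2) by simp
      also have "\<dots> \<le> local_sup_error X R rhat A t \<sigma> \<theta> \<rho> n K \<delta>"
        by (rule local_sup_error_ge[OF \<nu>'(1) elim(3)])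
      finally show "ereal (1 / (4 * B)) \<le> local_sup_error X R rhat A t \<sigma> \<theta> \<rho> n K \<delta>" .
    qed
  qed
  then have "ereal (1 / (4 * B)) \<le> liminf (\<lambda>n. INF K\<in>estimators n. local_sup_error X R rhat A t \<sigma> \<theta> \<rho> n K \<delta>)"
    by (rule Liminf_bounded)
  moreover have "0 < ereal (1 / (4 * B))" using B by simp
  ultimately show ?thesis by (rule less_le_trans[rotated])
qed

text \<open>When the two laws are close in total variation the probabilities of failure add up to almost \<open>1\<close>,
  so one of them is almost \<open>1 / 2\<close>.\<close>
lemma local_minimax_error_near_half:
  fixes X :: "nat \<Rightarrow> nat \<Rightarrow> real^'p" and A :: "real^'p^'k"
  assumes \<sigma>: "\<sigma> > 0" and des: "design X Q" and z: "z < 1 / 2"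
    and \<nu>: "\<bar>\<nu>\<^sub>1\<bar> < \<rho>" "\<bar>\<nu>\<^sub>2\<bar> < \<rho>"
    and close: "sqrt (exp ((\<nu>\<^sub>2 - \<nu>\<^sub>1)\<^sup>2 * Q $ i $ i / \<sigma>\<^sup>2) - 1) < 1 - 2 * z"
    and lim: "(\<lambda>n. pms_cdf X R rhat A n (local_param \<theta> i n \<nu>\<^sub>1) \<sigma> t) \<longlonglongrightarrow> g\<^sub>1"
      "(\<lambda>n. pms_cdf X R rhat A n (local_param \<theta> i n \<nu>\<^sub>2) \<sigma> t) \<longlonglongrightarrow> g\<^sub>2"
    and gap: "2 * \<delta> < \<bar>g\<^sub>1 - g\<^sub>2\<bar>"
  shows "liminf (\<lambda>n. INF K\<in>estimators n. local_sup_error X R rhat A t \<sigma> \<theta> \<rho> n K \<delta>) \<ge> ereal z"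
proof -
  let ?k = "\<lambda>n \<nu>. pms_cdf X R rhat A n (local_param \<theta> i n \<nu>) \<sigma> t"
  define C where "C n = exp ((\<nu>\<^sub>2 - \<nu>\<^sub>1)\<^sup>2 * scaled_gram X n $ i $ i / \<sigma>\<^sup>2)" for n
  have "(\<lambda>n. sqrt (C n - 1)) \<longlonglongrightarrow> sqrt (exp ((\<nu>\<^sub>2 - \<nu>\<^sub>1)\<^sup>2 * Q $ i $ i / \<sigma>\<^sup>2) - 1)"
    unfolding C_def by (intro tendsto_real_sqrt tendsto_diff tendsto_const likelihood_constant_tendsto[OF des \<sigma>])
  then have "\<forall>\<^sub>F n in sequentially. sqrt (C n - 1) < 1 - 2 * z" using close by (rule order_tendstoD)
  moreover have "\<forall>\<^sub>F n in sequentially. 2 * \<delta> < \<bar>?k n \<nu>\<^sub>1 - ?k n \<nu>\<^sub>2\<bar>" by (rule eventually_gap[OF lim gap])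
  ultimately have "\<forall>\<^sub>F n in sequentially. ereal z
      \<le> (INF K\<in>estimators n. local_sup_error X R rhat A t \<sigma> \<theta> \<rho> n K \<delta>)"
    using eventually_gt_at_top[of 0]
  proof eventually_elim
    case (elim n)
    show ?case
    proof (rule INF_greatest)
      fix K assume K: "K \<in> estimators n"
      let ?e = "\<lambda>\<nu>. error_prob X R rhat A t \<sigma> n K \<delta> (local_param \<theta> i n \<nu>)"
      have "1 - sqrt (C n - 1) \<le> ?e \<nu>\<^sub>1 + ?e \<nu>\<^sub>2"
        using two_point_bound(1)[OF \<sigma> elim(3) K elim(2)] by (simp only: C_def)
      then have "z \<le> ?e \<nu>\<^sub>1 \<or> z \<le> ?e \<nu>\<^sub>2" using elim(1) by linarith
      then obtain \<nu> where \<nu>': "\<bar>\<nu>\<bar> < \<rho>" "z \<le> ?e \<nu>" using \<nu> by blast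
      have "ereal z \<le> ereal (?e \<nu>)" using \<nu>'(2) by simp
      also have "\<dots> \<le> local_sup_error X R rhat A t \<sigma> \<theta> \<rho> n K \<delta>"
        by (rule local_sup_error_ge[OF \<nu>'(1) elim(3)])
      finally show "ereal z \<le> local_sup_error X R rhat A t \<sigma> \<theta> \<rho> n K \<delta>" .
    qed
  qed
  then show ?thesis by (rule Liminf_bounded)
qed

lemma likelihood_constant_small:
  assumes "\<kappa> > (0::real)"
  obtains \<eta> where "\<eta> > 0" "\<And>h. \<bar>h\<bar> < \<eta> \<Longrightarrow> sqrt (exp (h\<^sup>2 * q / s) - 1) < \<kappa>"
proof -
  have "((\<lambda>h. sqrt (exp (h\<^sup>2 * q / s) - 1)) \<longlongrightarrow> sqrt (exp (0\<^sup>2 * q / s) - 1)) (nhds 0)"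
    unfolding divide_inverse by (intro tendsto_intros filterlim_ident)
  then have "\<forall>\<^sub>F h in nhds 0. sqrt (exp (h\<^sup>2 * q / s) - 1) < \<kappa>"
    by (rule order_tendstoD) (use assms in simp)
  then show ?thesis using that by (auto simp: eventually_nhds_metric dist_real_def)
qed

lemma card_complement_singleton:
  fixes r :: "'p::finite set"
  assumes "card r = CARD('p) - 1"
  shows "r = UNIV - {zero_index r}"
proof -
  have "card (UNIV - r) = CARD('p) - card r" by (rule card_Diff_subset) auto
  then have "card (UNIV - r) = 1" using assms by (simp add: Suc_leI zero_less_card_finite)
  then obtain i where i: "UNIV - r = {i}" by (rule card_1_singletonE)
  then have r: "r = UNIV - {i}" by blast
  then have "zero_index r = i" by (simp add: zero_index_def)
  with r show ?thesis by simp
qed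

theorem theorem3p1:
  fixes A :: "real^'p^'k" and Q :: "real^'p^'p" and t :: "real^'k" and \<sigma> c :: real
  assumes "rank A = CARD('k)" and "0 < \<sigma>"
  shows "\<exists>\<delta>\<^sub>0>0. \<exists>\<rho>\<^sub>0>0.
    \<forall>(X :: nat \<Rightarrow> nat \<Rightarrow> real^'p) (R :: 'p set set) (rhat :: nat \<Rightarrow> (nat \<Rightarrow> real) \<Rightarrow> 'p set)
      (r :: 'p set) (\<theta> :: real^'p).
      design X Q \<and> candidate_models R \<and> selection_procedure R rhat \<and> assumption_S X R rhat \<and>
      r \<in> R \<and> card r = CARD('p) - 1 \<and> S_constant X rhat r c \<and>
      A *v (matrix_inv Q *v axis (zero_index r) 1) \<noteq> 0 \<and>
      one_zero_point r \<theta> \<longrightarrow>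
        (\<forall>K. (\<forall>n>CARD('p). K n \<in> estimators n) \<and>
             (\<forall>\<delta>>0. (\<lambda>n. error_prob X R rhat A t \<sigma> n (K n) \<delta> \<theta>) \<longlonglongrightarrow> 0) \<longrightarrow>
             (\<lambda>n. local_sup_error X R rhat A t \<sigma> \<theta> \<rho>\<^sub>0 n (K n) \<delta>\<^sub>0) \<longlonglongrightarrow> 1) \<and>
        liminf (\<lambda>n. INF K\<in>estimators n. local_sup_error X R rhat A t \<sigma> \<theta> \<rho>\<^sub>0 n K \<delta>\<^sub>0) > 0 \<and>
        (SUP \<delta>\<in>{0<..}. liminf (\<lambda>n. INF K\<in>estimators n.
            local_sup_error X R rhat A t \<sigma> \<theta> \<rho>\<^sub>0 n K \<delta>)) \<ge> 1 / 2"
proof -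
  note rank = assms(1) and \<sigma> = assms(2)
  \<comment> \<open>A factor exists as soon as some design satisfies the hypotheses.\<close>
  define L :: "real^'p^'p" where "L = (SOME L. L ** transpose L = \<sigma>\<^sup>2 *\<^sub>R matrix_inv Q)"
  define G where "G i = limit_cdf A t (drop_dir Q i) i (c * \<sigma> * sqrt (matrix_inv Q $ i $ i)) ((*v) L)" for i
  define E where "E i = boundary_points t (A *v drop_dir Q i)" for i
  define regular where "regular i \<longleftrightarrow> L ** transpose L = \<sigma>\<^sup>2 *\<^sub>R matrix_inv Q \<and> invertible Q \<and> c > 0 \<and>
    A *v (matrix_inv Q *v axis i 1) \<noteq> 0" for i
  let ?sep = "\<lambda>i \<delta> \<rho>. \<exists>\<nu>\<^sub>1 \<nu>\<^sub>2. \<nu>\<^sub>1 \<notin> E i \<and> \<nu>\<^sub>2 \<notin> E i \<and> \<bar>\<nu>\<^sub>1\<bar> < \<rho> \<and> \<bar>\<nu>\<^sub>2\<bar> < \<rho> \<and> 4 * \<delta> < \<bar>G i \<nu>\<^sub>1 - G i \<nu>\<^sub>2\<bar>"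
  have "\<exists>\<delta> \<rho>. \<delta> > 0 \<and> \<rho> > 0 \<and> (regular i \<longrightarrow> ?sep i \<delta> \<rho>)" for i
  proof (cases "regular i")
    case True
    then obtain \<nu>\<^sub>1 \<nu>\<^sub>2 where *: "\<nu>\<^sub>1 \<notin> E i" "\<nu>\<^sub>2 \<notin> E i" "G i \<nu>\<^sub>1 \<noteq> G i \<nu>\<^sub>2"
      using limit_cdf_two_values[OF rank \<sigma>, of c Q L i t] unfolding regular_def G_def E_def by blast
    define \<delta> where "\<delta> = \<bar>G i \<nu>\<^sub>1 - G i \<nu>\<^sub>2\<bar> / 5"
    define \<rho> where "\<rho> = \<bar>\<nu>\<^sub>1\<bar> + \<bar>\<nu>\<^sub>2\<bar> + 1"
    have "\<delta> > 0" "4 * \<delta> < \<bar>G i \<nu>\<^sub>1 - G i \<nu>\<^sub>2\<bar>" using *(3) by (simp_all add: \<delta>_def)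
    moreover have "\<rho> > 0" "\<bar>\<nu>\<^sub>1\<bar> < \<rho>" "\<bar>\<nu>\<^sub>2\<bar> < \<rho>" by (simp_all add: \<rho>_def)
    ultimately show ?thesis using * by blast
  qed (auto intro: exI[of _ 1])
  then obtain \<delta> \<rho> where \<delta>\<rho>: "\<And>i. \<delta> i > 0" "\<And>i. \<rho> i > 0" "\<And>i. regular i \<Longrightarrow> ?sep i (\<delta> i) (\<rho> i)"
    by metis
  \<comment> \<open>One choice of the constants serves the finitely many possible positions \<open>i\<close> of the zero.\<close>
  define \<delta>\<^sub>0 where "\<delta>\<^sub>0 = Min (range \<delta>)"
  define \<rho>\<^sub>0 where "\<rho>\<^sub>0 = Max (range \<rho>)"
  have \<delta>\<^sub>0: "\<delta>\<^sub>0 > 0" "\<delta>\<^sub>0 \<le> \<delta> i" for i using \<delta>\<rho>(1) by (auto simp: \<delta>\<^sub>0_def)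
  have \<rho>\<^sub>0: "\<rho> i \<le> \<rho>\<^sub>0" for i by (auto simp: \<rho>\<^sub>0_def)
  have \<rho>\<^sub>0_pos: "\<rho>\<^sub>0 > 0" using \<delta>\<rho>(2) \<rho>\<^sub>0 by (meson less_le_trans)
  show ?thesis
  proof (rule exI[of _ \<delta>\<^sub>0], rule conjI[OF \<delta>\<^sub>0(1)], rule exI[of _ \<rho>\<^sub>0], rule conjI[OF \<rho>\<^sub>0_pos],
      intro allI impI conjI)
    fix X :: "nat \<Rightarrow> nat \<Rightarrow> real^'p" and R :: "'p set set" and rhat and r :: "'p set" and \<theta> :: "real^'p"
    assume hyp: "design X Q \<and> candidate_models R \<and> selection_procedure R rhat \<and> assumption_S X R rhat \<and>
      r \<in> R \<and> card r = CARD('p) - 1 \<and> S_constant X rhat r c \<and>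
      A *v (matrix_inv Q *v axis (zero_index r) 1) \<noteq> 0 \<and> one_zero_point r \<theta>"
    define i where "i = zero_index r"
    have r: "r = UNIV - {i}" unfolding i_def using hyp by (intro card_complement_singleton) blast
    have des: "design X Q" and sel: "selection_procedure R rhat" and S: "S_constant X rhat (UNIV - {i}) c"
      and ozp: "one_zero_point (UNIV - {i}) \<theta>" and A: "A *v (matrix_inv Q *v axis i 1) \<noteq> 0"
      using hyp unfolding i_def[symmetric] r[symmetric] by simp_all
    have L: "L ** transpose L = \<sigma>\<^sup>2 *\<^sub>R matrix_inv Q"
      unfolding L_def by (rule someI_ex[OF design_factor[OF des \<sigma>]])
    have "regular i"
      unfolding regular_def using L des S A by (simp add: design_def S_constant_def)
    then obtain \<nu>\<^sub>1 \<nu>\<^sub>2 where \<nu>E: "\<nu>\<^sub>1 \<notin> E i" "\<nu>\<^sub>2 \<notin> E i" and \<nu>: "\<bar>\<nu>\<^sub>1\<bar> < \<rho> i" "\<bar>\<nu>\<^sub>2\<bar> < \<rho> i"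
      and gap: "4 * \<delta> i < \<bar>G i \<nu>\<^sub>1 - G i \<nu>\<^sub>2\<bar>"
      using \<delta>\<rho>(3) by blast
    have \<nu>\<rho>: "\<bar>\<nu>\<^sub>1\<bar> < \<rho>\<^sub>0" "\<bar>\<nu>\<^sub>2\<bar> < \<rho>\<^sub>0" using \<nu> \<rho>\<^sub>0[of i] by linarith+
    have gap4: "4 * \<delta>\<^sub>0 < \<bar>G i \<nu>\<^sub>1 - G i \<nu>\<^sub>2\<bar>" using gap \<delta>\<^sub>0(2)[of i] by linarith
    have lim: "(\<lambda>n. pms_cdf X R rhat A n (local_param \<theta> i n \<nu>) \<sigma> t) \<longlonglongrightarrow> G i \<nu>" if "\<nu> \<notin> E i" for \<nu>
      unfolding G_def by (rule pms_cdf_tendsto[OF rank \<sigma> des sel S ozp L that[unfolded E_def]])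
    show "(\<lambda>n. local_sup_error X R rhat A t \<sigma> \<theta> \<rho>\<^sub>0 n (K n) \<delta>\<^sub>0) \<longlonglongrightarrow> 1"
      if "(\<forall>n>CARD('p). K n \<in> estimators n) \<and>
          (\<forall>\<delta>>0. (\<lambda>n. error_prob X R rhat A t \<sigma> n (K n) \<delta> \<theta>) \<longlonglongrightarrow> 0)" for K
      using that \<delta>\<^sub>0(1)
      by (intro consistent_estimator_fails_locally[OF \<sigma> des \<delta>\<^sub>0(1) \<nu>\<rho> lim[OF \<nu>E(1)] lim[OF \<nu>E(2)] gap4]) auto
    show "liminf (\<lambda>n. INF K\<in>estimators n. local_sup_error X R rhat A t \<sigma> \<theta> \<rho>\<^sub>0 n K \<delta>\<^sub>0) > 0"
      using gap4 \<delta>\<^sub>0(1) by (intro local_minimax_error_pos[OF \<sigma> des \<nu>\<rho> lim[OF \<nu>E(1)] lim[OF \<nu>E(2)]]) linarith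
    show "(SUP \<delta>\<in>{0<..}. liminf (\<lambda>n. INF K\<in>estimators n.
            local_sup_error X R rhat A t \<sigma> \<theta> \<rho>\<^sub>0 n K \<delta>)) \<ge> 1 / 2"
    proof (rule dense_le)
      fix w :: ereal assume w: "w < 1 / 2"
      show "w \<le> (SUP \<delta>\<in>{0<..}. liminf (\<lambda>n. INF K\<in>estimators n.
            local_sup_error X R rhat A t \<sigma> \<theta> \<rho>\<^sub>0 n K \<delta>))"
      proof (cases w)
        case (real z)
        have half: "(1 / 2 :: ereal) = ereal (1 / 2)" by (simp add: one_ereal_def)
        have z: "z < 1 / 2" using w unfolding real half by simp
        then obtain \<eta> where \<eta>: "\<eta> > 0"
          and small: "\<And>h. \<bar>h\<bar> < \<eta> \<Longrightarrow> sqrt (exp (h\<^sup>2 * Q $ i $ i / \<sigma>\<^sup>2) - 1) < 1 - 2 * z"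
          using likelihood_constant_small[of "1 - 2 * z" "Q $ i $ i" "\<sigma>\<^sup>2"] by auto
        \<comment> \<open>Between \<open>\<nu>\<^sub>1\<close> and \<open>\<nu>\<^sub>2\<close> there are alternatives with distinct limits and laws as close as desired.\<close>
        define a b where "a = min \<nu>\<^sub>1 \<nu>\<^sub>2" and "b = max \<nu>\<^sub>1 \<nu>\<^sub>2"
        have ab: "a \<notin> E i" "b \<notin> E i" "a \<le> b" "\<bar>a\<bar> < \<rho>\<^sub>0" "\<bar>b\<bar> < \<rho>\<^sub>0" "G i a \<noteq> G i b"
          using \<nu>E \<nu>\<rho> gap4 \<delta>\<^sub>0(1) by (auto simp: a_def b_def min_def max_def)
        have finE: "finite (E i)" unfolding E_def by (rule finite_boundary_points)
        obtain x y where xy: "x \<notin> E i" "y \<notin> E i" "a \<le> x" "x \<le> b" "a \<le> y" "y \<le> b" "\<bar>y - x\<bar> < \<eta>"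
          "G i x \<noteq> G i y"
          using close_points_with_different_values[OF finE ab(1,2,3,6) \<eta>] by blast
        define d where "d = \<bar>G i x - G i y\<bar> / 3"
        have d: "d > 0" "2 * d < \<bar>G i x - G i y\<bar>" using xy(8) by (simp_all add: d_def)
        have xy\<rho>: "\<bar>x\<bar> < \<rho>\<^sub>0" "\<bar>y\<bar> < \<rho>\<^sub>0" using xy ab by linarith+
        have "w \<le> liminf (\<lambda>n. INF K\<in>estimators n. local_sup_error X R rhat A t \<sigma> \<theta> \<rho>\<^sub>0 n K d)"
          unfolding real
          by (rule local_minimax_error_near_half[OF \<sigma> des z xy\<rho> small[OF xy(7)] lim[OF xy(1)] lim[OF xy(2)] d(2)])
        also have "\<dots> \<le> (SUP \<delta>\<in>{0<..}. liminf (\<lambda>n. INF K\<in>estimators n.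
            local_sup_error X R rhat A t \<sigma> \<theta> \<rho>\<^sub>0 n K \<delta>))"
          using d(1) by (intro SUP_upper) simp
        finally show ?thesis .
      qed (use w in auto)
    qed
  qed
qed

end
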